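(* Let $X$ be a non-empty dense-in-itself metric space. (1) The Hilbert system $\mathrm{KD4G}_1\mathrm{.UC}$ is complete over $X$ for $\mathcal L_{[d]\forall}$-formulas, and sound if $X$ is connected and validates $\mathrm G_1$. (2) The Hilbert system $\mathrm{KD4G}_1t\mathrm{.UC}$ is complete over $X$ for $\mathcal L_{[d]\forall}^{\langle dt\rangle}$-formulas, and sound if $X$ is connected and validates $\mathrm G_1$.
   Context: A metric space is regarded as a topological space with its metric topology; a space is dense in itself if no singleton subset is open, and connected if it is not the union of two disjoint non-empty open sets. For $S\subseteq X$, $\langle d\rangle S=\{x\in X: S\cap O\setminus\{x\}\neq\emptyset\text{ for every open neighbourhood }O\text{ of }x\}$. LANGUAGES. $\mathsf{Var}$ is a fixed set of propositional variables (atoms). $\mathcal L_{[d]\forall}^{\langle dt\rangle}$-formulas: atoms; $\top$; $\neg\varphi$; $\varphi\wedge\psi$; $[d]\varphi$; $\forall\varphi$; and $\langle dt\rangle\Delta$ for each non-empty finite set $\Delta$ of formulas. $\mathcal L_{[d]\forall}$-formulas are those not involving $\langle dt\rangle$. Abbreviations: $\vee,\to,\leftrightarrow$ as usual, $\langle d\rangle\varphi=\neg[d]\neg\varphi$, $\exists\varphi=\neg\forall\neg\varphi$, $\Box^*\varphi=\varphi\wedge[d]\varphi$. SEMANTICS. An assignment into $X$ is a map $h:\mathsf{Var}\to\wp(X)$. Truth $(X,h),x\models\varphi$ at $x\in X$: atoms $p$ are true iff $x\in h(p)$; $\top$ and Booleans as usual; $[d]\varphi$ is true at $x$ iff some open neighbourhood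 $O$ of $x$ has $\varphi$ true at every $y\in O\setminus\{x\}$; $\forall\varphi$ is true at $x$ iff $\varphi$ is true at every $y\in X$; $\langle dt\rangle\Delta$ is true at $x$ iff there is $S\subseteq X$ with $x\in S\subseteq\bigcap_{\delta\in\Delta}\langle d\rangle([\![\delta]\!]\cap S)$, where $[\![\delta]\!]=\{y\in X:(X,h),y\models\delta\}$. A formula is valid in $X$ if it is true at every point of $X$ under every assignment into $X$; $X$ validates a scheme if all its instances are valid in $X$. SYSTEMS. $\mathrm G_1$ is the scheme of all formulas $[d](\Box^*Q_0\vee\Box^*Q_1)\to([d]\neg Q_0\vee[d]\neg Q_1)$, where $Q_0=\varphi_0\wedge\neg\varphi_1$, $Q_1=\varphi_1\wedge\neg\varphi_0$, and $\varphi_0,\varphi_1$ are arbitrary formulas. $\mathrm{KD4G}_1\mathrm{.UC}$ (for $\mathcal L_{[d]\forall}$): axioms are all instances of propositional tautologies; $[d](\varphi\to\psi)\to([d]\varphi\to[d]\psi)$; $\langle d\rangle\top$; $[d]\varphi\to[d][d]\varphi$; $\mathrm G_1$; the S5 axioms for $\forall$ ($\forall(\varphi\to\psi)\to(\forall\varphi\to\forall\psi)$, $\forall\varphi\to\varphi$, $\forall\varphi\to\forall\forall\varphi$, $\varphi\to\forall\exists\varphi$); (U) $\forall\varphi\to[d]\varphi$; (C) $\forall(\Box^*\varphi\vee\Box^*\neg\varphi)\to(\forall\varphi\vee\forall\neg\varphi)$. Rules: modus ponens; from $\varphi$ infer $[d]\varphi$; from $\varphi$ infer $\forall\varphi$.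 $\mathrm{KD4G}_1t\mathrm{.UC}$ (for $\mathcal L_{[d]\forall}^{\langle dt\rangle}$) has the same schemes and rules (for formulas of this language) plus (Fix) $\langle dt\rangle\Gamma\to\langle d\rangle(\gamma\wedge\langle dt\rangle\Gamma)$ for each $\gamma\in\Gamma$, and (Ind) $\Box^*(\varphi\to\bigwedge_{\gamma\in\Gamma}\langle d\rangle(\gamma\wedge\varphi))\to(\varphi\to\langle dt\rangle\Gamma)$. A Hilbert system is sound over $X$ if all its theorems are valid in $X$, and complete over $X$ if every formula of its language that is valid in $X$ is a theorem. *)

theory Defs
  imports "HOL-Analysis.Analysis" "HOL-Library.FSet"
begin

section \<open>Languages\<close>

text \<open>
  The raw type also contains \<open>Tangle {||}\<close>; the two languages below exclude it.
  The propositional variables are the elements of the arbitrary type \<open>'v\<close>.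
\<close>

datatype 'v fm =
    Atom 'v
  | Top
  | Neg "'v fm"  (\<open>\<^bold>\<not> _\<close> [80] 80)
  | Conj "'v fm" "'v fm"  (infixr \<open>\<^bold>\<and>\<close> 65)
  | Box "'v fm"  (\<open>\<^bold>[d\<^bold>] _\<close> [80] 80)
  | Univ "'v fm"  (\<open>\<^bold>\<forall> _\<close> [80] 80)
  | Tangle "'v fm fset"  (\<open>\<^bold>\<langle>dt\<^bold>\<rangle> _\<close> [80] 80)

abbreviation Disj :: "'v fm \<Rightarrow> 'v fm \<Rightarrow> 'v fm"  (infixr \<open>\<^bold>\<or>\<close> 60)
  where "\<phi> \<^bold>\<or> \<psi> \<equiv> \<^bold>\<not> (\<^bold>\<not> \<phi> \<^bold>\<and> \<^bold>\<not> \<psi>)"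

abbreviation Imp :: "'v fm \<Rightarrow> 'v fm \<Rightarrow> 'v fm"  (infixr \<open>\<^bold>\<rightarrow>\<close> 55)
  where "\<phi> \<^bold>\<rightarrow> \<psi> \<equiv> \<^bold>\<not> (\<phi> \<^bold>\<and> \<^bold>\<not> \<psi>)"

abbreviation Dia :: "'v fm \<Rightarrow> 'v fm"  (\<open>\<^bold>\<langle>d\<^bold>\<rangle> _\<close> [80] 80)
  where "\<^bold>\<langle>d\<^bold>\<rangle> \<phi> \<equiv> \<^bold>\<not> \<^bold>[d\<^bold>] \<^bold>\<not> \<phi>"

abbreviation Exis :: "'v fm \<Rightarrow> 'v fm"  (\<open>\<^bold>\<exists> _\<close> [80] 80)
  where "\<^bold>\<exists> \<phi> \<equiv> \<^bold>\<not> \<^bold>\<forall> \<^bold>\<not> \<phi>"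

abbreviation BoxStar :: "'v fm \<Rightarrow> 'v fm"  (\<open>\<^bold>\<box>\<^sup>* _\<close> [80] 80)
  where "\<^bold>\<box>\<^sup>* \<phi> \<equiv> \<phi> \<^bold>\<and> \<^bold>[d\<^bold>] \<phi>"

fun Conjs :: "'v fm list \<Rightarrow> 'v fm"  (\<open>\<^bold>\<And> _\<close> [80] 80) where
  "\<^bold>\<And> [] = Top"
| "\<^bold>\<And> [\<phi>] = \<phi>"
| "\<^bold>\<And> (\<phi> # \<psi> # \<phi>s) = \<phi> \<^bold>\<and> \<^bold>\<And> (\<psi> # \<phi>s)"

inductive_set lang_dt :: "'v fm set" where
  "Atom p \<in> lang_dt"
| "Top \<in> lang_dt"
| "\<phi> \<in> lang_dt \<Longrightarrow> \<^bold>\<not> \<phi> \<in> lang_dt"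
| "\<phi> \<in> lang_dt \<Longrightarrow> \<psi> \<in> lang_dt \<Longrightarrow> \<phi> \<^bold>\<and> \<psi> \<in> lang_dt"
| "\<phi> \<in> lang_dt \<Longrightarrow> \<^bold>[d\<^bold>] \<phi> \<in> lang_dt"
| "\<phi> \<in> lang_dt \<Longrightarrow> \<^bold>\<forall> \<phi> \<in> lang_dt"
| "\<Delta> \<noteq> {||} \<Longrightarrow> (\<And>\<delta>. \<delta> |\<in>| \<Delta> \<Longrightarrow> \<delta> \<in> lang_dt) \<Longrightarrow> \<^bold>\<langle>dt\<^bold>\<rangle> \<Delta> \<in> lang_dt"

inductive_set lang_d :: "'v fm set" where
  "Atom p \<in> lang_d"
| "Top \<in> lang_d"
| "\<phi> \<in> lang_d \<Longrightarrow> \<^bold>\<not> \<phi> \<in> lang_d"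
| "\<phi> \<in> lang_d \<Longrightarrow> \<psi> \<in> lang_d \<Longrightarrow> \<phi> \<^bold>\<and> \<psi> \<in> lang_d"
| "\<phi> \<in> lang_d \<Longrightarrow> \<^bold>[d\<^bold>] \<phi> \<in> lang_d"
| "\<phi> \<in> lang_d \<Longrightarrow> \<^bold>\<forall> \<phi> \<in> lang_d"

section \<open>Semantics\<close>

definition dense_in_itself :: "'x topology \<Rightarrow> bool" where
  "dense_in_itself X \<longleftrightarrow> (\<forall>x \<in> topspace X. \<not> openin X {x})"

text \<open>
  The library's \<open>X derived_set_of S\<close> is the set \<open>\<langle>d\<rangle>S\<close> of limit points of \<open>S\<close> in \<open>X\<close>.
\<close>

function truth :: "'x topology \<Rightarrow> ('v \<Rightarrow> 'x set) \<Rightarrow> 'x \<Rightarrow> 'v fm \<Rightarrow> bool" where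
  "truth X h x (Atom p) \<longleftrightarrow> x \<in> h p"
| "truth X h x Top \<longleftrightarrow> True"
| "truth X h x (\<^bold>\<not> \<phi>) \<longleftrightarrow> \<not> truth X h x \<phi>"
| "truth X h x (\<phi> \<^bold>\<and> \<psi>) \<longleftrightarrow> truth X h x \<phi> \<and> truth X h x \<psi>"
| "truth X h x (\<^bold>[d\<^bold>] \<phi>) \<longleftrightarrow>
     (\<exists>U. openin X U \<and> x \<in> U \<and> (\<forall>y \<in> U - {x}. truth X h y \<phi>))"
| "truth X h x (\<^bold>\<forall> \<phi>) \<longleftrightarrow> (\<forall>y \<in> topspace X. truth X h y \<phi>)"
| "truth X h x (\<^bold>\<langle>dt\<^bold>\<rangle> \<Delta>) \<longleftrightarrow>
     (\<exists>S \<subseteq> topspace X. x \<in> S \<and>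
        (\<forall>\<delta> |\<in>| \<Delta>. S \<subseteq> X derived_set_of ({y \<in> topspace X. truth X h y \<delta>} \<inter> S)))"
  by pat_completeness auto

lemma size_less_size_Tangle: "\<delta> |\<in>| \<Delta> \<Longrightarrow> size \<delta> < size (\<^bold>\<langle>dt\<^bold>\<rangle> \<Delta>)"
  using member_le_sum[of \<delta> "fset \<Delta>" "\<lambda>\<delta>. Suc (size \<delta>)"] by simp

termination truth
  by (relation "Wellfounded.measure (\<lambda>(X, h, x, \<phi>). size \<phi>)")
     (auto simp del: fm.size(14) intro: size_less_size_Tangle)

definition valid :: "'x topology \<Rightarrow> 'v fm \<Rightarrow> bool" where
  "valid X \<phi> \<longleftrightarrow>
     (\<forall>h. (\<forall>p. h p \<subseteq> topspace X) \<longrightarrow> (\<forall>x \<in> topspace X. truth X h x \<phi>))"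

text \<open>A scheme is represented by the set of its instances.\<close>

definition validates :: "'x topology \<Rightarrow> 'v fm set \<Rightarrow> bool" where
  "validates X \<Sigma> \<longleftrightarrow> (\<forall>\<phi> \<in> \<Sigma>. valid X \<phi>)"

section \<open>Hilbert systems\<close>

text \<open>
  An instance of a propositional tautology arises by substituting formulas for the
  letters of a propositional formula that is true under all Boolean valuations.
\<close>

datatype pfm = PLetter nat | PTop | PNeg pfm | PConj pfm pfm

primrec peval :: "(nat \<Rightarrow> bool) \<Rightarrow> pfm \<Rightarrow> bool" where
  "peval v (PLetter n) \<longleftrightarrow> v n"
| "peval v PTop \<longleftrightarrow> True"
| "peval v (PNeg P) \<longleftrightarrow> \<not> peval v P"
| "peval v (PConj P Q) \<longleftrightarrow> peval v P \<and> peval v Q"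

primrec psubst :: "(nat \<Rightarrow> 'v fm) \<Rightarrow> pfm \<Rightarrow> 'v fm" where
  "psubst s (PLetter n) = s n"
| "psubst s PTop = Top"
| "psubst s (PNeg P) = \<^bold>\<not> psubst s P"
| "psubst s (PConj P Q) = psubst s P \<^bold>\<and> psubst s Q"

definition Taut :: "'v fm set" where
  "Taut = {psubst s P | s P. \<forall>v. peval v P}"

definition G1 :: "'v fm set" where
  "G1 = {\<^bold>[d\<^bold>] (\<^bold>\<box>\<^sup>* Q0 \<^bold>\<or> \<^bold>\<box>\<^sup>* Q1) \<^bold>\<rightarrow> (\<^bold>[d\<^bold>] \<^bold>\<not> Q0 \<^bold>\<or> \<^bold>[d\<^bold>] \<^bold>\<not> Q1) | Q0 Q1 \<phi>0 \<phi>1.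
          Q0 = \<phi>0 \<^bold>\<and> \<^bold>\<not> \<phi>1 \<and> Q1 = \<phi>1 \<^bold>\<and> \<^bold>\<not> \<phi>0}"

definition KD4_axioms :: "'v fm set" where
  "KD4_axioms =
     {\<^bold>[d\<^bold>] (\<phi> \<^bold>\<rightarrow> \<psi>) \<^bold>\<rightarrow> (\<^bold>[d\<^bold>] \<phi> \<^bold>\<rightarrow> \<^bold>[d\<^bold>] \<psi>) | \<phi> \<psi>. True} \<union>
     {\<^bold>\<langle>d\<^bold>\<rangle> Top} \<union>
     {\<^bold>[d\<^bold>] \<phi> \<^bold>\<rightarrow> \<^bold>[d\<^bold>] \<^bold>[d\<^bold>] \<phi> | \<phi>. True}"

definition S5_axioms :: "'v fm set" where
  "S5_axioms =
     {\<^bold>\<forall> (\<phi> \<^bold>\<rightarrow> \<psi>) \<^bold>\<rightarrow> (\<^bold>\<forall> \<phi> \<^bold>\<rightarrow> \<^bold>\<forall> \<psi>) | \<phi> \<psi>. True} \<union>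
     {\<^bold>\<forall> \<phi> \<^bold>\<rightarrow> \<phi> | \<phi>. True} \<union>
     {\<^bold>\<forall> \<phi> \<^bold>\<rightarrow> \<^bold>\<forall> \<^bold>\<forall> \<phi> | \<phi>. True} \<union>
     {\<phi> \<^bold>\<rightarrow> \<^bold>\<forall> \<^bold>\<exists> \<phi> | \<phi>. True}"

definition U_axioms :: "'v fm set" where
  "U_axioms = {\<^bold>\<forall> \<phi> \<^bold>\<rightarrow> \<^bold>[d\<^bold>] \<phi> | \<phi>. True}"

definition C_axioms :: "'v fm set" where
  "C_axioms = {\<^bold>\<forall> (\<^bold>\<box>\<^sup>* \<phi> \<^bold>\<or> \<^bold>\<box>\<^sup>* \<^bold>\<not> \<phi>) \<^bold>\<rightarrow> (\<^bold>\<forall> \<phi> \<^bold>\<or> \<^bold>\<forall> \<^bold>\<not> \<phi>) | \<phi>. True}"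

definition Fix_axioms :: "'v fm set" where
  "Fix_axioms = {\<^bold>\<langle>dt\<^bold>\<rangle> \<Gamma> \<^bold>\<rightarrow> \<^bold>\<langle>d\<^bold>\<rangle> (\<gamma> \<^bold>\<and> \<^bold>\<langle>dt\<^bold>\<rangle> \<Gamma>) | \<Gamma> \<gamma>. \<gamma> |\<in>| \<Gamma>}"

text \<open>
  The conjunction over the finite set \<open>\<Gamma>\<close> may be formed along any enumeration \<open>\<gamma>s\<close>
  of \<open>\<Gamma>\<close> without repetitions.
\<close>

definition Ind_axioms :: "'v fm set" where
  "Ind_axioms =
     {\<^bold>\<box>\<^sup>* (\<phi> \<^bold>\<rightarrow> \<^bold>\<And> (map (\<lambda>\<gamma>. \<^bold>\<langle>d\<^bold>\<rangle> (\<gamma> \<^bold>\<and> \<phi>)) \<gamma>s)) \<^bold>\<rightarrow> (\<phi> \<^bold>\<rightarrow> \<^bold>\<langle>dt\<^bold>\<rangle> \<Gamma>) | \<phi> \<Gamma> \<gamma>s.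
        distinct \<gamma>s \<and> fset_of_list \<gamma>s = \<Gamma>}"

text \<open>
  Theorems of the Hilbert system for the language \<open>L\<close> with axioms \<open>A\<close>. Restricting the
  axioms to \<open>L\<close> suffices, since the rules do not lead out of \<open>lang_d\<close> or \<open>lang_dt\<close>.
\<close>

inductive_set thms :: "'v fm set \<Rightarrow> 'v fm set \<Rightarrow> 'v fm set"
  for L :: "'v fm set" and A :: "'v fm set" where
  ax: "\<phi> \<in> A \<Longrightarrow> \<phi> \<in> L \<Longrightarrow> \<phi> \<in> thms L A"
| mp: "\<phi> \<in> thms L A \<Longrightarrow> \<phi> \<^bold>\<rightarrow> \<psi> \<in> thms L A \<Longrightarrow> \<psi> \<in> thms L A"
| nec_d: "\<phi> \<in> thms L A \<Longrightarrow> \<^bold>[d\<^bold>] \<phi> \<in> thms L A"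
| nec_univ: "\<phi> \<in> thms L A \<Longrightarrow> \<^bold>\<forall> \<phi> \<in> thms L A"

definition KD4G1_UC :: "'v fm set" where
  "KD4G1_UC =
     thms lang_d (Taut \<union> KD4_axioms \<union> G1 \<union> S5_axioms \<union> U_axioms \<union> C_axioms)"

definition KD4G1t_UC :: "'v fm set" where
  "KD4G1t_UC =
     thms lang_dt (Taut \<union> KD4_axioms \<union> G1 \<union> S5_axioms \<union> U_axioms \<union> C_axioms
                   \<union> Fix_axioms \<union> Ind_axioms)"

text \<open>Here a system is given by the set \<open>T\<close> of its theorems.\<close>

definition sound_over :: "'x topology \<Rightarrow> 'v fm set \<Rightarrow> bool" where
  "sound_over X T \<longleftrightarrow> (\<forall>\<phi> \<in> T. valid X \<phi>)"

definition complete_over :: "'x topology \<Rightarrow> 'v fm set \<Rightarrow> 'v fm set \<Rightarrow> bool" where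
  "complete_over X L T \<longleftrightarrow> (\<forall>\<phi> \<in> L. valid X \<phi> \<longrightarrow> \<phi> \<in> T)"

end

theory Submission
  imports Defs
begin

text \<open>
  A formula that is not a theorem fails in a maximal consistent set. Among the maximal consistent
  sets with the same universal formulas, a point is described by its type, that is the
  subformulas it contains, and by the set of types of its successors. If its own type is not among
  the latter, it becomes an irreflexive point of a finite frame, and its state records recursively
  the states of its successors; otherwise it becomes a reflexive point, unless its type lacks a tangle
  formula that a reflexive point of this type satisfies, in which case it is dropped. The larger
  clusters consist of types at which the set of visible types does not shrink, and (Ind) derives the
  tangle formulas that such a cluster satisfies. By \<open>G\<^sub>1\<close>, together with (Ind) for the dropped points,
  the successors of an irreflexive point form a connected frame, and by (C) so does the whole frame.

  A non-empty dense-in-itself metric space maps onto such a frame in such a way that the limit values of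
  the map at a point are exactly the successors of its value there, and such a map preserves truth. It
  is built by induction on the number of successors: a reflexive point is realized off an open set
  whose pieces realize its strict successors and accumulate at every other point, as in the
  dissection theorem of McKinsey and Tarski, and an irreflexive point is realized at
  the points of a discrete set.
\<close>

section \<open>Maximal consistent sets\<close>

text \<open>If irreflexive points were identified by type and view alone (the view being the set
  \<open>T\<close> of visible types), the successors of several points would be thrown together, and
  \<open>G1\<close> says nothing about the connectedness of such a union. This is why successor
  states are recorded. The recursion ends because an irreflexive successor has a strictly smaller
  view. Two loops with the same view do not see each other, even if the points behind them do.
  Connectedness is therefore measured by common successors and not by the relation itself: the
  states of related good points always have one. The topology asks for the same notion. A region
  filled from a reflexive \<open>c\<close> shows all of \<open>up c\<close> at its boundary, so
  regions filled from \<open>c\<close> and \<open>c'\<close> cannot in general be adjacent. They can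
  both adjoin a layer filled from a reflexive \<open>e\<close> above \<open>c\<close> and
  \<open>c'\<close>: what the layer shows at its boundary lies in \<open>up e\<close>, hence in
  \<open>up c\<close> and in \<open>up c'\<close>, and a boundary point may take either
  value.\<close>

fun skel :: "('v fm \<Rightarrow> nat) \<Rightarrow> 'v fm \<Rightarrow> pfm" where
  "skel i Top = PTop"
| "skel i (\<^bold>\<not> \<phi>) = PNeg (skel i \<phi>)"
| "skel i (\<phi> \<^bold>\<and> \<psi>) = PConj (skel i \<phi>) (skel i \<psi>)"
| "skel i \<phi> = PLetter (i \<phi>)"

fun primes :: "'v fm \<Rightarrow> 'v fm set" where
  "primes Top = {}"
| "primes (\<^bold>\<not> \<phi>) = primes \<phi>"
| "primes (\<phi> \<^bold>\<and> \<psi>) = primes \<phi> \<union> primes \<psi>"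
| "primes \<phi> = {\<phi>}"

definition boolean :: "('v fm \<Rightarrow> bool) \<Rightarrow> bool" where
  "boolean e \<longleftrightarrow> e Top \<and> (\<forall>\<phi>. e (\<^bold>\<not> \<phi>) \<longleftrightarrow> \<not> e \<phi>) \<and> (\<forall>\<phi> \<psi>. e (\<phi> \<^bold>\<and> \<psi>) \<longleftrightarrow> e \<phi> \<and> e \<psi>)"

text \<open>The maximal non-Boolean subformulas are numbered injectively and serve as letters, so
  substituting them back restores \<open>\<phi>\<close>. Every valuation of the letters induces,
  through \<open>skel\<close>, a Boolean valuation of all formulas, whatever \<open>i\<close> does
  outside \<open>primes \<phi>\<close>.\<close>

lemma Taut_if_boolean:
  assumes "\<And>e. boolean e \<Longrightarrow> e \<phi>"
  shows "\<phi> \<in> Taut"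
proof -
  have "finite (primes \<phi>)"
    by (induction \<phi> rule: primes.induct) auto
  then obtain i :: "'a fm \<Rightarrow> nat" where i: "inj_on i (primes \<phi>)"
    by (meson finite_imp_inj_to_nat_seg)
  have "primes \<psi> \<subseteq> primes \<phi> \<Longrightarrow> psubst (inv_into (primes \<phi>) i) (skel i \<psi>) = \<psi>" for \<psi>
    using i by (induction i \<psi> rule: skel.induct) auto
  moreover have "peval v (skel i \<phi>)" for v
    by (rule assms[of "\<lambda>\<psi>. peval v (skel i \<psi>)"]) (simp add: boolean_def)
  ultimately show ?thesis
    unfolding Taut_def by (smt (verit) mem_Collect_eq subset_refl)
qed

definition full_axioms :: "'v fm set" where
  "full_axioms = Taut \<union> KD4_axioms \<union> G1 \<union> S5_axioms \<union> U_axioms \<union> C_axioms \<union> Fix_axioms \<union> Ind_axioms"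

text \<open>Both languages meet these closure conditions, so one proof serves both systems. For
  tangle formulas only the passage to the members is demanded, which holds vacuously in
  \<open>lang_d\<close>.\<close>

locale tangle_logic =
  fixes L :: "'v fm set"
  assumes Top_L [simp]: "Top \<in> L"
    and Neg_L [simp]: "\<^bold>\<not> \<phi> \<in> L \<longleftrightarrow> \<phi> \<in> L"
    and Conj_L [simp]: "\<phi> \<^bold>\<and> \<psi> \<in> L \<longleftrightarrow> \<phi> \<in> L \<and> \<psi> \<in> L"
    and Box_L [simp]: "\<^bold>[d\<^bold>] \<phi> \<in> L \<longleftrightarrow> \<phi> \<in> L"
    and Univ_L [simp]: "\<^bold>\<forall> \<phi> \<in> L \<longleftrightarrow> \<phi> \<in> L"
    and Tangle_L: "\<^bold>\<langle>dt\<^bold>\<rangle> \<Delta> \<in> L \<Longrightarrow> \<delta> |\<in>| \<Delta> \<Longrightarrow> \<delta> \<in> L"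
    and Tangle_L_nonempty: "\<^bold>\<langle>dt\<^bold>\<rangle> \<Delta> \<in> L \<Longrightarrow> \<Delta> \<noteq> {||}"
begin

abbreviation Th :: "'v fm set" where
  "Th \<equiv> thms L full_axioms"

lemma Th_subset_L: "\<phi> \<in> Th \<Longrightarrow> \<phi> \<in> L"
  by (induction rule: thms.induct) auto

lemma Th_axiom: "\<phi> \<in> full_axioms \<Longrightarrow> \<phi> \<in> L \<Longrightarrow> \<phi> \<in> Th"
  by (rule thms.ax)

lemma Th_taut: "(\<And>e. boolean e \<Longrightarrow> e \<phi>) \<Longrightarrow> \<phi> \<in> L \<Longrightarrow> \<phi> \<in> Th"
  by (rule Th_axiom) (auto simp: full_axioms_def intro: Taut_if_boolean)

section \<open>Closed theories and Lindenbaum's lemma\<close>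

definition closed_theory :: "'v fm set \<Rightarrow> bool" where
  "closed_theory x \<longleftrightarrow> Th \<subseteq> x \<and> x \<subseteq> L \<and> (\<forall>\<phi> \<psi>. \<phi> \<in> x \<longrightarrow> \<phi> \<^bold>\<rightarrow> \<psi> \<in> x \<longrightarrow> \<psi> \<in> x)"

definition mcs :: "'v fm set \<Rightarrow> bool" where
  "mcs x \<longleftrightarrow> closed_theory x \<and> (\<forall>\<phi>\<in>L. \<^bold>\<not> \<phi> \<in> x \<longleftrightarrow> \<phi> \<notin> x)"

lemma closed_theory_mp: "closed_theory x \<Longrightarrow> \<phi> \<^bold>\<rightarrow> \<psi> \<in> x \<Longrightarrow> \<phi> \<in> x \<Longrightarrow> \<psi> \<in> x"
  unfolding closed_theory_def by blast

lemma closed_theory_taut: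
  "closed_theory x \<Longrightarrow> (\<And>e. boolean e \<Longrightarrow> e \<phi>) \<Longrightarrow> \<phi> \<in> L \<Longrightarrow> \<phi> \<in> x"
  using Th_taut unfolding closed_theory_def by blast

lemma closed_theory_Th: "closed_theory Th"
  using Th_subset_L thms.mp unfolding closed_theory_def by blast

text \<open>This plays the part of a deduction theorem: adding \<open>\<psi>\<close> to
  \<open>x\<close> yields what \<open>\<psi>\<close> implies in \<open>x\<close>.\<close>

lemma closed_theory_add:
  assumes x: "closed_theory x" and \<psi>: "\<psi> \<in> L"
  shows "closed_theory {\<theta>\<in>L. \<psi> \<^bold>\<rightarrow> \<theta> \<in> x}" (is "closed_theory ?y")
    and "x \<subseteq> {\<theta>\<in>L. \<psi> \<^bold>\<rightarrow> \<theta> \<in> x}" and "\<psi> \<in> {\<theta>\<in>L. \<psi> \<^bold>\<rightarrow> \<theta> \<in> x}"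
proof -
  show sub: "x \<subseteq> ?y"
  proof
    fix \<theta> assume "\<theta> \<in> x"
    moreover from this have "\<theta> \<in> L"
      using x unfolding closed_theory_def by blast
    moreover from this have "\<theta> \<^bold>\<rightarrow> (\<psi> \<^bold>\<rightarrow> \<theta>) \<in> x"
      using \<psi> by (intro closed_theory_taut[OF x]) (auto simp: boolean_def)
    ultimately show "\<theta> \<in> ?y"
      using x closed_theory_mp by blast
  qed
  show "\<psi> \<in> ?y"
    using \<psi> by (auto intro!: closed_theory_taut[OF x] simp: boolean_def)
  have "\<theta>' \<in> ?y" if "\<theta> \<in> ?y" "\<theta> \<^bold>\<rightarrow> \<theta>' \<in> ?y" for \<theta> \<theta>'
  proof -
    have "(\<psi> \<^bold>\<rightarrow> \<theta>) \<^bold>\<rightarrow> ((\<psi> \<^bold>\<rightarrow> (\<theta> \<^bold>\<rightarrow> \<theta>')) \<^bold>\<rightarrow> (\<psi> \<^bold>\<rightarrow> \<theta>')) \<in> x"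
      using that \<psi> by (intro closed_theory_taut[OF x]) (auto simp: boolean_def)
    then show ?thesis
      using that x closed_theory_mp by (smt (verit) Conj_L Neg_L mem_Collect_eq)
  qed
  then show "closed_theory ?y"
    using x sub unfolding closed_theory_def by blast
qed

text \<open>Zorn's lemma is applied to the theories that omit \<open>\<phi>\<close>. In a maximal
  one, every missing formula implies \<open>\<phi>\<close>; a formula and its negation cannot both
  do so, as \<open>\<phi>\<close> would follow.\<close>

lemma Lindenbaum:
  assumes x: "closed_theory x" and \<phi>: "\<phi> \<in> L" "\<phi> \<notin> x"
  obtains y where "mcs y" "x \<subseteq> y" "\<phi> \<notin> y"
proof -
  define A where "A = {y. closed_theory y \<and> x \<subseteq> y \<and> \<phi> \<notin> y}"
  have "\<Union>C \<in> A" if "C \<noteq> {}" "subset.chain A C" for C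
  proof -
    have C: "C \<subseteq> A" and ch: "\<And>a b. a \<in> C \<Longrightarrow> b \<in> C \<Longrightarrow> a \<subseteq> b \<or> b \<subseteq> a"
      using that(2) unfolding subset_chain_def by blast+
    have "\<psi>' \<in> \<Union>C" if "\<psi> \<in> \<Union>C" "\<psi> \<^bold>\<rightarrow> \<psi>' \<in> \<Union>C" for \<psi> \<psi>'
    proof -
      obtain a b where "a \<in> C" "b \<in> C" "\<psi> \<in> a" "\<psi> \<^bold>\<rightarrow> \<psi>' \<in> b"
        using \<open>\<psi> \<in> \<Union>C\<close> \<open>\<psi> \<^bold>\<rightarrow> \<psi>' \<in> \<Union>C\<close> by blast
      then obtain c where "c \<in> C" "\<psi> \<in> c" "\<psi> \<^bold>\<rightarrow> \<psi>' \<in> c"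
        using ch[of a b] by blast
      then show ?thesis
        using C closed_theory_mp unfolding A_def by blast
    qed
    then have "closed_theory (\<Union>C)"
      using C \<open>C \<noteq> {}\<close> unfolding closed_theory_def A_def by blast
    then show ?thesis
      using C \<open>C \<noteq> {}\<close> unfolding A_def by blast
  qed
  moreover have "A \<noteq> {}"
    using x \<phi> unfolding A_def by blast
  ultimately have "\<exists>y\<in>A. \<forall>z\<in>A. y \<subseteq> z \<longrightarrow> z = y"
    by (intro subset_Zorn_nonempty)
  then obtain y where y: "y \<in> A" and max: "\<And>z. z \<in> A \<Longrightarrow> y \<subseteq> z \<Longrightarrow> z = y"
    by blast
  have cy: "closed_theory y" and xy: "x \<subseteq> y" and \<phi>y: "\<phi> \<notin> y"
    using y by (simp_all add: A_def)
  have *: "\<psi> \<^bold>\<rightarrow> \<phi> \<in> y" if "\<psi> \<in> L" "\<psi> \<notin> y" for \<psi>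
  proof (rule ccontr)
    assume "\<psi> \<^bold>\<rightarrow> \<phi> \<notin> y"
    then have "{\<theta>\<in>L. \<psi> \<^bold>\<rightarrow> \<theta> \<in> y} \<in> A"
      using closed_theory_add[OF cy \<open>\<psi> \<in> L\<close>] xy by (simp add: A_def)
    then show False
      using closed_theory_add[OF cy \<open>\<psi> \<in> L\<close>] max \<open>\<psi> \<notin> y\<close> by blast
  qed
  have "\<^bold>\<not> \<psi> \<in> y \<longleftrightarrow> \<psi> \<notin> y" if \<psi>: "\<psi> \<in> L" for \<psi>
  proof
    assume n: "\<^bold>\<not> \<psi> \<in> y"
    have "\<^bold>\<not> \<psi> \<^bold>\<rightarrow> (\<psi> \<^bold>\<rightarrow> \<phi>) \<in> y"
      using \<psi> \<phi> by (intro closed_theory_taut[OF cy]) (auto simp: boolean_def)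
    then show "\<psi> \<notin> y"
      using n \<phi>y closed_theory_mp[OF cy] by blast
  next
    assume n: "\<psi> \<notin> y"
    have "(\<psi> \<^bold>\<rightarrow> \<phi>) \<^bold>\<rightarrow> ((\<^bold>\<not> \<psi> \<^bold>\<rightarrow> \<phi>) \<^bold>\<rightarrow> \<phi>) \<in> y"
      using \<psi> \<phi> by (intro closed_theory_taut[OF cy]) (auto simp: boolean_def)
    then show "\<^bold>\<not> \<psi> \<in> y"
      using n \<phi>y *[of \<psi>] *[of "\<^bold>\<not> \<psi>"] \<psi> closed_theory_mp[OF cy] Neg_L by blast
  qed
  then show thesis
    using cy xy \<phi>y that[of y] by (simp add: mcs_def)
qed

lemma mcs_theory: "mcs x \<Longrightarrow> closed_theory x"
  by (simp add: mcs_def)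

lemma mcs_L: "mcs x \<Longrightarrow> \<phi> \<in> x \<Longrightarrow> \<phi> \<in> L"
  unfolding mcs_def closed_theory_def by blast

lemma mcs_L_iff [dest]:
  "mcs x \<Longrightarrow> \<^bold>[d\<^bold>] \<phi> \<in> x \<Longrightarrow> \<phi> \<in> L"
  "mcs x \<Longrightarrow> \<^bold>\<forall> \<phi> \<in> x \<Longrightarrow> \<phi> \<in> L"
  using mcs_L by force+

lemma mcs_Th: "mcs x \<Longrightarrow> \<phi> \<in> Th \<Longrightarrow> \<phi> \<in> x"
  unfolding mcs_def closed_theory_def by blast

lemma mcs_Neg: "mcs x \<Longrightarrow> \<phi> \<in> L \<Longrightarrow> \<^bold>\<not> \<phi> \<in> x \<longleftrightarrow> \<phi> \<notin> x"
  by (auto simp: mcs_def)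

lemma mcs_Top: "mcs x \<Longrightarrow> Top \<in> x"
  by (erule mcs_Th, rule Th_taut) (auto simp: boolean_def)

lemma mcs_Conj:
  assumes x: "mcs x" and L: "\<phi> \<in> L" "\<psi> \<in> L"
  shows "\<phi> \<^bold>\<and> \<psi> \<in> x \<longleftrightarrow> \<phi> \<in> x \<and> \<psi> \<in> x"
proof -
  have "\<phi> \<^bold>\<and> \<psi> \<^bold>\<rightarrow> \<phi> \<in> x" "\<phi> \<^bold>\<and> \<psi> \<^bold>\<rightarrow> \<psi> \<in> x" "\<phi> \<^bold>\<rightarrow> (\<psi> \<^bold>\<rightarrow> \<phi> \<^bold>\<and> \<psi>) \<in> x"
    using L by (auto intro!: closed_theory_taut[OF mcs_theory[OF x]] simp: boolean_def)
  then show ?thesis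
    using closed_theory_mp[OF mcs_theory[OF x]] by blast
qed

lemma mcs_Conjs:
  assumes x: "mcs x" and "\<And>\<phi>. \<phi> \<in> set \<phi>s \<Longrightarrow> \<phi> \<in> L"
  shows "\<^bold>\<And> \<phi>s \<in> L \<and> (\<^bold>\<And> \<phi>s \<in> x \<longleftrightarrow> (\<forall>\<phi>\<in>set \<phi>s. \<phi> \<in> x))"
  using assms(2) by (induction \<phi>s rule: Conjs.induct) (auto simp: mcs_Conj[OF x] mcs_Top[OF x])

lemmas mcs_bool = mcs_Neg mcs_Conj mcs_Top

lemma mcs_axiom: "mcs x \<Longrightarrow> \<phi> \<in> full_axioms \<Longrightarrow> \<phi> \<in> L \<Longrightarrow> \<phi> \<in> x"
  using mcs_Th Th_axiom by blast

section \<open>Canonical relations and the axioms read as properties of them\<close>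

definition R :: "'v fm set \<Rightarrow> 'v fm set \<Rightarrow> bool" where
  "R x y \<longleftrightarrow> mcs x \<and> mcs y \<and> (\<forall>\<phi>. \<^bold>[d\<^bold>] \<phi> \<in> x \<longrightarrow> \<phi> \<in> y)"

definition R_univ :: "'v fm set \<Rightarrow> 'v fm set \<Rightarrow> bool" where
  "R_univ x y \<longleftrightarrow> mcs x \<and> mcs y \<and> (\<forall>\<phi>. \<^bold>\<forall> \<phi> \<in> x \<longrightarrow> \<phi> \<in> y)"

text \<open>The operator \<open>m\<close> stands for \<open>Box\<close> or \<open>Univ\<close>. The
  K axiom and necessitation say that the formulas with \<open>m\<close> prefixed in \<open>x\<close>
  form a closed theory, which is then extended.\<close>

lemma normal_successor:
  assumes L: "\<And>\<psi>. m \<psi> \<in> x \<Longrightarrow> \<psi> \<in> L" and K: "\<And>\<psi> \<theta>. m (\<psi> \<^bold>\<rightarrow> \<theta>) \<in> x \<Longrightarrow> m \<psi> \<in> x \<Longrightarrow> m \<theta> \<in> x"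
    and nec: "\<And>\<psi>. \<psi> \<in> Th \<Longrightarrow> m \<psi> \<in> x" and \<phi>: "\<phi> \<in> L" "m \<phi> \<notin> x"
  shows "\<exists>y. mcs y \<and> (\<forall>\<psi>. m \<psi> \<in> x \<longrightarrow> \<psi> \<in> y) \<and> \<phi> \<notin> y"
proof -
  have "closed_theory {\<psi>. m \<psi> \<in> x}"
    unfolding closed_theory_def using L K nec by blast
  then obtain y where "mcs y" "{\<psi>. m \<psi> \<in> x} \<subseteq> y" "\<phi> \<notin> y"
    using \<phi> Lindenbaum by (metis mem_Collect_eq)
  then show ?thesis by blast
qed

lemma mcs_Box:
  assumes x: "mcs x" and \<phi>: "\<phi> \<in> L"
  shows "\<^bold>[d\<^bold>] \<phi> \<in> x \<longleftrightarrow> (\<forall>y. R x y \<longrightarrow> \<phi> \<in> y)"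
proof
  assume r: "\<forall>y. R x y \<longrightarrow> \<phi> \<in> y"
  have K: "\<^bold>[d\<^bold>] \<theta> \<in> x" if "\<^bold>[d\<^bold>] (\<psi> \<^bold>\<rightarrow> \<theta>) \<in> x" "\<^bold>[d\<^bold>] \<psi> \<in> x" for \<psi> \<theta>
  proof -
    have "\<^bold>[d\<^bold>] (\<psi> \<^bold>\<rightarrow> \<theta>) \<^bold>\<rightarrow> (\<^bold>[d\<^bold>] \<psi> \<^bold>\<rightarrow> \<^bold>[d\<^bold>] \<theta>) \<in> x"
      using mcs_L_iff(1)[OF x that(1)] by (intro mcs_axiom[OF x]) (auto simp: full_axioms_def KD4_axioms_def)
    then show ?thesis
      using that closed_theory_mp[OF mcs_theory[OF x]] by blast
  qed
  show "\<^bold>[d\<^bold>] \<phi> \<in> x"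
  proof (rule ccontr)
    assume "\<^bold>[d\<^bold>] \<phi> \<notin> x"
    then have "\<exists>y. mcs y \<and> (\<forall>\<psi>. \<^bold>[d\<^bold>] \<psi> \<in> x \<longrightarrow> \<psi> \<in> y) \<and> \<phi> \<notin> y"
      using mcs_L_iff(1)[OF x] K mcs_Th[OF x thms.nec_d] \<phi> by (intro normal_successor)
    then show False
      using r x by (auto simp: R_def)
  qed
qed (auto simp: R_def)

lemma mcs_Univ:
  assumes x: "mcs x" and \<phi>: "\<phi> \<in> L"
  shows "\<^bold>\<forall> \<phi> \<in> x \<longleftrightarrow> (\<forall>y. R_univ x y \<longrightarrow> \<phi> \<in> y)"
proof
  assume r: "\<forall>y. R_univ x y \<longrightarrow> \<phi> \<in> y"
  have K: "\<^bold>\<forall> \<theta> \<in> x" if "\<^bold>\<forall> (\<psi> \<^bold>\<rightarrow> \<theta>) \<in> x" "\<^bold>\<forall> \<psi> \<in> x" for \<psi> \<theta>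
  proof -
    have "\<^bold>\<forall> (\<psi> \<^bold>\<rightarrow> \<theta>) \<^bold>\<rightarrow> (\<^bold>\<forall> \<psi> \<^bold>\<rightarrow> \<^bold>\<forall> \<theta>) \<in> x"
      using mcs_L_iff(2)[OF x that(1)] by (intro mcs_axiom[OF x]) (auto simp: full_axioms_def S5_axioms_def)
    then show ?thesis
      using that closed_theory_mp[OF mcs_theory[OF x]] by blast
  qed
  show "\<^bold>\<forall> \<phi> \<in> x"
  proof (rule ccontr)
    assume "\<^bold>\<forall> \<phi> \<notin> x"
    then have "\<exists>y. mcs y \<and> (\<forall>\<psi>. \<^bold>\<forall> \<psi> \<in> x \<longrightarrow> \<psi> \<in> y) \<and> \<phi> \<notin> y"
      using mcs_L_iff(2)[OF x] K mcs_Th[OF x thms.nec_univ] \<phi> by (intro normal_successor)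
    then show False
      using r x by (auto simp: R_univ_def)
  qed
qed (auto simp: R_univ_def)

lemma mcs_Dia: "mcs x \<Longrightarrow> \<phi> \<in> L \<Longrightarrow> \<^bold>\<langle>d\<^bold>\<rangle> \<phi> \<in> x \<longleftrightarrow> (\<exists>y. R x y \<and> \<phi> \<in> y)"
  by (auto simp: mcs_Neg mcs_Box R_def)

lemma mcs_Imp: "mcs x \<Longrightarrow> \<phi> \<in> L \<Longrightarrow> \<psi> \<in> L \<Longrightarrow> \<phi> \<^bold>\<rightarrow> \<psi> \<in> x \<longleftrightarrow> (\<phi> \<in> x \<longrightarrow> \<psi> \<in> x)"
  by (simp add: mcs_bool)

lemma R_trans: "R x y \<Longrightarrow> R y z \<Longrightarrow> R x z"
proof -
  assume r: "R x y" "R y z"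
  have "\<phi> \<in> z" if "\<^bold>[d\<^bold>] \<phi> \<in> x" for \<phi>
  proof -
    have x: "mcs x" and L: "\<phi> \<in> L"
      using r that mcs_L_iff(1)[of x \<phi>] by (simp_all add: R_def)
    then have "\<^bold>[d\<^bold>] \<phi> \<^bold>\<rightarrow> \<^bold>[d\<^bold>] \<^bold>[d\<^bold>] \<phi> \<in> x"
      by (intro mcs_axiom[OF x]) (auto simp: full_axioms_def KD4_axioms_def)
    then show ?thesis
      using that x r L mcs_Imp[OF x] by (auto simp: R_def)
  qed
  then show ?thesis
    using r by (auto simp: R_def)
qed

lemma R_serial: "mcs x \<Longrightarrow> \<exists>y. R x y"
proof -
  assume x: "mcs x"
  then have "\<^bold>\<langle>d\<^bold>\<rangle> Top \<in> x"
    by (rule mcs_axiom) (auto simp: full_axioms_def KD4_axioms_def)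
  then show ?thesis
    using mcs_Dia[OF x, of Top] by auto
qed

lemma R_univ_refl: "mcs x \<Longrightarrow> R_univ x x"
proof -
  assume x: "mcs x"
  have "\<phi> \<in> x" if "\<^bold>\<forall> \<phi> \<in> x" for \<phi>
  proof -
    have "\<phi> \<in> L"
      using that x by blast
    then have "\<^bold>\<forall> \<phi> \<^bold>\<rightarrow> \<phi> \<in> x"
      by (intro mcs_axiom[OF x]) (auto simp: full_axioms_def S5_axioms_def)
    then show ?thesis
      using that closed_theory_mp[OF mcs_theory[OF x]] by blast
  qed
  then show ?thesis
    using x by (auto simp: R_univ_def)
qed

lemma R_univ_trans: "R_univ x y \<Longrightarrow> R_univ y z \<Longrightarrow> R_univ x z"
proof -
  assume r: "R_univ x y" "R_univ y z"
  have "\<phi> \<in> z" if "\<^bold>\<forall> \<phi> \<in> x" for \<phi>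
  proof -
    have x: "mcs x" and L: "\<phi> \<in> L"
      using r that mcs_L_iff(2)[of x \<phi>] by (simp_all add: R_univ_def)
    then have "\<^bold>\<forall> \<phi> \<^bold>\<rightarrow> \<^bold>\<forall> \<^bold>\<forall> \<phi> \<in> x"
      by (intro mcs_axiom[OF x]) (auto simp: full_axioms_def S5_axioms_def)
    then show ?thesis
      using that x r L mcs_Imp[OF x] by (auto simp: R_univ_def)
  qed
  then show ?thesis
    using r by (auto simp: R_univ_def)
qed

lemma R_univ_sym: "R_univ x y \<Longrightarrow> R_univ y x"
proof -
  assume r: "R_univ x y"
  then have x: "mcs x" and y: "mcs y"
    by (auto simp: R_univ_def)
  have "\<phi> \<in> x" if "\<^bold>\<forall> \<phi> \<in> y" for \<phi>
  proof (rule ccontr)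
    assume n: "\<phi> \<notin> x"
    have L: "\<phi> \<in> L"
      using that y by blast
    then have "\<^bold>\<not> \<phi> \<^bold>\<rightarrow> \<^bold>\<forall> \<^bold>\<exists> \<^bold>\<not> \<phi> \<in> x"
      by (intro mcs_axiom[OF x]) (auto simp: full_axioms_def S5_axioms_def)
    then have "\<^bold>\<exists> \<^bold>\<not> \<phi> \<in> y"
      using n L r by (auto simp: mcs_bool[OF x] R_univ_def)
    then obtain z where "R_univ y z" "\<phi> \<notin> z"
      using L y by (auto simp: mcs_Neg mcs_Univ R_univ_def)
    then show False
      using that by (auto simp: R_univ_def)
  qed
  then show ?thesis
    using r by (auto simp: R_univ_def)
qed

lemma R_imp_R_univ: "R x y \<Longrightarrow> R_univ x y"
proof -
  assume r: "R x y"
  then have x: "mcs x" by (simp add: R_def)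
  have "\<phi> \<in> y" if "\<^bold>\<forall> \<phi> \<in> x" for \<phi>
  proof -
    have "\<phi> \<in> L"
      using that x by blast
    then have "\<^bold>\<forall> \<phi> \<^bold>\<rightarrow> \<^bold>[d\<^bold>] \<phi> \<in> x"
      by (intro mcs_axiom[OF x]) (auto simp: full_axioms_def U_axioms_def)
    then show ?thesis
      using that r closed_theory_mp[OF mcs_theory[OF x]] by (auto simp: R_def)
  qed
  then show ?thesis
    using r by (auto simp: R_def R_univ_def)
qed

text \<open>The instance takes \<open>\<alpha>\<close> and its negation for the two formulas of
  \<open>G1\<close>, so that \<open>Q0\<close> amounts to \<open>\<alpha>\<close> and
  \<open>Q1\<close> to its negation. By \<open>step\<close> the antecedent holds at
  \<open>x\<close>; the consequent says that one of the two values does not occur among the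
  successors.\<close>

lemma mcs_G1:
  assumes x: "mcs x" and \<alpha>: "\<alpha> \<in> L"
    and step: "\<And>y z. R x y \<Longrightarrow> R y z \<Longrightarrow> \<alpha> \<in> y \<longleftrightarrow> \<alpha> \<in> z"
    and y: "R x y" "R x y'"
  shows "\<alpha> \<in> y \<longleftrightarrow> \<alpha> \<in> y'"
proof -
  let ?Q0 = "\<alpha> \<^bold>\<and> \<^bold>\<not> \<^bold>\<not> \<alpha>" and ?Q1 = "\<^bold>\<not> \<alpha> \<^bold>\<and> \<^bold>\<not> \<alpha>"
  have "\<^bold>[d\<^bold>] (\<^bold>\<box>\<^sup>* ?Q0 \<^bold>\<or> \<^bold>\<box>\<^sup>* ?Q1) \<^bold>\<rightarrow> (\<^bold>[d\<^bold>] \<^bold>\<not> ?Q0 \<^bold>\<or> \<^bold>[d\<^bold>] \<^bold>\<not> ?Q1) \<in> x"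
    using \<alpha> by (intro mcs_axiom[OF x]) (auto simp: full_axioms_def G1_def)
  moreover have "\<^bold>[d\<^bold>] (\<^bold>\<box>\<^sup>* ?Q0 \<^bold>\<or> \<^bold>\<box>\<^sup>* ?Q1) \<in> x"
  proof -
    have "\<^bold>\<box>\<^sup>* ?Q0 \<^bold>\<or> \<^bold>\<box>\<^sup>* ?Q1 \<in> u" if "R x u" for u
    proof -
      have u: "mcs u" and m: "\<And>z. R u z \<Longrightarrow> mcs z"
        using that by (simp_all add: R_def)
      have "\<^bold>\<box>\<^sup>* ?Q0 \<in> u \<longleftrightarrow> \<alpha> \<in> u" "\<^bold>\<box>\<^sup>* ?Q1 \<in> u \<longleftrightarrow> \<alpha> \<notin> u"
        using \<alpha> m by (simp_all add: mcs_bool[OF u] mcs_bool mcs_Box[OF u]) (use step[OF that] in blast)+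
      then show ?thesis
        using \<alpha> by (simp only: mcs_bool[OF u] Conj_L Neg_L Box_L) blast
    qed
    then show ?thesis
      using \<alpha> x by (simp add: mcs_Box)
  qed
  ultimately have "\<^bold>[d\<^bold>] \<^bold>\<not> ?Q0 \<^bold>\<or> \<^bold>[d\<^bold>] \<^bold>\<not> ?Q1 \<in> x"
    using closed_theory_mp[OF mcs_theory[OF x]] by blast
  then have "\<^bold>[d\<^bold>] \<^bold>\<not> ?Q0 \<in> x \<or> \<^bold>[d\<^bold>] \<^bold>\<not> ?Q1 \<in> x"
    using \<alpha> by (simp only: mcs_bool[OF x] Conj_L Neg_L Box_L) blast
  then have "(\<forall>u. R x u \<longrightarrow> \<alpha> \<notin> u) \<or> (\<forall>u. R x u \<longrightarrow> \<alpha> \<in> u)"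
    using \<alpha> unfolding R_def by (force simp: mcs_bool)
  then show ?thesis
    using y by blast
qed

lemma mcs_C:
  assumes x: "mcs x" and \<alpha>: "\<alpha> \<in> L"
    and step: "\<And>y z. R_univ x y \<Longrightarrow> R y z \<Longrightarrow> \<alpha> \<in> y \<longleftrightarrow> \<alpha> \<in> z"
    and y: "R_univ x y" "R_univ x y'"
  shows "\<alpha> \<in> y \<longleftrightarrow> \<alpha> \<in> y'"
proof -
  have "\<^bold>\<forall> (\<^bold>\<box>\<^sup>* \<alpha> \<^bold>\<or> \<^bold>\<box>\<^sup>* \<^bold>\<not> \<alpha>) \<^bold>\<rightarrow> (\<^bold>\<forall> \<alpha> \<^bold>\<or> \<^bold>\<forall> \<^bold>\<not> \<alpha>) \<in> x"
    using \<alpha> by (intro mcs_axiom[OF x]) (auto simp: full_axioms_def C_axioms_def)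
  moreover have "\<^bold>\<forall> (\<^bold>\<box>\<^sup>* \<alpha> \<^bold>\<or> \<^bold>\<box>\<^sup>* \<^bold>\<not> \<alpha>) \<in> x"
  proof -
    have "\<^bold>\<box>\<^sup>* \<alpha> \<^bold>\<or> \<^bold>\<box>\<^sup>* \<^bold>\<not> \<alpha> \<in> u" if "R_univ x u" for u
    proof -
      have u: "mcs u" and m: "\<And>z. R u z \<Longrightarrow> mcs z"
        using that by (simp_all add: R_univ_def R_def)
      have "\<^bold>\<box>\<^sup>* \<alpha> \<in> u \<longleftrightarrow> \<alpha> \<in> u" "\<^bold>\<box>\<^sup>* \<^bold>\<not> \<alpha> \<in> u \<longleftrightarrow> \<alpha> \<notin> u"
        using \<alpha> m by (simp_all add: mcs_bool[OF u] mcs_bool mcs_Box[OF u]) (use step[OF that] in blast)+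
      then show ?thesis
        using \<alpha> by (simp only: mcs_bool[OF u] Conj_L Neg_L Box_L) blast
    qed
    then show ?thesis
      using \<alpha> x by (simp add: mcs_Univ)
  qed
  ultimately have "\<^bold>\<forall> \<alpha> \<^bold>\<or> \<^bold>\<forall> \<^bold>\<not> \<alpha> \<in> x"
    using closed_theory_mp[OF mcs_theory[OF x]] by blast
  then have "\<^bold>\<forall> \<alpha> \<in> x \<or> \<^bold>\<forall> \<^bold>\<not> \<alpha> \<in> x"
    using \<alpha> by (simp only: mcs_bool[OF x] Conj_L Neg_L Univ_L) blast
  then have "(\<forall>u. R_univ x u \<longrightarrow> \<alpha> \<in> u) \<or> (\<forall>u. R_univ x u \<longrightarrow> \<alpha> \<notin> u)"
    using \<alpha> unfolding R_univ_def by (force simp: mcs_bool)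
  then show ?thesis
    using y by blast
qed

lemma mcs_Fix:
  assumes x: "mcs x" and \<Gamma>: "\<^bold>\<langle>dt\<^bold>\<rangle> \<Gamma> \<in> x" "\<gamma> |\<in>| \<Gamma>"
  shows "\<exists>y. R x y \<and> \<gamma> \<in> y \<and> \<^bold>\<langle>dt\<^bold>\<rangle> \<Gamma> \<in> y"
proof -
  have L: "\<^bold>\<langle>dt\<^bold>\<rangle> \<Gamma> \<in> L" "\<gamma> \<in> L"
    using \<Gamma> Tangle_L mcs_L[OF x] by blast+
  then have "\<^bold>\<langle>dt\<^bold>\<rangle> \<Gamma> \<^bold>\<rightarrow> \<^bold>\<langle>d\<^bold>\<rangle> (\<gamma> \<^bold>\<and> \<^bold>\<langle>dt\<^bold>\<rangle> \<Gamma>) \<in> x"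
    using \<Gamma>(2) by (intro mcs_axiom[OF x]) (auto simp: full_axioms_def Fix_axioms_def)
  then have "\<^bold>\<langle>d\<^bold>\<rangle> (\<gamma> \<^bold>\<and> \<^bold>\<langle>dt\<^bold>\<rangle> \<Gamma>) \<in> x"
    using \<Gamma>(1) closed_theory_mp[OF mcs_theory[OF x]] by blast
  then show ?thesis
    using L x by (auto simp: mcs_Dia mcs_Conj R_def)
qed

lemma mcs_Ind:
  assumes x: "mcs x" and L: "\<^bold>\<langle>dt\<^bold>\<rangle> \<Gamma> \<in> L" "\<phi> \<in> L" and \<phi>: "\<phi> \<in> x"
    and step: "\<And>y \<gamma>. y = x \<or> R x y \<Longrightarrow> \<phi> \<in> y \<Longrightarrow> \<gamma> |\<in>| \<Gamma> \<Longrightarrow> \<exists>z. R y z \<and> \<gamma> \<in> z \<and> \<phi> \<in> z"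
  shows "\<^bold>\<langle>dt\<^bold>\<rangle> \<Gamma> \<in> x"
proof -
  obtain \<gamma>s where \<gamma>s: "set \<gamma>s = fset \<Gamma>" "distinct \<gamma>s"
    using finite_distinct_list[of "fset \<Gamma>"] by auto
  let ?\<psi> = "\<phi> \<^bold>\<rightarrow> \<^bold>\<And> (map (\<lambda>\<gamma>. \<^bold>\<langle>d\<^bold>\<rangle> (\<gamma> \<^bold>\<and> \<phi>)) \<gamma>s)"
  have \<gamma>L: "\<theta> \<in> L" if "\<theta> \<in> set (map (\<lambda>\<gamma>. \<^bold>\<langle>d\<^bold>\<rangle> (\<gamma> \<^bold>\<and> \<phi>)) \<gamma>s)" for \<theta>
    using that \<gamma>s L Tangle_L by auto
  have \<psi>L: "?\<psi> \<in> L"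
    using mcs_Conjs[OF x, of "map (\<lambda>\<gamma>. \<^bold>\<langle>d\<^bold>\<rangle> (\<gamma> \<^bold>\<and> \<phi>)) \<gamma>s", OF \<gamma>L] L by simp
  have "fset_of_list \<gamma>s = \<Gamma>"
    using \<gamma>s by (metis fset_inject fset_of_list.rep_eq)
  then have "\<^bold>\<box>\<^sup>* ?\<psi> \<^bold>\<rightarrow> (\<phi> \<^bold>\<rightarrow> \<^bold>\<langle>dt\<^bold>\<rangle> \<Gamma>) \<in> x"
    using \<gamma>s L \<psi>L by (intro mcs_axiom[OF x]) (auto simp: full_axioms_def Ind_axioms_def)
  moreover have "?\<psi> \<in> y" if y: "y = x \<or> R x y" for y
  proof -
    have m: "mcs y"
      using y x by (auto simp: R_def)
    have "\<^bold>\<And> (map (\<lambda>\<gamma>. \<^bold>\<langle>d\<^bold>\<rangle> (\<gamma> \<^bold>\<and> \<phi>)) \<gamma>s) \<in> y" if "\<phi> \<in> y"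
    proof -
      have "\<^bold>\<langle>d\<^bold>\<rangle> (\<gamma> \<^bold>\<and> \<phi>) \<in> y" if "\<gamma> \<in> set \<gamma>s" for \<gamma>
      proof -
        have "\<gamma> |\<in>| \<Gamma>" "\<gamma> \<in> L"
          using that \<gamma>s L Tangle_L by auto
        then obtain z where "R y z" "\<gamma> \<in> z" "\<phi> \<in> z"
          using step[OF y \<open>\<phi> \<in> y\<close>] by blast
        then show ?thesis
          using mcs_Dia[OF m, of "\<gamma> \<^bold>\<and> \<phi>"] \<open>\<gamma> \<in> L\<close> L by (auto simp: mcs_Conj R_def)
      qed
      then show ?thesis
        using mcs_Conjs[OF m, of "map (\<lambda>\<gamma>. \<^bold>\<langle>d\<^bold>\<rangle> (\<gamma> \<^bold>\<and> \<phi>)) \<gamma>s", OF \<gamma>L] by simp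
    qed
    then show ?thesis
      using \<psi>L mcs_Imp[OF m] by simp
  qed
  then have "\<^bold>\<box>\<^sup>* ?\<psi> \<in> x"
    using \<psi>L x by (simp add: mcs_Conj mcs_Box)
  ultimately show ?thesis
    using \<phi> closed_theory_mp[OF mcs_theory[OF x]] by blast
qed

end

section \<open>Finite transitive serial frames\<close>

locale fin_frame =
  fixes W :: "'w set" and R :: "'w \<Rightarrow> 'w \<Rightarrow> bool"
  assumes finite_W: "finite W"
    and R_W: "R a b \<Longrightarrow> a \<in> W \<and> b \<in> W"
    and R_trans: "R a b \<Longrightarrow> R b c \<Longrightarrow> R a c"
    and R_serial: "a \<in> W \<Longrightarrow> \<exists>b. R a b"
begin

definition up :: "'w \<Rightarrow> 'w set" where
  "up a = {b. R a b}"

lemma mem_up [iff]: "b \<in> up a \<longleftrightarrow> R a b"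
  by (simp add: up_def)

text \<open>
  The graph on the reflexive points of \<open>F\<close> that joins points with a common successor is connected.
\<close>

definition link_connected :: "'w set \<Rightarrow> bool" where
  "link_connected F \<longleftrightarrow>
     (\<forall>A. (\<forall>a\<in>F. \<forall>b\<in>F. R a a \<longrightarrow> R b b \<longrightarrow> (\<exists>g. R a g \<and> R b g) \<longrightarrow> (a \<in> A \<longleftrightarrow> b \<in> A)) \<longrightarrow>
       (\<forall>a\<in>F. \<forall>b\<in>F. R a a \<longrightarrow> R b b \<longrightarrow> (a \<in> A \<longleftrightarrow> b \<in> A)))"

lemma finite_up: "finite (up a)"
  using finite_W R_W by (meson finite_subset mem_up subsetI)

text \<open>Let \<open>b\<close> be a successor of \<open>a\<close> with fewest successors. Any
  successor \<open>c\<close> of \<open>b\<close> has the same successors as \<open>b\<close>, and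
  \<open>c\<close> is one of them.\<close>

lemma reflexive_above:
  assumes "a \<in> W"
  shows "\<exists>b. R a b \<and> R b b"
proof -
  obtain b where b: "R a b" and min: "\<And>c. R a c \<Longrightarrow> card (up b) \<le> card (up c)"
    using R_serial[OF assms] ex_has_least_nat[of "R a" _ "\<lambda>b. card (up b)"] by blast
  obtain c where c: "R b c"
    using R_serial R_W b by blast
  have "up c \<subseteq> up b"
    using R_trans c by blast
  then have "up c = up b"
    using card_seteq[OF finite_up] min R_trans b c by meson
  then have "R c c"
    using c by blast
  then show ?thesis
    using R_trans b c by blast
qed

text \<open>A list is wanted because its stops can be laid out along the values of a real function.
  Stops may recur. A common successor may be taken reflexive by
  \<open>reflexive_above\<close>.\<close>

lemma walk:
  assumes F: "link_connected F" "\<And>a b. a \<in> F \<Longrightarrow> R a b \<Longrightarrow> b \<in> F" and FW: "F \<subseteq> W" "F \<noteq> {}"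
  obtains xs where "xs \<noteq> []" "set xs = {a\<in>F. R a a}"
    "successively (\<lambda>a b. \<exists>e\<in>F. R e e \<and> R a e \<and> R b e) xs"
proof -
  let ?l = "\<lambda>a b. \<exists>e\<in>F. R e e \<and> R a e \<and> R b e"
  define T where "T = {a\<in>F. R a a}"
  define wk where "wk xs \<longleftrightarrow> xs \<noteq> [] \<and> set xs \<subseteq> T \<and> successively ?l xs" for xs
  have conn: "(\<lambda>a b. b \<in> T \<and> ?l a b)\<^sup>*\<^sup>* a b" (is "?r a b") if ab: "a \<in> T" "b \<in> T" for a b
  proof -
    have "?r a y" if l: "?r a x" "y \<in> T" "R x g" "R y g" for x y g
    proof -
      obtain e where "R g e" "R e e"
        using reflexive_above[of g] R_W l by blast
      then have "?l x y"
        using that R_trans F(2)[of y] unfolding T_def by blast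
      then show ?thesis
        using that by (simp add: rtranclp.rtrancl_into_rtrancl)
    qed
    \<comment> \<open>The set of stops reachable from \<open>a\<close> respects the links, so it can
      serve as the set \<open>A\<close> in \<open>link_connected\<close>.\<close>
    then have "\<forall>x\<in>F. \<forall>y\<in>F. R x x \<longrightarrow> R y y \<longrightarrow> (\<exists>g. R x g \<and> R y g) \<longrightarrow> (x \<in> {z. ?r a z} \<longleftrightarrow> y \<in> {z. ?r a z})"
      unfolding T_def by blast
    then have "a \<in> {z. ?r a z} \<longleftrightarrow> b \<in> {z. ?r a z}"
      using F(1) ab unfolding link_connected_def T_def by blast
    then show ?thesis by simp
  qed
  have ext: "\<exists>ys. wk ys \<and> set xs \<subseteq> set ys \<and> last ys = b" if "?r a b" "wk xs" "last xs = a" for a b xs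
    using that(1)
  proof induction
    case base
    then show ?case using that by blast
  next
    case (step y z)
    then obtain ys where "wk ys" "set xs \<subseteq> set ys" "last ys = y" by blast
    then have "wk (ys @ [z]) \<and> set xs \<subseteq> set (ys @ [z]) \<and> last (ys @ [z]) = z"
      using step(2) unfolding wk_def by (auto simp: successively_append_iff)
    then show ?case by blast
  qed
  have "finite T"
    using FW finite_W finite_subset[of F W] unfolding T_def by auto
  moreover have "T \<noteq> {}"
    using FW F(2) reflexive_above unfolding T_def by fastforce
  moreover have "\<exists>xs. wk xs \<and> A \<subseteq> set xs" if "finite A" "A \<noteq> {}" "A \<subseteq> T" for A
    using that
  proof (induction A rule: finite_ne_induct)
    case (singleton a)
    then have "wk [a] \<and> {a} \<subseteq> set [a]" unfolding wk_def by simp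
    then show ?case by blast
  next
    case (insert a A)
    then obtain xs where xs: "wk xs" "A \<subseteq> set xs" by blast
    then have "last xs \<in> T"
      unfolding wk_def using last_in_set by blast
    then obtain ys where ys: "wk ys" "set xs \<subseteq> set ys" "last ys = a"
      using ext[OF conn xs(1) refl] insert.prems by blast
    then have "a \<in> set ys"
      unfolding wk_def using last_in_set by blast
    then show ?case
      using ys xs by blast
  qed
  ultimately obtain xs where "wk xs" "T \<subseteq> set xs" by blast
  then show thesis
    using that[of xs] unfolding wk_def T_def by blast
qed

end

locale good_frame = fin_frame +
  assumes W_ne: "W \<noteq> {}"
    and conn_W: "link_connected W"
    and conn_up: "v \<in> W \<Longrightarrow> \<not> R v v \<Longrightarrow> link_connected (up v)"

text \<open>If step \<open>n\<close> acts at a scale that tends to 0, a value that recurs forever is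
  found arbitrarily close. Prescribing \<open>l 0\<close> controls the first step.\<close>

lemma enumerate_cofinally:
  assumes "finite A" "a \<in> A"
  obtains l :: "nat \<Rightarrow> 'a" where "l 0 = a" "\<And>n. l n \<in> A" "\<And>b m. b \<in> A \<Longrightarrow> \<exists>n\<ge>m. l n = b"
proof -
  obtain xs where xs: "set xs = A"
    using finite_list[OF assms(1)] by blast
  define k where "k = length (a # xs)"
  define l where "l n = (a # xs) ! (n mod k)" for n
  have "l 0 = a" "k > 0"
    by (simp_all add: l_def k_def)
  moreover have "l n \<in> A" for n
  proof -
    have "n mod k < length (a # xs)"
      using \<open>k > 0\<close> by (simp add: k_def)
    then show ?thesis
      using nth_mem[of "n mod k" "a # xs"] xs assms(2) unfolding l_def by auto
  qed
  moreover have "\<exists>n\<ge>m. l n = b" if b: "b \<in> A" for b m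
  proof -
    obtain i where i: "i < k" "(a # xs) ! i = b"
      using b xs unfolding k_def by (metis in_set_conv_nth list.set_intros(2))
    have "m \<le> m * k"
      using \<open>k > 0\<close> by simp
    then have "m \<le> i + m * k" by (rule trans_le_add2)
    moreover have "(i + m * k) mod k = i"
      using i by simp
    then have "l (i + m * k) = b"
      using i by (simp add: l_def)
    ultimately show ?thesis by blast
  qed
  ultimately show thesis
    by (intro that[of l]) auto
qed

lemma glue:
  assumes "\<And>i j y. i \<in> I \<Longrightarrow> j \<in> I \<Longrightarrow> y \<in> D i \<Longrightarrow> y \<in> D j \<Longrightarrow> i = j"
  obtains f where "\<And>i y. i \<in> I \<Longrightarrow> y \<in> D i \<Longrightarrow> f y = g i y"
proof
  fix i y assume "i \<in> I" "y \<in> D i"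
  then have "(SOME i. i \<in> I \<and> y \<in> D i) = i"
    using assms by (intro some_equality) blast+
  then show "g (SOME i. i \<in> I \<and> y \<in> D i) y = g i y" by simp
qed

section \<open>Maps from a dense-in-itself metric space to a frame\<close>

locale dense_metric = Metric_space M d for M :: "'x set" and d +
  assumes dense: "openin mtopology U \<Longrightarrow> x \<in> U \<Longrightarrow> \<exists>y\<in>U. y \<noteq> x"
begin

abbreviation opn :: "'x set \<Rightarrow> bool" where "opn \<equiv> openin mtopology"
abbreviation cl :: "'x set \<Rightarrow> 'x set" where "cl \<equiv> (closure_of) mtopology"
abbreviation bd :: "'x set \<Rightarrow> 'x set" where "bd V \<equiv> cl V - V"

lemma cl_iff: "x \<in> cl S \<longleftrightarrow> x \<in> M \<and> (\<forall>N. opn N \<longrightarrow> x \<in> N \<longrightarrow> N \<inter> S \<noteq> {})"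
  by (auto simp: in_closure_of)

lemma cl_meets: "x \<in> cl S \<Longrightarrow> opn N \<Longrightarrow> x \<in> N \<Longrightarrow> N \<inter> S \<noteq> {}"
  by (simp add: cl_iff)

lemma opn_subset: "opn U \<Longrightarrow> U \<subseteq> M"
  using openin_subset by fastforce

lemma cl_superset: "opn V \<Longrightarrow> V \<subseteq> cl V"
  by (simp add: closure_of_subset opn_subset)

lemma opn_Int: "opn A \<Longrightarrow> opn B \<Longrightarrow> opn (A \<inter> B)"
  by (rule openin_Int)

lemma opn_diff_cl: "opn A \<Longrightarrow> opn (A - cl B)"
  by (simp add: openin_diff)

text \<open>With \<open>A\<close> equal to \<open>up (f x)\<close> the two conjuncts are the forth
  and the back condition of a p-morphism for the derived set operator. The point \<open>x\<close>
  may lie outside \<open>V\<close>, so the notion also describes boundary points.\<close>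

definition clusters :: "'x set \<Rightarrow> ('x \<Rightarrow> 'w) \<Rightarrow> 'x \<Rightarrow> 'w set \<Rightarrow> bool" where
  "clusters V f x A \<longleftrightarrow>
     (\<exists>N. opn N \<and> x \<in> N \<and> (\<forall>y\<in>N \<inter> V - {x}. f y \<in> A)) \<and>
     (\<forall>a\<in>A. \<forall>N. opn N \<longrightarrow> x \<in> N \<longrightarrow> (\<exists>y\<in>N \<inter> V - {x}. f y = a))"

lemma clusters_nearby:
  "clusters V f x A \<Longrightarrow> \<exists>N. opn N \<and> x \<in> N \<and> (\<forall>y\<in>N \<inter> V - {x}. f y \<in> A)"
  by (simp add: clusters_def)

lemma clusters_hit:
  "clusters V f x A \<Longrightarrow> a \<in> A \<Longrightarrow> opn N \<Longrightarrow> x \<in> N \<Longrightarrow> \<exists>y\<in>N \<inter> V - {x}. f y = a"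
  by (simp add: clusters_def)

lemma clustersI:
  assumes "opn N" "x \<in> N" "\<And>y. y \<in> N \<inter> V - {x} \<Longrightarrow> f y \<in> A"
    and "\<And>a G. a \<in> A \<Longrightarrow> opn G \<Longrightarrow> x \<in> G \<Longrightarrow> \<exists>y\<in>G \<inter> V - {x}. f y = a"
  shows "clusters V f x A"
  unfolding clusters_def using assms by blast

lemma clusters_cong:
  assumes c: "clusters V f x A" and N: "opn N" "x \<in> N"
    and VV: "\<And>y. y \<in> N \<Longrightarrow> y \<noteq> x \<Longrightarrow> y \<in> V \<longleftrightarrow> y \<in> V'"
    and ff: "\<And>y. y \<in> N \<Longrightarrow> y \<in> V \<Longrightarrow> y \<noteq> x \<Longrightarrow> f y = f' y"
  shows "clusters V' f' x A"
  unfolding clusters_def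
proof (intro conjI ballI allI impI)
  obtain N1 where N1: "opn N1" "x \<in> N1" "\<forall>y\<in>N1 \<inter> V - {x}. f y \<in> A"
    using clusters_nearby[OF c] by blast
  have "f' y \<in> A" if "y \<in> (N \<inter> N1) \<inter> V' - {x}" for y
    using that N1 VV[of y] ff[of y] by (metis DiffD1 DiffD2 DiffI IntD1 IntD2 IntI singletonI)
  then show "\<exists>N. opn N \<and> x \<in> N \<and> (\<forall>y\<in>N \<inter> V' - {x}. f' y \<in> A)"
    using N N1 opn_Int by blast
next
  fix a G assume "a \<in> A" "opn G" "x \<in> G"
  then obtain y where "y \<in> (N \<inter> G) \<inter> V - {x}" "f y = a"
    using clusters_hit[OF c _ opn_Int] N by blast
  then have "y \<in> G \<inter> V' - {x}" "f' y = a"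
    using VV[of y] ff[of y] by auto
  then show "\<exists>y\<in>G \<inter> V' - {x}. f' y = a"
    by blast
qed

end

locale metric_frame = dense_metric M d + fin_frame W R
  for M :: "'x set" and d and W :: "'w set" and R
begin

section \<open>Maps on open sets and their extension\<close>

definition dmor :: "'x set \<Rightarrow> ('x \<Rightarrow> 'w) \<Rightarrow> bool" where
  "dmor V f \<longleftrightarrow> (\<forall>x\<in>V. f x \<in> W \<and> clusters V f x (up (f x)))"

lemma dmor_local:
  assumes "\<And>x. x \<in> V \<Longrightarrow> \<exists>N V' f'. opn N \<and> x \<in> N \<and> dmor V' f' \<and> (\<forall>y\<in>N. (y \<in> V \<longleftrightarrow> y \<in> V') \<and> (y \<in> V \<longrightarrow> f y = f' y))"
  shows "dmor V f"
  unfolding dmor_def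
proof (intro ballI conjI)
  fix x assume x: "x \<in> V"
  obtain N V' f' where N: "opn N" "x \<in> N" "dmor V' f'"
    and eq: "\<And>y. y \<in> N \<Longrightarrow> y \<in> V \<longleftrightarrow> y \<in> V'" "\<And>y. y \<in> N \<Longrightarrow> y \<in> V \<Longrightarrow> f y = f' y"
    using assms[OF x] by blast
  have "f' x \<in> W" "clusters V' f' x (up (f' x))"
    using N x eq(1)[of x] unfolding dmor_def by blast+
  moreover have "f x = f' x"
    using eq(2) N x by blast
  ultimately show "f x \<in> W" "clusters V f x (up (f x))"
    using clusters_cong[OF _ N(1,2), of V' f' _ V f] eq by (simp, metis)
qed

lemma dmor_cong:
  assumes "dmor V f" "opn V" "\<And>y. y \<in> V \<Longrightarrow> f y = f' y"
  shows "dmor V f'"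
proof (rule dmor_local)
  fix x assume "x \<in> V"
  then show "\<exists>N V' g. opn N \<and> x \<in> N \<and> dmor V' g \<and> (\<forall>y\<in>N. (y \<in> V \<longleftrightarrow> y \<in> V') \<and> (y \<in> V \<longrightarrow> f' y = g y))"
    using assms by (intro exI[of _ V] exI[of _ f] conjI ballI) simp_all
qed

text \<open>Because all of \<open>up c\<close> appears at the boundary, the value \<open>c\<close>
  is right for a boundary point whenever the other side shows only values from
  \<open>up c\<close>.\<close>

definition fills :: "'w \<Rightarrow> bool" where
  "fills c \<longleftrightarrow> (\<forall>U. opn U \<longrightarrow> (\<exists>f. dmor U f \<and> f ` U \<subseteq> up c \<and>
     (\<forall>y\<in>bd U. clusters U f y (up c)) \<and> (U \<noteq> {} \<longrightarrow> c \<in> f ` U)))"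

text \<open>A single reflexive \<open>c\<close> describes what is seen at the boundary; this is the
  interface that \<open>extend\<close> expects. Since \<open>V\<close> is the interior of its
  closure, every boundary point is a limit of points outside \<open>cl V\<close>, which keeps room
  for later stages of a filling.\<close>

definition localizes :: "'w \<Rightarrow> bool" where
  "localizes v \<longleftrightarrow> (\<forall>x N. opn N \<longrightarrow> x \<in> N \<longrightarrow> (\<exists>V f c. opn V \<and> x \<in> V \<and> cl V \<subseteq> N \<and>
     mtopology interior_of cl V = V \<and> dmor V f \<and> f ` V \<subseteq> insert v (up v) \<and> v \<in> f ` V \<and>
     R c c \<and> R v c \<and> (\<forall>y\<in>bd V. clusters V f y (up c))))"

lemma fill_region:
  assumes U: "opn U" and D: "opn D" "D \<subseteq> U" "dmor D f0" and c: "R c c" "fills c"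
    and F: "f0 ` D \<subseteq> F" "\<And>a b. a \<in> F \<Longrightarrow> R a b \<Longrightarrow> b \<in> F" "c \<in> F"
    and bdD: "\<And>y. y \<in> U \<Longrightarrow> y \<in> bd D \<Longrightarrow> \<exists>k. R k k \<and> R c k \<and> clusters D f0 y (up k)"
  shows "\<exists>f. dmor U f \<and> f ` U \<subseteq> F \<and> (\<forall>y\<in>D. f y = f0 y)"
proof -
  define Z where "Z = U - cl D"
  have Z: "opn Z" "Z \<subseteq> U" "Z \<inter> D = {}"
    using U opn_diff_cl cl_superset[OF D(1)] unfolding Z_def by blast+
  obtain q where q: "dmor Z q" "q ` Z \<subseteq> up c" "\<And>y. y \<in> bd Z \<Longrightarrow> clusters Z q y (up c)"
    using c(2)[unfolded fills_def, rule_format, OF Z(1)] by metis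
  obtain k where k: "\<And>y. y \<in> U \<Longrightarrow> y \<in> bd D \<Longrightarrow> R (k y) (k y) \<and> R c (k y) \<and> clusters D f0 y (up (k y))"
    using bdD by metis
  \<comment> \<open>At a boundary point of \<open>D\<close> that is also a limit of
    \<open>Z\<close>, all of \<open>up c\<close> is hit from \<open>Z\<close>, and \<open>D\<close>
    adds only values from \<open>up (k y)\<close>, a subset of \<open>up c\<close>. At the others,
    only \<open>D\<close> and its boundary are near, and the value \<open>k y\<close> fits.\<close>
  define f where "f y = (if y \<in> D then f0 y else if y \<in> Z then q y else if y \<in> cl Z then c else k y)" for y
  have fD: "f y = f0 y" if "y \<in> D" for y
    using that by (simp add: f_def)
  have fZ: "f y = q y" if "y \<in> Z" for y
    using that Z by (auto simp: f_def)
  have cov: "y \<in> D \<or> y \<in> Z \<or> y \<in> bd D" if "y \<in> U" for y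
    using that unfolding Z_def by blast
  have cW: "c \<in> W" "k y \<in> W" if "y \<in> U" "y \<in> bd D" for y
    using c R_W k that by blast+
  have "f x \<in> W \<and> clusters U f x (up (f x))" if x: "x \<in> U" for x
  proof -
    consider "x \<in> D" | "x \<in> Z" | "x \<in> bd D" "x \<in> cl Z" "x \<notin> Z" | "x \<in> bd D" "x \<notin> cl Z" "x \<notin> Z"
      using cov[OF x] by blast
    then show ?thesis
    proof cases
      case 1
      then have "f0 x \<in> W" "clusters D f0 x (up (f0 x))"
        using D unfolding dmor_def by blast+
      then show ?thesis
        using 1 fD clusters_cong[of D f0 x _ D U f] D by auto
    next
      case 2
      then have "q x \<in> W" "clusters Z q x (up (q x))"
        using q unfolding dmor_def by blast+
      then show ?thesis
        using 2 fZ clusters_cong[of Z q x _ Z U f] Z by auto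
    next
      case 3
      note kx = k[OF x 3(1)]
      obtain N where N: "opn N" "x \<in> N" "\<forall>y\<in>N \<inter> D - {x}. f0 y \<in> up (k x)"
        using clusters_nearby[of D f0 x "up (k x)"] kx by metis
      have fx: "f x = c"
        using 3 by (auto simp: f_def)
      have "f y \<in> up c" if yN: "y \<in> N \<inter> U - {x}" for y
      proof -
        consider "y \<in> D" | "y \<in> Z" | "y \<in> bd D" "y \<notin> Z"
          using cov yN by blast
        then show ?thesis
        proof cases
          case 1
          then show ?thesis using N that kx R_trans fD by auto
        next
          case 2
          then show ?thesis using q fZ by auto
        next
          case 3
          then show ?thesis using k[of y] that c by (auto simp: f_def)
        qed
      qed
      moreover have "\<exists>y\<in>G \<inter> U - {x}. f y = a" if "a \<in> up c" "opn G" "x \<in> G" for a G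
      proof -
        have "x \<in> bd Z" using 3 by blast
        obtain y where "y \<in> G \<inter> Z - {x}" "q y = a"
          using clusters_hit[OF q(3)[OF \<open>x \<in> bd Z\<close>] \<open>a \<in> up c\<close> \<open>opn G\<close> \<open>x \<in> G\<close>] by (elim bexE) (rule that)
        then show ?thesis
          using fZ Z by auto
      qed
      ultimately have "clusters U f x (up c)"
        by (rule clustersI[OF N(1,2)])
      then show ?thesis
        using fx R_W[OF c(1)] by simp
    next
      case 4
      note kx = k[OF x 4(1)]
      obtain N where N: "opn N" "x \<in> N" "\<forall>y\<in>N \<inter> D - {x}. f0 y \<in> up (k x)"
        using clusters_nearby[of D f0 x "up (k x)"] kx by metis
      have fx: "f x = k x"
        using 4 by (auto simp: f_def)
      have "f y \<in> up (k x)" if yN: "y \<in> (N - cl Z) \<inter> U - {x}" for y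
      proof -
        consider "y \<in> D" | "y \<in> bd D" "y \<notin> Z" "y \<notin> cl Z"
          using cov yN cl_superset[OF Z(1)] by blast
        then show ?thesis
        proof cases
          case 1
          then show ?thesis using N that fD by auto
        next
          case 2
          then have ky: "R (k y) (k y)" "clusters D f0 y (up (k y))"
            using k that by blast+
          \<comment> \<open>As \<open>k y\<close> is reflexive, it is itself hit from
            \<open>D\<close> near \<open>y\<close>. The values of \<open>D\<close> in
            \<open>N\<close> are bounded by \<open>up (k x)\<close>, so \<open>k y\<close> is
            admissible near \<open>x\<close>.\<close>
          then obtain z where z: "z \<in> N \<inter> D - {y}" "f0 z = k y"
            using clusters_hit[OF ky(2), of "k y" N] N yN by blast
          then have "f0 z \<in> up (k x)"
            using N(3) 4(1) by blast
          then have "R (k x) (k y)"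
            using z(2) by simp
          then show ?thesis using 2 by (auto simp: f_def)
        qed
      qed
      moreover have "\<exists>y\<in>G \<inter> U - {x}. f y = a" if "a \<in> up (k x)" "opn G" "x \<in> G" for a G
        using clusters_hit[of D f0 x "up (k x)" a G] kx that fD D by fastforce
      moreover have NZ: "opn (N - cl Z)" "x \<in> N - cl Z"
        using N(1,2) 4 opn_diff_cl by auto
      ultimately have "clusters U f x (up (k x))"
        by (intro clustersI[OF NZ])
      then show ?thesis
        using fx kx R_W[of "k x" "k x"] by simp
    qed
  qed
  moreover have "f y \<in> F" if "y \<in> U" for y
  proof -
    consider "y \<in> D" | "y \<in> Z" | "y \<in> bd D" "y \<notin> Z"
      using cov \<open>y \<in> U\<close> by blast
    then show ?thesis
    proof cases
      case 1
      then show ?thesis using F(1) fD by auto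
    next
      case 2
      then have "R c (q y)" using q(2) by auto
      then show ?thesis using fZ[OF 2] F(2)[OF F(3)] by auto
    next
      case 3
      then show ?thesis using F(2)[OF F(3)] F(3) k[OF \<open>y \<in> U\<close>] by (auto simp: f_def)
    qed
  qed
  ultimately show ?thesis
    using fD unfolding dmor_def by blast
qed

text \<open>The added points are boundary points of \<open>V\<close>, where the limit values are
  \<open>up c\<close>. As \<open>c\<close> belongs to \<open>up c\<close>, giving them the value
  \<open>c\<close> disturbs no set of limit values.\<close>

lemma regularize:
  assumes V: "opn V" "dmor V f" and c: "R c c" and bdV: "\<And>y. y \<in> bd V \<Longrightarrow> clusters V f y (up c)"
  obtains V' f' where "opn V'" "V \<subseteq> V'" "cl V' = cl V" "mtopology interior_of cl V' = V'" "dmor V' f'"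
    "\<And>y. y \<in> V \<Longrightarrow> f' y = f y" "f' ` V' \<subseteq> insert c (f ` V)" "\<And>y. y \<in> bd V' \<Longrightarrow> clusters V' f' y (up c)"
proof -
  define V' where "V' = mtopology interior_of cl V"
  define f' where "f' y = (if y \<in> V then f y else c)" for y
  have V': "opn V'" "V \<subseteq> V'" "V' \<subseteq> cl V"
    using interior_of_maximal[OF cl_superset[OF V(1)] V(1)] interior_of_subset[of mtopology "cl V"]
    unfolding V'_def by auto
  then have clV': "cl V' = cl V"
    using closure_of_mono[of V V' mtopology] closure_of_mono[of V' "cl V" mtopology] by simp
  have cl': "clusters V' f' y (up c)" if y: "y \<in> cl V" "y \<notin> V" for y
    unfolding clusters_def
  proof (intro conjI ballI allI impI)
    obtain N where N: "opn N" "y \<in> N" "\<forall>z\<in>N \<inter> V - {y}. f z \<in> up c"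
      using clusters_nearby[OF bdV[of y]] y by blast
    then have "\<forall>z\<in>N \<inter> V' - {y}. f' z \<in> up c"
      using c by (auto simp: f'_def)
    then show "\<exists>N. opn N \<and> y \<in> N \<and> (\<forall>z\<in>N \<inter> V' - {y}. f' z \<in> up c)"
      using N by blast
  next
    fix a N assume a: "a \<in> up c" "opn N" "y \<in> N"
    obtain z where "z \<in> N \<inter> V - {y}" "f z = a"
      using clusters_hit[OF bdV[of y] a] y by blast
    then show "\<exists>z\<in>N \<inter> V' - {y}. f' z = a"
      using V' by (auto simp: f'_def)
  qed
  have "f' x \<in> W \<and> clusters V' f' x (up (f' x))" if x: "x \<in> V'" for x
  proof (cases "x \<in> V")
    case True
    then have "f x \<in> W" "clusters V f x (up (f x))"
      using V unfolding dmor_def by blast+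
    then show ?thesis
      using True V V' clusters_cong[of V f x _ V V' f'] by (auto simp: f'_def)
  next
    case False
    then show ?thesis
      using cl'[of x] x V' c R_W by (auto simp: f'_def)
  qed
  then have "dmor V' f'"
    unfolding dmor_def by blast
  moreover have "mtopology interior_of cl V' = V'"
    unfolding clV' by (simp add: V'_def)
  moreover have "f' ` V' \<subseteq> insert c (f ` V)"
    by (auto simp: f'_def)
  ultimately show thesis
    using that[of V' f'] V' clV' cl' by (auto simp: f'_def)
qed

text \<open>
  Adjacent stops of a walk through the reflexive points of \<open>F\<close> have a common reflexive
  successor. A continuous function takes the value \<open>j\<close> on the pieces \<open>D i\<close> labelled with
  the \<open>j\<close>-th stop; the layers where it is near \<open>j + 1/2\<close> are filled with that common
  successor, and the remaining zones with the stops.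
\<close>

lemma extend:
  fixes D :: "'i \<Rightarrow> 'x set" and \<kappa> :: "'i \<Rightarrow> 'w"
  assumes U: "opn U" and F: "F \<subseteq> W" "F \<noteq> {}" "\<And>a b. a \<in> F \<Longrightarrow> R a b \<Longrightarrow> b \<in> F" "link_connected F"
    and fl: "\<And>e. e \<in> F \<Longrightarrow> R e e \<Longrightarrow> fills e"
    and D: "\<And>i. i \<in> I \<Longrightarrow> opn (D i) \<and> D i \<subseteq> U \<and> dmor (D i) f0 \<and> f0 ` D i \<subseteq> F"
    and \<kappa>: "\<And>i. i \<in> I \<Longrightarrow> \<kappa> i \<in> F \<and> R (\<kappa> i) (\<kappa> i)"
    and bdD: "\<And>i y. i \<in> I \<Longrightarrow> y \<in> U \<Longrightarrow> y \<in> bd (D i) \<Longrightarrow> clusters (D i) f0 y (up (\<kappa> i))"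
    and disc: "\<And>y. y \<in> U \<Longrightarrow> \<exists>N. opn N \<and> y \<in> N \<and> (\<forall>i\<in>I. \<forall>j\<in>I. N \<inter> D i \<noteq> {} \<longrightarrow> N \<inter> D j \<noteq> {} \<longrightarrow> i = j)"
  shows "\<exists>f. dmor U f \<and> f ` U \<subseteq> F \<and> (\<forall>i\<in>I. \<forall>y\<in>D i. f y = f0 y)"
proof -
  obtain xs where xs: "xs \<noteq> []" "set xs = {a\<in>F. R a a}"
    "successively (\<lambda>a b. \<exists>e\<in>F. R e e \<and> R a e \<and> R b e) xs"
    by (rule walk[OF F(4,3,1,2)])
  define m where "m = length xs"
  have xsF: "xs ! j \<in> F" "R (xs ! j) (xs ! j)" if "j < m" for j
    using nth_mem[of j xs] xs(2) that unfolding m_def by auto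
  have "\<exists>j. j < m \<and> xs ! j = c" if "c \<in> set xs" for c
    using that unfolding m_def by (metis in_set_conv_nth)
  then obtain idx where idx: "\<And>c. c \<in> set xs \<Longrightarrow> idx c < m \<and> xs ! idx c = c"
    by metis
  have "\<exists>e\<in>F. R e e \<and> R (xs ! j) e \<and> R (xs ! Suc j) e" if "Suc j < m" for j
    using xs(3) that unfolding m_def successively_conv_nth by blast
  then obtain e where e: "\<And>j. Suc j < m \<Longrightarrow> e j \<in> F \<and> R (e j) (e j) \<and> R (xs ! j) (e j) \<and> R (xs ! Suc j) (e j)"
    by metis
  have \<kappa>xs: "\<kappa> i \<in> set xs" if "i \<in> I" for i
    using \<kappa>[OF that] xs by blast

  \<comment> \<open>Closures are taken within \<open>U\<close>, where the family of pieces is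
    discrete: no point of \<open>U\<close> is a limit of pieces with two different labels.\<close>
  define K where "K c = U \<inter> cl (\<Union>i\<in>{i\<in>I. \<kappa> i = c}. D i)" for c
  have K_disj: "c = c'" if y: "y \<in> K c" "y \<in> K c'" for y c c'
  proof -
    have "y \<in> U"
      using y(1) unfolding K_def by blast
    obtain N where N: "opn N" "y \<in> N" "\<forall>i\<in>I. \<forall>j\<in>I. N \<inter> D i \<noteq> {} \<longrightarrow> N \<inter> D j \<noteq> {} \<longrightarrow> i = j"
      using disc[OF \<open>y \<in> U\<close>] by (elim exE conjE) (rule that)
    have "N \<inter> (\<Union>i\<in>{i\<in>I. \<kappa> i = c}. D i) \<noteq> {}" "N \<inter> (\<Union>i\<in>{i\<in>I. \<kappa> i = c'}. D i) \<noteq> {}"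
      using y cl_meets[OF _ N(1,2)] by (simp_all add: K_def)
    then have "\<exists>i\<in>I. \<kappa> i = c \<and> N \<inter> D i \<noteq> {}" "\<exists>j\<in>I. \<kappa> j = c' \<and> N \<inter> D j \<noteq> {}"
      by auto
    then show ?thesis using N(3) by metis
  qed
  define K0 where "K0 = (\<Union>c\<in>set xs. K c)"
  let ?XU = "subtopology mtopology U"
  have topU: "topspace ?XU = U"
    using opn_subset[OF U] by (simp add: Int_absorb1)
  have cK: "closedin ?XU (K c)" for c
    unfolding K_def by (metis closedin_closure_of closedin_subtopology_Int_closed)
  have cK_Un: "closedin ?XU (\<Union>c\<in>C. K c)" if "finite C" for C
    using that cK by (intro closedin_Union) auto
  define k where "k y = real (idx (SOME c. c \<in> set xs \<and> y \<in> K c))" for y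
  have k: "k y = real (idx c)" if "c \<in> set xs" "y \<in> K c" for y c
  proof -
    have "(SOME c. c \<in> set xs \<and> y \<in> K c) = c"
      using that K_disj by (intro some_equality) auto
    then show ?thesis by (simp add: k_def)
  qed
  \<comment> \<open>The preimage of any set is a union of some of the finitely many closed sets
    \<open>K c\<close>.\<close>
  have "continuous_map (subtopology ?XU K0) euclideanreal k"
    unfolding continuous_map_closedin
  proof (intro conjI allI impI ballI)
    fix C :: "real set" assume "closedin euclideanreal C"
    have K0U: "topspace (subtopology ?XU K0) = K0"
      using topU unfolding K0_def K_def by auto
    have "{x \<in> topspace (subtopology ?XU K0). k x \<in> C} = (\<Union>c\<in>{c \<in> set xs. real (idx c) \<in> C}. K c)"
      unfolding K0U using k unfolding K0_def by auto
    moreover have "(\<Union>c\<in>{c \<in> set xs. real (idx c) \<in> C}. K c) \<subseteq> K0"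
      unfolding K0_def by blast
    ultimately show "closedin (subtopology ?XU K0) {x \<in> topspace (subtopology ?XU K0). k x \<in> C}"
      using cK_Un[of "{c \<in> set xs. real (idx c) \<in> C}"] by (simp add: closedin_subset_topspace)
  qed simp
  moreover have "normal_space ?XU"
    by (simp add: metrizable_imp_normal_space metrizable_space_mtopology metrizable_space_subtopology)
  moreover have "closedin ?XU K0"
    unfolding K0_def by (rule cK_Un) simp
  moreover have "k ` K0 \<subseteq> {0..real (m - 1)}"
  proof
    fix r assume "r \<in> k ` K0"
    then obtain c y where "c \<in> set xs" "y \<in> K c" "r = k y"
      unfolding K0_def by blast
    then have "r = real (idx c)" "idx c < m"
      using k idx by auto
    then show "r \<in> {0..real (m - 1)}" by simp
  qed
  ultimately obtain g where g: "continuous_map ?XU euclideanreal g" "\<And>y. y \<in> K0 \<Longrightarrow> g y = k y"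
      "g ` U \<subseteq> {0..real (m - 1)}"
    using Tietze_extension_closed_real_interval[of ?XU K0 k 0 "real (m - 1)"] topU
    by (metis of_nat_0_le_iff)
  have "m > 0"
    using xs(1) by (simp add: m_def)
  have g_rng: "0 \<le> g y" "g y \<le> real m - 1" if "y \<in> U" for y
    using g(3) that \<open>m > 0\<close> by (auto simp: of_nat_diff image_subset_iff)
  have opg: "opn {y \<in> U. a < g y \<and> g y < b}" for a b
  proof -
    have "openin ?XU {y \<in> topspace ?XU. g y \<in> {a<..<b}}"
      using g(1) by (rule openin_continuous_map_preimage) simp
    then show ?thesis
      unfolding topU using U by (simp add: openin_open_subtopology)
  qed
  have gD: "g y = real (idx (\<kappa> i))" if "i \<in> I" "y \<in> D i" for i y
  proof -
    have "D i \<subseteq> cl (\<Union>i'\<in>{i'\<in>I. \<kappa> i' = \<kappa> i}. D i')"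
      using closure_of_mono[of "D i" "\<Union>i'\<in>{i'\<in>I. \<kappa> i' = \<kappa> i}. D i'" mtopology] cl_superset[of "D i"] D[OF that(1)] that(1) by blast
    then have yK: "y \<in> K (\<kappa> i)"
      using D[OF that(1)] that(2) unfolding K_def by blast
    then have "y \<in> K0"
      using \<kappa>xs[OF that(1)] unfolding K0_def by blast
    then show ?thesis
      using g(2)[of y] k[OF \<kappa>xs[OF that(1)] yK] by simp
  qed

  \<comment> \<open>On a piece \<open>g\<close> is an integer, so the layers avoid the pieces. They
    contain the levels \<open>j + 1/2\<close>, and their edges stay clear of these levels and of the
    integers.\<close>
  define Wl where "Wl j = {y \<in> U. real j + 1/3 < g y \<and> g y < real j + 2/3}" for j
  have "\<exists>q. dmor (Wl j) q \<and> q ` Wl j \<subseteq> up (e j) \<and> (\<forall>y\<in>bd (Wl j). clusters (Wl j) q y (up (e j)))" if "Suc j < m" for j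
  proof -
    have "e j \<in> F" "R (e j) (e j)" "opn (Wl j)"
      using e[OF that] opg unfolding Wl_def by auto
    then show ?thesis
      using fl[of "e j", unfolded fills_def, rule_format, of "Wl j"] by metis
  qed
  then obtain q where q: "\<And>j. Suc j < m \<Longrightarrow> dmor (Wl j) (q j) \<and> q j ` Wl j \<subseteq> up (e j) \<and> (\<forall>y\<in>bd (Wl j). clusters (Wl j) (q j) y (up (e j)))"
    by metis
  define DD where "DD = (\<Union>i\<in>I. D i)"
  define D' where "D' = DD \<union> (\<Union>j\<in>{j. Suc j < m}. Wl j)"
  define f1 where "f1 y = (if y \<in> DD then f0 y else q (nat \<lfloor>g y\<rfloor>) y)" for y
  have opW: "opn (Wl j)" for j
    unfolding Wl_def by (rule opg)
  have W_floor: "nat \<lfloor>g y\<rfloor> = j" if "y \<in> Wl j" for y j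
  proof -
    have "\<lfloor>g y\<rfloor> = int j"
      using that unfolding Wl_def floor_eq_iff by auto
    then show ?thesis by simp
  qed
  have W_DD: "y \<notin> DD" if "y \<in> Wl j" for y j
  proof
    assume "y \<in> DD"
    then obtain i where "i \<in> I" "y \<in> D i"
      unfolding DD_def by blast
    then have "real j + 1/3 < real (idx (\<kappa> i))" "real (idx (\<kappa> i)) < real j + 2/3"
      using gD that unfolding Wl_def by auto
    then have "j < idx (\<kappa> i)" "idx (\<kappa> i) < Suc j" by linarith+
    then show False by simp
  qed
  have f1D: "f1 y = f0 y" if "i \<in> I" "y \<in> D i" for i y
    using that unfolding f1_def DD_def by auto
  have f1W: "f1 y = q j y" if "y \<in> Wl j" for j y
    using that W_DD W_floor unfolding f1_def by simp
  have opD': "opn D'"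
    using D opW unfolding D'_def DD_def by (intro openin_Un openin_Union) auto
  have D'U: "D' \<subseteq> U"
    using D unfolding D'_def DD_def Wl_def by blast
  have mor_f1: "dmor D' f1"
  proof (rule dmor_local)
    fix x assume "x \<in> D'"
    then consider i where "i \<in> I" "x \<in> D i" | j where "Suc j < m" "x \<in> Wl j"
      unfolding D'_def DD_def by blast
    then show "\<exists>N V' f'. opn N \<and> x \<in> N \<and> dmor V' f' \<and> (\<forall>y\<in>N. (y \<in> D' \<longleftrightarrow> y \<in> V') \<and> (y \<in> D' \<longrightarrow> f1 y = f' y))"
    proof cases
      case 1
      have "\<forall>y\<in>D i. y \<in> D'"
        using 1 unfolding D'_def DD_def by blast
      then show ?thesis
        using 1 D f1D by (intro exI[of _ "D i"] exI[of _ f0]) auto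
    next
      case 2
      have "\<forall>y\<in>Wl j. y \<in> D'"
        using 2 unfolding D'_def by blast
      then show ?thesis
        using 2 q opW f1W by (intro exI[of _ "Wl j"] exI[of _ "q j"]) auto
    qed
  qed
  have f1F: "f1 ` D' \<subseteq> F"
  proof
    fix a assume "a \<in> f1 ` D'"
    then obtain y where y: "y \<in> D'" "a = f1 y" by blast
    then consider i where "i \<in> I" "y \<in> D i" | j where "Suc j < m" "y \<in> Wl j"
      unfolding D'_def DD_def by blast
    then show "a \<in> F"
    proof cases
      case 1
      then show ?thesis using D[of i] f1D y by auto
    next
      case 2
      then have "R (e j) (q j y)" using q[of j] by auto
      then show ?thesis using 2 f1W y F(3) e[of j] by auto
    qed
  qed

  \<comment> \<open>The zones are disjoint. The levels between them lie inside the layers, where the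
    map is already settled, so the zones can be filled independently.\<close>
  define Z where "Z j = {y \<in> U. real j - 1/2 < g y \<and> g y < real j + 1/2}" for j
  have opZ: "opn (Z j)" for j
    unfolding Z_def by (rule opg)
  \<comment> \<open>Where \<open>D'\<close> coincides near \<open>y\<close> with a single piece or
    layer \<open>A\<close>, the boundary condition known for \<open>A\<close> carries over to
    \<open>D'\<close> inside the zone.\<close>
  have one_piece: "clusters (D' \<inter> Z j) f1 y K"
    if N: "opn N" "y \<in> N" "N \<subseteq> Z j" and A: "\<And>u. u \<in> N \<Longrightarrow> u \<in> D' \<longleftrightarrow> u \<in> A"
      and f1A: "\<And>u. u \<in> A \<Longrightarrow> f1 u = f' u" and y: "y \<in> bd (D' \<inter> Z j)"
      and cA: "y \<in> bd A \<Longrightarrow> clusters A f' y K" for N A f' y K j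
  proof -
    have "G \<inter> A \<noteq> {}" if "opn G" "y \<in> G" for G
    proof -
      have "(N \<inter> G) \<inter> (D' \<inter> Z j) \<noteq> {}"
        by (rule cl_meets[OF _ opn_Int[OF N(1) that(1)]]) (use y N(2) that(2) in simp_all)
      then show ?thesis using A by blast
    qed
    moreover have "y \<in> M" using opn_subset[OF N(1)] N(2) by blast
    ultimately have "y \<in> cl A" by (simp add: cl_iff)
    then have "y \<in> bd A"
      using y N(2,3) A[OF N(2)] by blast
    from cA[OF this] show ?thesis
      by (rule clusters_cong[OF _ N(1,2)]) (use A N(3) f1A in auto)
  qed
  have near: "\<exists>k. R k k \<and> R (xs ! j) k \<and> clusters (D' \<inter> Z j) f1 y (up k)"
    if j: "j < m" and y: "y \<in> Z j" "y \<in> bd (D' \<inter> Z j)" for j y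
  proof -
    have yU: "y \<in> U" and yZ: "real j - 1/2 < g y" "g y < real j + 1/2" and yD: "y \<notin> D'"
      using y unfolding Z_def by auto
    have meets: "N \<inter> D' \<inter> Z j \<noteq> {}" if "opn N" "y \<in> N" for N
      using cl_meets[of y "D' \<inter> Z j" N] y that by (simp add: Int_assoc)
    \<comment> \<open>Each case has a window of values of \<open>g\<close> that meets one kind of
      set only: within 1/3 of \<open>j\<close> there are no layers and only pieces labelled
      \<open>xs ! j\<close>; the windows of the other two cases contain no integer and meet no layer
      but \<open>Wl j\<close> or the one before it.\<close>
    consider "real j - 1/3 < g y" "g y < real j + 1/3" | "g y \<ge> real j + 1/3" | "g y \<le> real j - 1/3"
      by linarith
    then show ?thesis
    proof cases
      case 1
      obtain N1 where N1: "opn N1" "y \<in> N1" "\<forall>i\<in>I. \<forall>j\<in>I. N1 \<inter> D i \<noteq> {} \<longrightarrow> N1 \<inter> D j \<noteq> {} \<longrightarrow> i = j"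
        using disc[OF yU] by blast
      define N where "N = N1 \<inter> {y \<in> U. real j - 1/3 < g y \<and> g y < real j + 1/3}"
      have N: "opn N" "y \<in> N" "N \<subseteq> Z j"
        using N1 opn_Int opg yU 1 unfolding N_def Z_def by auto
      have NW: "z \<notin> Wl j'" if "z \<in> N" for z j'
      proof
        assume "z \<in> Wl j'"
        then have "real j' + 1/3 < real j + 1/3" "real j - 1/3 < real j' + 2/3"
          using that unfolding N_def Wl_def by auto
        then have "j' < j" "j < Suc j'" by linarith+
        then show False by simp
      qed
      obtain z where z: "z \<in> N" "z \<in> D'"
        using meets[OF N(1,2)] by blast
      then obtain i where i: "i \<in> I" "z \<in> D i"
        using NW unfolding D'_def DD_def by blast
      have Di: "u \<in> D' \<longleftrightarrow> u \<in> D i" if "u \<in> N" for u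
      proof -
        have "u \<in> D i" if "i' \<in> I" "u \<in> D i'" for i'
          using that N1(3) i z \<open>u \<in> N\<close> unfolding N_def by blast
        then show ?thesis
          using NW[OF that] i(1) unfolding D'_def DD_def by blast
      qed
      have "real j - 1/3 < real (idx (\<kappa> i))" "real (idx (\<kappa> i)) < real j + 1/3"
        using gD[OF i] z(1) unfolding N_def by auto
      then have "idx (\<kappa> i) = j" by linarith
      then have kj: "\<kappa> i = xs ! j"
        using idx[OF \<kappa>xs[OF i(1)]] by simp
      have "clusters (D' \<inter> Z j) f1 y (up (\<kappa> i))"
        by (rule one_piece[OF N Di f1D[OF i(1)] y(2) bdD[OF i(1) yU]])
      then show ?thesis
        using kj xsF[OF j] by auto
    next
      case 2
      then have "Suc j < m"
        using g_rng(2)[OF yU] by linarith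
      define N where "N = {y \<in> U. real j + 1/6 < g y \<and> g y < real j + 1/2}"
      have N: "opn N" "y \<in> N" "N \<subseteq> Z j"
        using opg yU yZ 2 unfolding N_def Z_def by auto
      have Di: "u \<in> D' \<longleftrightarrow> u \<in> Wl j" if "u \<in> N" for u
      proof -
        have "u \<notin> D i" if "i \<in> I" for i
        proof
          assume "u \<in> D i"
          then have "real j + 1/6 < real (idx (\<kappa> i))" "real (idx (\<kappa> i)) < real j + 1/2"
            using gD[OF that] \<open>u \<in> N\<close> unfolding N_def by auto
          then have "j < idx (\<kappa> i)" "idx (\<kappa> i) < Suc j" by linarith+
          then show False by simp
        qed
        moreover have "j' = j" if "u \<in> Wl j'" for j'
        proof -
          have "real j' + 1/3 < real j + 1/2" "real j + 1/6 < real j' + 2/3"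
            using that \<open>u \<in> N\<close> unfolding N_def Wl_def by auto
          then show ?thesis by linarith
        qed
        ultimately show ?thesis
          using \<open>Suc j < m\<close> unfolding D'_def DD_def by blast
      qed
      have "clusters (D' \<inter> Z j) f1 y (up (e j))"
        by (rule one_piece[OF N Di f1W y(2)]) (use q[OF \<open>Suc j < m\<close>] in auto)
      then show ?thesis
        using e[OF \<open>Suc j < m\<close>] by blast
    next
      case 3
      then obtain j' where j': "j = Suc j'"
        using g_rng(1)[OF yU] by (cases j) auto
      then have "Suc j' < m"
        using j by simp
      define N where "N = {y \<in> U. real j' + 1/2 < g y \<and> g y < real j' + 5/6}"
      have N: "opn N" "y \<in> N" "N \<subseteq> Z j"
        using opg yU yZ 3 unfolding N_def Z_def j' by auto
      have Di: "u \<in> D' \<longleftrightarrow> u \<in> Wl j'" if "u \<in> N" for u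
      proof -
        have "u \<notin> D i" if "i \<in> I" for i
        proof
          assume "u \<in> D i"
          then have "real j' + 1/2 < real (idx (\<kappa> i))" "real (idx (\<kappa> i)) < real j' + 5/6"
            using gD[OF that] \<open>u \<in> N\<close> unfolding N_def by auto
          then have "j' < idx (\<kappa> i)" "idx (\<kappa> i) < Suc j'" by linarith+
          then show False by simp
        qed
        moreover have "l = j'" if "u \<in> Wl l" for l
        proof -
          have "real l + 1/3 < real j' + 5/6" "real j' + 1/2 < real l + 2/3"
            using that \<open>u \<in> N\<close> unfolding N_def Wl_def by auto
          then show ?thesis by linarith
        qed
        ultimately show ?thesis
          using \<open>Suc j' < m\<close> unfolding D'_def DD_def by blast
      qed
      have "clusters (D' \<inter> Z j) f1 y (up (e j'))"
        by (rule one_piece[OF N Di f1W y(2)]) (use q[OF \<open>Suc j' < m\<close>] in auto)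
      then show ?thesis
        using e[OF \<open>Suc j' < m\<close>] j' by blast
    qed
  qed
  \<comment> \<open>By \<open>near\<close>, whatever adjoins the zone shows the successors of some
    reflexive \<open>k\<close> above the stop \<open>xs ! j\<close>, so the zone can be filled from
    this stop.\<close>
  have "\<exists>f. dmor (Z j) f \<and> f ` Z j \<subseteq> F \<and> (\<forall>y\<in>D' \<inter> Z j. f y = f1 y)" if j: "j < m" for j
  proof (rule fill_region)
    show "dmor (D' \<inter> Z j) f1"
    proof (rule dmor_local)
      fix x assume "x \<in> D' \<inter> Z j"
      then show "\<exists>N V' f'. opn N \<and> x \<in> N \<and> dmor V' f' \<and> (\<forall>y\<in>N. (y \<in> D' \<inter> Z j \<longleftrightarrow> y \<in> V') \<and> (y \<in> D' \<inter> Z j \<longrightarrow> f1 y = f' y))"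
        using mor_f1 opZ by (intro exI[of _ "Z j"] exI[of _ D'] exI[of _ f1]) simp
    qed
    show "f1 ` (D' \<inter> Z j) \<subseteq> F"
      using f1F by blast
  qed (use opZ opD' opn_Int xsF[OF j] fl F(3) near[OF j] in auto)
  then obtain fz where fz: "\<And>j. j < m \<Longrightarrow> dmor (Z j) (fz j) \<and> fz j ` Z j \<subseteq> F \<and> (\<forall>y\<in>D' \<inter> Z j. fz j y = f1 y)"
    by metis
  define f where "f y = (if y \<in> D' then f1 y else fz (nat \<lfloor>g y + 1/2\<rfloor>) y)" for y
  have f_Z: "f y = fz j y" if "j < m" "y \<in> Z j" for j y
  proof -
    have "\<lfloor>g y + 1/2\<rfloor> = int j"
      using that(2) unfolding Z_def floor_eq_iff by auto
    then show ?thesis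
      using fz[OF that(1)] that(2) unfolding f_def by auto
  qed
  have cover: "(\<exists>j<m. y \<in> Z j) \<or> (\<exists>j. Suc j < m \<and> y \<in> Wl j)" if yU: "y \<in> U" for y
  proof -
    define j where "j = nat \<lfloor>g y + 1/2\<rfloor>"
    have "real j = of_int \<lfloor>g y + 1/2\<rfloor>"
      using g_rng(1)[OF that] unfolding j_def by simp
    then have j: "real j \<le> g y + 1/2" "g y + 1/2 < real j + 1"
      by linarith+
    then have "real j < real m"
      using g_rng(2)[OF that] by linarith
    then have "j < m" by simp
    show ?thesis
    proof (cases "g y = real j - 1/2")
      case True
      then obtain i where "j = Suc i"
        using g_rng(1)[OF yU] by (cases j) auto
      then have "Suc i < m \<and> y \<in> Wl i"
        using True that \<open>j < m\<close> unfolding Wl_def by auto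
      then show ?thesis by blast
    next
      case False
      then have "y \<in> Z j"
        using j that unfolding Z_def by auto
      then show ?thesis using \<open>j < m\<close> by blast
    qed
  qed
  have "dmor U f"
  proof (rule dmor_local)
    fix x assume "x \<in> U"
    then consider j where "j < m" "x \<in> Z j" | j where "Suc j < m" "x \<in> Wl j"
      using cover by blast
    then show "\<exists>N V' f'. opn N \<and> x \<in> N \<and> dmor V' f' \<and> (\<forall>y\<in>N. (y \<in> U \<longleftrightarrow> y \<in> V') \<and> (y \<in> U \<longrightarrow> f y = f' y))"
    proof cases
      case 1
      have "\<forall>y\<in>Z j. y \<in> U" unfolding Z_def by blast
      then show ?thesis
        using 1 fz opZ f_Z by (intro exI[of _ "Z j"] exI[of _ "fz j"]) auto
    next
      case 2
      have "\<forall>y\<in>Wl j. y \<in> U \<and> f y = q j y"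
        using 2 f1W unfolding Wl_def f_def D'_def by auto
      then show ?thesis
        using 2 q opW by (intro exI[of _ "Wl j"] exI[of _ "q j"]) auto
    qed
  qed
  moreover have "f y \<in> F" if yU: "y \<in> U" for y
  proof (cases "y \<in> D'")
    case True
    then show ?thesis using f1F unfolding f_def by auto
  next
    case False
    then obtain j where "j < m" "y \<in> Z j"
      using cover[OF yU] unfolding D'_def by blast
    then show ?thesis
      using f_Z fz[of j] by auto
  qed
  moreover have "f y = f0 y" if "i \<in> I" "y \<in> D i" for i y
  proof -
    have "y \<in> D'" using that unfolding D'_def DD_def by blast
    then show ?thesis using f1D[OF that] by (simp add: f_def)
  qed
  ultimately show ?thesis by blast
qed

section \<open>Realizing one point of the frame near a point of the space\<close>

text \<open>The chain from \<open>x\<close> over \<open>z\<close>, \<open>y\<close> and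
  \<open>z'\<close> to \<open>x'\<close> has four links below \<open>r/4\<close>. So a ball of
  radius \<open>r/4\<close> meets at most one of the balls of this radius around points that are
  \<open>r\<close> apart.\<close>

lemma quarter_balls:
  assumes "z \<in> mball x (r/4)" "z' \<in> mball x' (r/4)" "z \<in> mball y (r/4)" "z' \<in> mball y (r/4)"
  shows "d x x' < r"
  using triangle[of x z x'] triangle[of z y x'] triangle[of y z' x'] commute[of z y] commute[of z' x'] assms by auto

lemma localizes_reflexive:
  assumes "R v v" "fills v"
  shows "localizes v"
  unfolding localizes_def
proof (intro allI impI)
  fix x N assume N: "opn N" "x \<in> N"
  then obtain r where r: "r > 0" "mcball x r \<subseteq> N" "x \<in> M"
    using opn_subset unfolding openin_mtopology_mcball by blast
  have "\<exists>f. dmor (mball x r) f \<and> f ` mball x r \<subseteq> up v \<and> (\<forall>y\<in>bd (mball x r). clusters (mball x r) f y (up v)) \<and> (mball x r \<noteq> {} \<longrightarrow> v \<in> f ` mball x r)"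
    using assms(2)[unfolded fills_def, rule_format, OF openin_mball] .
  moreover have "x \<in> mball x r"
    using r by simp
  ultimately obtain f where f: "dmor (mball x r) f" "f ` mball x r \<subseteq> up v" "v \<in> f ` mball x r"
      "\<And>y. y \<in> bd (mball x r) \<Longrightarrow> clusters (mball x r) f y (up v)"
    by (metis empty_iff)
  obtain V f' where V: "opn V" "mball x r \<subseteq> V" "cl V = cl (mball x r)" "mtopology interior_of cl V = V" "dmor V f'"
    "\<And>y. y \<in> mball x r \<Longrightarrow> f' y = f y" "f' ` V \<subseteq> insert v (f ` mball x r)" "\<And>y. y \<in> bd V \<Longrightarrow> clusters V f' y (up v)"
    using regularize[OF openin_mball f(1) assms(1) f(4)] by metis
  have "cl V \<subseteq> N"
    using V(3) r closure_of_minimal[OF mball_subset_mcball closedin_mcball, of x r] by auto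
  moreover have "x \<in> V"
    using V(2) \<open>x \<in> mball x r\<close> by blast
  moreover have "f' ` V \<subseteq> insert v (up v)"
    using V(7) f(2) by blast
  moreover have "v \<in> f' ` V"
  proof -
    obtain z where "z \<in> mball x r" "f z = v"
      using f(3) by (metis imageE)
    then have "z \<in> V" "f' z = v"
      using V(2,6) by auto
    then show ?thesis by blast
  qed
  ultimately show "\<exists>V f c. opn V \<and> x \<in> V \<and> cl V \<subseteq> N \<and> mtopology interior_of cl V = V \<and> dmor V f \<and>
      f ` V \<subseteq> insert v (up v) \<and> v \<in> f ` V \<and> R c c \<and> R v c \<and> (\<forall>y\<in>bd V. clusters V f y (up c))"
    using V(1,4,5,8) assms(1) by (intro exI[of _ V] exI[of _ f'] exI[of _ v] conjI ballI) simp_all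
qed

lemma dense_mball:
  assumes "x \<in> M" "r > 0"
  shows "\<exists>y\<in>M. 0 < d x y \<and> d x y < r"
proof -
  obtain y where "y \<in> mball x r" "y \<noteq> x"
    using dense[OF openin_mball, of x x r] assms by auto
  then show ?thesis
    using mdist_pos_less[of x y] by auto
qed

text \<open>
  Around \<open>x\<close>, pieces realizing the successors of \<open>v\<close> accumulate at \<open>x\<close> only, while a shell at
  the boundary of the ball shows nothing but successors of a single reflexive point.
\<close>

lemma localizes_irreflexive:
  assumes v: "v \<in> W" "\<not> R v v" "link_connected (up v)"
    and loc: "\<And>u. R v u \<Longrightarrow> localizes u" and fl: "\<And>u. R v u \<Longrightarrow> R u u \<Longrightarrow> fills u"
  shows "localizes v"
  unfolding localizes_def
proof (intro allI impI)
  fix x N assume N: "opn N" "x \<in> N"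
  then obtain r where r: "r > 0" "mcball x r \<subseteq> N" "x \<in> M"
    using opn_subset unfolding openin_mtopology_mcball by blast
  obtain c where c: "R v c" "R c c"
    using reflexive_above[OF v(1)] by blast
  have "c \<in> up v" using c by blast
  then obtain u :: "nat \<Rightarrow> 'w" where u': "u 0 = c" "\<And>n. u n \<in> up v" "\<And>b m. b \<in> up v \<Longrightarrow> \<exists>n\<ge>m. u n = b"
    by (rule enumerate_cofinally[OF finite_up]) (rule that)
  have u: "\<And>n. R v (u n)" "\<And>b m. R v b \<Longrightarrow> \<exists>n\<ge>m. u n = b"
    using u'(2,3) by auto
  have "\<exists>p. (p 0 \<in> M \<and> 0 < d x (p 0) \<and> d x (p 0) < r / 2) \<and>
      (\<forall>n. (p (Suc n) \<in> M \<and> 0 < d x (p (Suc n)) \<and> d x (p (Suc n)) < r / 2) \<and> d x (p (Suc n)) \<le> d x (p n) / 2)"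
  proof -
    have "\<exists>y. (y \<in> M \<and> 0 < d x y \<and> d x y < r / 2) \<and> d x y \<le> d x z / 2"
      if z: "z \<in> M \<and> 0 < d x z \<and> d x z < r / 2" for z
    proof -
      obtain y where "y \<in> M" "0 < d x y" "d x y < d x z / 2"
        using dense_mball[of x "d x z / 2"] z r(3) by auto
      then show ?thesis
        using z by (intro exI[of _ y]) auto
    qed
    moreover have "\<exists>y. y \<in> M \<and> 0 < d x y \<and> d x y < r / 2"
      using dense_mball[of x "r / 2"] r by auto
    ultimately show ?thesis
      using dependent_nat_choice[of "\<lambda>_ y. y \<in> M \<and> 0 < d x y \<and> d x y < r / 2" "\<lambda>_ z y. d x y \<le> d x z / 2"] by metis
  qed
  then obtain p where p0: "p 0 \<in> M" "0 < d x (p 0)" "d x (p 0) < r / 2"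
    and pS: "\<And>n. p (Suc n) \<in> M" "\<And>n. 0 < d x (p (Suc n))" "\<And>n. d x (p (Suc n)) \<le> d x (p n) / 2"
    by blast
  have p: "p n \<in> M" "0 < d x (p n)" for n
    using p0 pS by (cases n; simp)+
  \<comment> \<open>The piece with index \<open>n\<close> lies at distance about
    \<open>\<delta> n\<close> from \<open>x\<close>; index 0 is reserved for the shell. The bound
    \<open>r / 2\<close> on the first point makes the distances halve from the start.\<close>
  define \<delta> where "\<delta> n = (case n of 0 \<Rightarrow> r | Suc n \<Rightarrow> d x (p n))" for n
  have \<delta>0: "\<delta> 0 = r" and \<delta>S: "\<delta> (Suc n) = d x (p n)" for n
    by (simp_all add: \<delta>_def)
  have \<delta>_pos: "0 < \<delta> n" for n
    using p r by (cases n) (simp_all add: \<delta>0 \<delta>S)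
  have \<delta>_half: "\<delta> (Suc n) \<le> \<delta> n / 2" for n
    using p0 pS by (cases n) (simp_all add: \<delta>0 \<delta>S)
  have \<delta>_less: "\<delta> n \<le> \<delta> m / 2" if "m < n" for m n
    using that
  proof (induction n)
    case (Suc n)
    then show ?case
      using \<delta>_half[of n] \<delta>_pos[of n] \<delta>_pos[of m] by (cases "m = n") (auto simp: less_Suc_eq)
  qed simp
  have \<delta>_pow: "\<delta> n \<le> r / 2 ^ n" for n
  proof (induction n)
    case (Suc n)
    then have "\<delta> n / 2 \<le> (r / 2 ^ n) / 2"
      by (rule divide_right_mono) simp
    then have "\<delta> (Suc n) \<le> (r / 2 ^ n) / 2"
      by (rule order_trans[OF \<delta>_half])
    then show ?case by simp
  qed (simp add: \<delta>0)
  have "\<exists>V f c. opn V \<and> cl V \<subseteq> mball (p n) (\<delta> (Suc n) / 4) \<and> dmor V f \<and> f ` V \<subseteq> insert (u n) (up (u n)) \<and> u n \<in> f ` V \<and>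
      R c c \<and> R (u n) c \<and> (\<forall>y\<in>bd V. clusters V f y (up c))" for n
  proof -
    have "p n \<in> mball (p n) (\<delta> (Suc n) / 4)"
      using p(1)[of n] \<delta>_pos[of "Suc n"] by simp
    from loc[OF u(1)[of n], unfolded localizes_def, rule_format, OF openin_mball this] show ?thesis
      by metis
  qed
  then obtain V h k where V: "\<And>n. opn (V n)" "\<And>n. cl (V n) \<subseteq> mball (p n) (\<delta> (Suc n) / 4)" "\<And>n. dmor (V n) (h n)"
      "\<And>n. h n ` V n \<subseteq> insert (u n) (up (u n))" "\<And>n. u n \<in> h n ` V n" "\<And>n. R (k n) (k n)" "\<And>n. R (u n) (k n)"
      "\<And>n y. y \<in> bd (V n) \<Longrightarrow> clusters (V n) (h n) y (up (k n))"
    by metis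
  define shell where "shell = mball x r - mcball x (3/4 * r)"
  have shell: "opn shell" "\<And>y. y \<in> shell \<longleftrightarrow> y \<in> M \<and> 3/4 * r < d x y \<and> d x y < r"
    using r unfolding shell_def by (auto simp: openin_diff)
  obtain q where q: "dmor shell q" "q ` shell \<subseteq> up c" "\<And>y. y \<in> bd shell \<Longrightarrow> clusters shell q y (up c)"
    using fl[OF c, unfolded fills_def, rule_format, OF shell(1)] by metis
  define D where "D n = (case n of 0 \<Rightarrow> shell | Suc n \<Rightarrow> V n)" for n
  define ff where "ff n = (case n of 0 \<Rightarrow> q | Suc n \<Rightarrow> h n)" for n
  define \<kappa> where "\<kappa> n = (case n of 0 \<Rightarrow> c | Suc n \<Rightarrow> k n)" for n
  have rng: "y \<in> M \<and> 3/4 * \<delta> n < d x y \<and> d x y < 5/4 * \<delta> n" if "y \<in> D n" for n y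
  proof (cases n)
    case 0
    then show ?thesis using that shell(2) r by (simp add: D_def \<delta>0)
  next
    case (Suc n')
    then have "y \<in> cl (V n')"
      using that cl_superset[OF V(1)] by (auto simp: D_def)
    then have "y \<in> M" "d (p n') y < \<delta> n / 4"
      using V(2)[of n'] Suc by auto
    moreover have "d x y \<le> d x (p n') + d (p n') y" "d x (p n') \<le> d x y + d (p n') y"
      using triangle[of x "p n'" y] triangle[of x y "p n'"] commute[of y "p n'"] p r \<open>y \<in> M\<close> by auto
    ultimately show ?thesis
      using Suc by (simp add: \<delta>S)
  qed
  have opD: "opn (D n)" for n
    using shell(1) V(1) by (cases n) (simp_all add: D_def)
  have morD: "dmor (D n) (ff n)" for n
    using q(1) V(3) by (cases n) (simp_all add: D_def ff_def)
  have bdD: "clusters (D n) (ff n) y (up (\<kappa> n))" if "y \<in> bd (D n)" for n y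
    using q(3) V(8) that by (cases n) (simp_all add: D_def ff_def \<kappa>_def)
  have upD: "ff n ` D n \<subseteq> up v" for n
  proof (cases n)
    case 0
    then show ?thesis using q(2) R_trans[OF c(1)] by (auto simp: D_def ff_def)
  next
    case (Suc n')
    then show ?thesis using V(4)[of n'] u(1)[of n'] R_trans[OF u(1)[of n']] by (auto simp: D_def ff_def)
  qed
  have \<kappa>: "R v (\<kappa> n) \<and> R (\<kappa> n) (\<kappa> n)" for n
    using c V(6) R_trans[OF u(1) V(7)] by (cases n) (simp_all add: \<kappa>_def)
  \<comment> \<open>A piece lies between 3/4 and 5/4 of its \<open>\<delta>\<close>, and a later
    \<open>\<delta>\<close> is at most half of an earlier one. So distances in two different pieces
    have a ratio above (3/4)/(5/8) = 6/5, while the ends of the window have ratio 13/11, which is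
    smaller.\<close>
  have window: "m = n" if "y \<in> D m" "z \<in> D n" "11/12 * \<eta> < d x y" "d x y < 13/12 * \<eta>" "11/12 * \<eta> < d x z" "d x z < 13/12 * \<eta>" for m n y z \<eta>
    using rng[OF that(1)] rng[OF that(2)] \<delta>_less[of m n] \<delta>_less[of n m] that(3-) \<delta>_pos[of m] \<delta>_pos[of n]
    by (cases m n rule: linorder_cases) auto
  have D_inj: "m = n" if "y \<in> D m" "y \<in> D n" for m n y
    using window[OF that, of "d x y"] rng[OF that(1)] \<delta>_pos[of m] by auto
  obtain f0 where "\<And>n y. n \<in> UNIV \<Longrightarrow> y \<in> D n \<Longrightarrow> f0 y = ff n y"
    using glue[of UNIV D ff thesis] D_inj by blast
  then have f0: "\<And>n y. y \<in> D n \<Longrightarrow> f0 y = ff n y" by simp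
  define V0 where "V0 = mball x r"
  \<comment> \<open>Removing \<open>x\<close> removes the only point of the ball at which the pieces
    accumulate, so that the family is discrete in \<open>U\<close>.\<close>
  define U where "U = V0 - {x}"
  have "closedin mtopology {x}"
    using r Hausdorff_imp_t1_space[OF Hausdorff_space_mtopology] by (simp add: t1_space_closedin_singleton)
  then have U: "opn U"
    unfolding U_def V0_def by (intro openin_diff) auto
  have U_iff: "y \<in> U \<longleftrightarrow> y \<in> M \<and> 0 < d x y \<and> d x y < r" for y
    using r mdist_pos_eq[of x y] unfolding U_def V0_def by (cases "y = x") auto
  have DU: "D n \<subseteq> U" for n
  proof
    fix y assume y: "y \<in> D n"
    show "y \<in> U"
    proof (cases n)
      case 0
      then show ?thesis using y shell(2)[of y] r unfolding U_iff by (auto simp: D_def)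
    next
      case (Suc n')
      then show ?thesis
        using rng[OF y] \<delta>_pos[of n] \<delta>_less[of 0 n] \<delta>0 r unfolding U_iff by auto
    qed
  qed
  have "\<exists>f. dmor U f \<and> f ` U \<subseteq> up v \<and> (\<forall>n\<in>UNIV. \<forall>y\<in>D n. f y = f0 y)"
  proof (rule extend[where \<kappa> = \<kappa>])
    show "up v \<subseteq> W" "up v \<noteq> {}"
      using R_W c(1) by blast+
    show "\<And>a b. a \<in> up v \<Longrightarrow> R a b \<Longrightarrow> b \<in> up v"
      using R_trans by blast
    show "opn (D n) \<and> D n \<subseteq> U \<and> dmor (D n) f0 \<and> f0 ` D n \<subseteq> up v" for n
    proof (intro conjI)
      show "dmor (D n) f0"
        using dmor_cong[OF morD[of n] opD[of n], of f0] f0 by auto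
      show "f0 ` D n \<subseteq> up v"
        using upD[of n] f0 by auto
    qed (use opD DU in auto)
    show "clusters (D n) f0 y (up (\<kappa> n))" if "y \<in> U" "y \<in> bd (D n)" for n y
      by (rule clusters_cong[OF bdD[OF that(2)] U that(1)]) (use f0 in auto)
    show "\<exists>N. opn N \<and> y \<in> N \<and> (\<forall>i\<in>UNIV. \<forall>j\<in>UNIV. N \<inter> D i \<noteq> {} \<longrightarrow> N \<inter> D j \<noteq> {} \<longrightarrow> i = j)" if "y \<in> U" for y
    proof -
      define G where "G = mball x (13/12 * d x y) - mcball x (11/12 * d x y)"
      have y: "y \<in> M" "0 < d x y"
        using that unfolding U_iff by auto
      have G: "z \<in> G \<longleftrightarrow> z \<in> M \<and> 11/12 * d x y < d x z \<and> d x z < 13/12 * d x y" for z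
        using r unfolding G_def by auto
      have "i = j" if "G \<inter> D i \<noteq> {}" "G \<inter> D j \<noteq> {}" for i j
      proof -
        obtain z z' where "z \<in> G" "z \<in> D i" "z' \<in> G" "z' \<in> D j"
          using \<open>G \<inter> D i \<noteq> {}\<close> \<open>G \<inter> D j \<noteq> {}\<close> by blast
        then show ?thesis
          using window[of z i z' j "d x y"] G by simp
      qed
      moreover have "opn G"
        unfolding G_def by (intro openin_diff) auto
      moreover have "y \<in> G"
        using y G by simp
      ultimately show ?thesis by blast
    qed
  qed (use U v fl \<kappa> in auto)
  then obtain f where f: "dmor U f" "f ` U \<subseteq> up v" "\<And>n y. y \<in> D n \<Longrightarrow> f y = f0 y"
    by blast
  define f' where "f' y = (if y = x then v else f y)" for y
  have V0: "opn V0" "x \<in> V0" "x \<notin> U" "V0 = insert x U"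
    using r unfolding V0_def U_def by auto
  have "f' y \<in> W \<and> clusters V0 f' y (up (f' y))" if "y \<in> V0" for y
  proof (cases "y = x")
    case True
    have "f' z \<in> up v" if "z \<in> V0 \<inter> V0 - {x}" for z
      using f(2) V0 that unfolding f'_def by auto
    moreover have "\<exists>z\<in>G \<inter> V0 - {x}. f' z = a" if a: "R v a" and G: "opn G" "x \<in> G" for a G
    proof -
      obtain s where s: "s > 0" "mball x s \<subseteq> G"
        using G unfolding openin_mtopology by blast
      obtain m where "r / s < 2 ^ m"
        using real_arch_pow[of 2 "r / s"] by auto
      then have m: "r / 2 ^ m < s"
        using s by (simp add: field_simps)
      obtain n where n: "n \<ge> m" "u n = a"
        using u(2)[OF a] by blast
      then obtain z where z: "z \<in> V n" "h n z = a"
        using V(5)[of n] by auto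
      then have zD: "z \<in> D (Suc n)" by (simp add: D_def)
      have "f z = a"
        using f(3)[OF zD] f0[OF zD] z by (simp add: ff_def)
      moreover have "z \<in> G"
      proof -
        have "d x z < 5/4 * \<delta> (Suc n)" "z \<in> M"
          using rng[OF zD] by auto
        moreover have "\<delta> (Suc n) \<le> \<delta> n / 2"
          by (rule \<delta>_half)
        moreover have "\<delta> n \<le> r / 2 ^ n"
          by (rule \<delta>_pow)
        moreover have "r / 2 ^ n \<le> r / 2 ^ m"
          using n r by (intro divide_left_mono power_increasing) auto
        ultimately have "d x z < s"
          using m \<delta>_pos[of n] by linarith
        then show ?thesis
          using s r \<open>z \<in> M\<close> by auto
      qed
      moreover have "z \<in> U"
        using DU zD by blast
      ultimately show ?thesis
        using V0 unfolding f'_def by auto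
    qed
    ultimately have "clusters V0 f' x (up v)"
      by (intro clustersI[OF V0(1,2)]) auto
    then show ?thesis
      using v True by (simp add: f'_def)
  next
    case False
    then have "y \<in> U" using that V0 by auto
    then have fy: "f y \<in> W" "clusters U f y (up (f y))"
      using f(1) unfolding dmor_def by blast+
    have "clusters V0 f' y (up (f y))"
      by (rule clusters_cong[OF fy(2) U \<open>y \<in> U\<close>]) (use V0 in \<open>auto simp: f'_def\<close>)
    then show ?thesis
      using fy False by (simp add: f'_def)
  qed
  then have mor: "dmor V0 f'"
    unfolding dmor_def by blast
  have bdV0: "clusters V0 f' y (up c)" if y: "y \<in> bd V0" for y
  proof -
    have yM: "y \<in> M"
      using y by (simp add: cl_iff)
    have yr: "d x y \<ge> r"
      using y r yM unfolding V0_def by auto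
    \<comment> \<open>On \<open>G\<close> the ball and the shell are the same set, so the boundary
      of the ball sees only the shell.\<close>
    define G where "G = M - mcball x (3/4 * r)"
    have G: "opn G" "y \<in> G"
      using yM yr r unfolding G_def by (auto simp: openin_diff)
    have GV: "z \<in> shell \<longleftrightarrow> z \<in> V0" if "z \<in> G" for z
      using that shell(2)[of z] r unfolding G_def V0_def by auto
    have "y \<in> cl shell"
      unfolding cl_iff
    proof (intro conjI allI impI)
      fix A assume "opn A" "y \<in> A"
      then have "(G \<inter> A) \<inter> V0 \<noteq> {}"
        using cl_meets[of y V0 "G \<inter> A"] y G opn_Int[of G A] by blast
      then show "A \<inter> shell \<noteq> {}"
        using GV by blast
    qed (use yM in auto)
    then have "clusters shell q y (up c)"
      using q(3) shell(2) yr by auto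
    then show ?thesis
    proof (rule clusters_cong[OF _ G])
      fix z assume "z \<in> shell"
      then have "z \<in> D 0" by (simp add: D_def)
      then show "q z = f' z"
        using f(3)[of z 0] f0[of z 0] DU[of 0] V0 by (auto simp: f'_def ff_def)
    qed (use GV in auto)
  qed
  obtain V' g where V': "opn V'" "V0 \<subseteq> V'" "cl V' = cl V0" "mtopology interior_of cl V' = V'" "dmor V' g"
    "\<And>y. y \<in> V0 \<Longrightarrow> g y = f' y" "g ` V' \<subseteq> insert c (f' ` V0)" "\<And>y. y \<in> bd V' \<Longrightarrow> clusters V' g y (up c)"
    using regularize[OF V0(1) mor c(2) bdV0] by metis
  have "cl V' \<subseteq> N"
    using V'(3) r closure_of_minimal[OF mball_subset_mcball closedin_mcball, of x r] unfolding V0_def by auto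
  moreover have "f' ` V0 \<subseteq> insert v (up v)"
    using f(2) V0(4) unfolding f'_def by auto
  then have "g ` V' \<subseteq> insert v (up v)"
    using V'(7) c by blast
  moreover have "x \<in> V'" "g x = v"
    using V' V0 by (auto simp: f'_def)
  moreover from this have "v \<in> g ` V'" by blast
  ultimately show "\<exists>V f c. opn V \<and> x \<in> V \<and> cl V \<subseteq> N \<and> mtopology interior_of cl V = V \<and> dmor V f \<and>
      f ` V \<subseteq> insert v (up v) \<and> v \<in> f ` V \<and> R c c \<and> R v c \<and> (\<forall>y\<in>bd V. clusters V f y (up c))"
    using V'(1,4,5,8) c by (intro exI[of _ V'] exI[of _ g] exI[of _ c] conjI ballI) simp_all
qed

section \<open>Filling an open set from a reflexive point\<close>

definition net :: "real \<Rightarrow> 'x set \<Rightarrow> 'x set \<Rightarrow> bool" where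
  "net e Y I \<longleftrightarrow> I \<subseteq> Y \<and> (\<forall>x\<in>I. \<forall>y\<in>I. x \<noteq> y \<longrightarrow> e \<le> d x y) \<and> (\<forall>y\<in>Y. \<exists>x\<in>I. d x y < e)"

lemma net_exists:
  assumes "Y \<subseteq> M" "e > 0"
  shows "\<exists>I. net e Y I"
proof -
  define A where "A = {I. I \<subseteq> Y \<and> (\<forall>x\<in>I. \<forall>y\<in>I. x \<noteq> y \<longrightarrow> e \<le> d x y)}"
  have "\<Union>C \<in> A" if "C \<noteq> {}" "subset.chain A C" for C
  proof -
    have C: "C \<subseteq> A" "\<And>a b. a \<in> C \<Longrightarrow> b \<in> C \<Longrightarrow> a \<subseteq> b \<or> b \<subseteq> a"
      using that(2) unfolding subset_chain_def by blast+
    have "e \<le> d x y" if "x \<in> a" "a \<in> C" "y \<in> b" "b \<in> C" "x \<noteq> y" for x y a b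
    proof -
      obtain c where "c \<in> C" "x \<in> c" "y \<in> c"
        using C(2)[of a b] \<open>x \<in> a\<close> \<open>a \<in> C\<close> \<open>y \<in> b\<close> \<open>b \<in> C\<close> by (metis subsetD)
      then show ?thesis
        using C(1) \<open>x \<noteq> y\<close> unfolding A_def by blast
    qed
    then show ?thesis
      using C(1) unfolding A_def by blast
  qed
  moreover have "{} \<in> A"
    by (simp add: A_def)
  ultimately have "\<exists>I\<in>A. \<forall>J\<in>A. I \<subseteq> J \<longrightarrow> J = I"
    by (intro subset_Zorn_nonempty) auto
  then obtain I where I: "I \<in> A" and max: "\<And>J. J \<in> A \<Longrightarrow> I \<subseteq> J \<Longrightarrow> J = I"
    by metis
  have "\<exists>x\<in>I. d x y < e" if y: "y \<in> Y" for y
  proof (rule ccontr)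
    assume n: "\<not> (\<exists>x\<in>I. d x y < e)"
    then have n': "e \<le> d x y" "e \<le> d y x" if "x \<in> I" for x
      using that commute[of x y] by fastforce+
    then have "insert y I \<in> A"
      using I y unfolding A_def by auto
    then have "y \<in> I"
      using max[of "insert y I"] by blast
    then have "e \<le> d y y" by (rule n'(1))
    moreover have "y \<in> M" using y assms(1) by blast
    ultimately show False
      using mdist_zero[of y] assms(2) by simp
  qed
  then have "net e Y I"
    using I unfolding A_def net_def by simp
  then show ?thesis by blast
qed

text \<open>
  One step of the construction of a map that clusters to all of \<open>up c\<close> off the open set of
  points already treated: \<open>G\<close> is treated, \<open>B\<close> is a discrete set of points of the cluster of
  \<open>c\<close>, and the value \<open>l\<close> occurs within \<open>e\<close> of every point.
\<close>

definition stage :: "'w \<Rightarrow> 'w \<Rightarrow> real \<Rightarrow> 'x set \<Rightarrow> 'x set \<Rightarrow> 'x set \<Rightarrow> ('x \<Rightarrow> 'w) \<Rightarrow> bool" where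
  "stage c l e Y G B f \<longleftrightarrow> opn G \<and> cl G \<union> B \<subseteq> Y \<and> G \<inter> B = {} \<and> closedin mtopology (cl G \<union> B) \<and>
     dmor G f \<and> f ` G \<subseteq> up c \<and> (B \<noteq> {} \<longrightarrow> R l c) \<and>
     (\<forall>y\<in>cl Y. \<exists>z. d y z < e \<and> (z \<in> G \<and> f z = l \<or> z \<in> B)) \<and>
     (R l c \<longrightarrow> G = {}) \<and>
     (\<forall>y\<in>cl Y - G. y \<in> cl (Y - (cl G \<union> B)))"

text \<open>This covers cells that are points and cells that are regular open sets:
  \<open>H x\<close> bounds the open subsets of \<open>cl (V x)\<close> and is empty for a point and
  \<open>V x\<close> itself for a regular open set. A ball of radius \<open>r/4\<close> meets at
  most one cell, so closures may be taken cell by cell. If the rest of \<open>Y\<close> stayed away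
  from \<open>y\<close>, then near \<open>y\<close> the closure of one cell would cover
  \<open>Y\<close>, and \<open>y\<close> would lie in \<open>H x\<close>.\<close>

lemma separated_cells:
  assumes Y: "opn Y" and r: "r > 0" and I: "net r Y I"
    and V: "\<forall>x\<in>I. V x \<subseteq> cl (V x) \<and> cl (V x) \<subseteq> Y \<inter> mball x (r/4)"
    and H: "\<forall>x\<in>I. \<forall>N. opn N \<longrightarrow> N \<subseteq> cl (V x) \<longrightarrow> N \<subseteq> H x"
  defines "P \<equiv> \<Union>x\<in>I. V x"
  shows "\<And>x x' y. x \<in> I \<Longrightarrow> x' \<in> I \<Longrightarrow> y \<in> V x \<Longrightarrow> y \<in> V x' \<Longrightarrow> x = x'"
    and "\<And>y. y \<in> cl P \<Longrightarrow> \<exists>x\<in>I. y \<in> cl (V x)"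
    and "\<And>y. y \<in> cl Y \<Longrightarrow> \<exists>x\<in>I. \<forall>z\<in>V x. d y z < 3 * r"
    and "\<And>y. y \<in> cl Y \<Longrightarrow> y \<notin> (\<Union>x\<in>I. H x) \<Longrightarrow> y \<in> cl (Y - cl P)"
proof -
  have YM: "Y \<subseteq> M" by (rule opn_subset[OF Y])
  have V_ball: "V x \<subseteq> mball x (r/4)" if "x \<in> I" for x
    using V that by blast
  have one: "x = x'" if "x \<in> I" "x' \<in> I" "z \<in> V x" "z' \<in> V x'" "z \<in> mball y (r/4)" "z' \<in> mball y (r/4)" for x x' y z z'
  proof (rule ccontr)
    assume "x \<noteq> x'"
    moreover have "d x x' < r"
      by (rule quarter_balls[OF _ _ that(5,6)]) (use V_ball that(1-4) in blast)+
    ultimately show False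
      using I that(1,2) unfolding net_def by fastforce
  qed
  show "x = x'" if "x \<in> I" "x' \<in> I" "y \<in> V x" "y \<in> V x'" for x x' y
  proof (rule one[OF that, of y])
    have "y \<in> M" using V_ball[OF that(1)] that(3) by auto
    then show "y \<in> mball y (r/4)" "y \<in> mball y (r/4)" using r by simp_all
  qed
  have local: "\<exists>x\<in>I. P \<inter> N \<subseteq> V x" if N: "N \<subseteq> mball y (r/4)" "P \<inter> N \<noteq> {}" for N y
  proof -
    obtain z x where z: "x \<in> I" "z \<in> V x" "z \<in> N"
      using N(2) unfolding P_def by blast
    then have "P \<inter> N \<subseteq> V x"
      using one[of x _ z _ y] N(1) unfolding P_def by blast
    then show ?thesis using z(1) by blast
  qed
  have inV: "z \<in> cl (V x)" if "z \<in> cl P" "z \<in> N" "opn N" "P \<inter> N \<subseteq> V x" for z N x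
  proof -
    have "A \<inter> V x \<noteq> {}" if "opn A" "z \<in> A" for A
      using cl_meets[OF \<open>z \<in> cl P\<close> opn_Int[OF that(1) \<open>opn N\<close>]] that(2) \<open>z \<in> N\<close> \<open>P \<inter> N \<subseteq> V x\<close> by blast
    then show ?thesis
      using that(1) by (simp add: cl_iff)
  qed
  show "\<exists>x\<in>I. y \<in> cl (V x)" if y: "y \<in> cl P" for y
  proof -
    have B: "opn (mball y (r/4))" "y \<in> mball y (r/4)" using y r by (auto simp: cl_iff)
    then obtain x where x: "x \<in> I" "P \<inter> mball y (r/4) \<subseteq> V x"
      using local[of "mball y (r/4)" y] cl_meets[OF y] by blast
    then show ?thesis using inV[OF y B(2,1)] by blast
  qed
  show "\<exists>x\<in>I. \<forall>z\<in>V x. d y z < 3 * r" if y: "y \<in> cl Y" for y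
  proof -
    have yM: "y \<in> M" using y by (simp add: cl_iff)
    obtain y' where y': "y' \<in> mball y r" "y' \<in> Y"
      using cl_meets[OF y, of "mball y r"] yM r by fastforce
    obtain x where x: "x \<in> I" "d x y' < r"
      using I y'(2) unfolding net_def by blast
    \<comment> \<open>It is less than \<open>r\<close> to a point of \<open>Y\<close>,
      \<open>r\<close> on to the net and \<open>r/4\<close> within the cell.\<close>
    have "d y z < 3 * r" if "z \<in> V x" for z
    proof -
      have "z \<in> mball x (r/4)" using V_ball x(1) that by blast
      then show ?thesis
        using triangle[of y y' z] triangle[of y' x z] commute[of x y'] x y' r by auto
    qed
    then show ?thesis using x(1) by blast
  qed
  show "y \<in> cl (Y - cl P)" if y: "y \<in> cl Y" "y \<notin> (\<Union>x\<in>I. H x)" for y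
    unfolding cl_iff
  proof (intro conjI allI impI notI)
    show yM: "y \<in> M" using y by (simp add: cl_iff)
    fix N assume N: "opn N" "y \<in> N" and empty: "N \<inter> (Y - cl P) = {}"
    define N' where "N' = N \<inter> mball y (r/4)"
    have N': "opn N'" "y \<in> N'" using N yM r unfolding N'_def by auto
    have sub: "N' \<inter> Y \<subseteq> cl P" using empty unfolding N'_def by blast
    obtain p where p: "p \<in> N' \<inter> Y"
      using cl_meets[OF y(1) N'] by blast
    then have "P \<inter> N' \<noteq> {}"
      using cl_meets[of p P N'] sub N' by blast
    then obtain x where x: "x \<in> I" "P \<inter> N' \<subseteq> V x"
      using local[of N' y] unfolding N'_def by blast
    have clV: "N' \<inter> Y \<subseteq> cl (V x)"
      using inV[OF _ _ N'(1) x(2)] sub by blast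
    show False
    proof (cases "y \<in> cl (V x)")
      case True
      then have "y \<in> N' \<inter> Y" using V x(1) N' by blast
      then show False using H x(1) opn_Int[OF N'(1) Y] clV y(2) by blast
    next
      case False
      then have "(N' - cl (V x)) \<inter> Y \<noteq> {}"
        using cl_meets[OF y(1) opn_diff_cl[OF N'(1)]] N'(2) by blast
      then show False using clV by blast
    qed
  qed
qed

text \<open>A value \<open>l\<close> in the cluster of \<open>c\<close> has
  \<open>up l = up c\<close>. It can be put at isolated places, since every point off the open parts
  ends up with the limit values \<open>up c\<close> anyway.\<close>

lemma stage_point:
  assumes l: "R l c" and Y: "opn Y" and e: "e > 0"
  shows "\<exists>G B f. stage c l e Y G B f"
proof -
  define r where "r = e / 3"
  have r: "r > 0" using e by (simp add: r_def)
  have YM: "Y \<subseteq> M" by (rule opn_subset[OF Y])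
  obtain I where I: "net r Y I" using net_exists[OF YM r] by blast
  then have IY: "I \<subseteq> Y" by (simp add: net_def)
  have cl1: "cl {x} = {x}" if "x \<in> I" for x
    using that IY YM Hausdorff_imp_t1_space[OF Hausdorff_space_mtopology]
    by (intro closure_of_closedin) (auto simp: t1_space_closedin_singleton)
  have "\<forall>x\<in>I. {x} \<subseteq> cl {x} \<and> cl {x} \<subseteq> Y \<inter> mball x (r/4)"
    using cl1 IY YM r by auto
  moreover have "N \<subseteq> {}" if "x \<in> I" "opn N" "N \<subseteq> cl {x}" for x N
    using dense[OF that(2)] that(3) unfolding cl1[OF that(1)] by blast
  then have "\<forall>x\<in>I. \<forall>N. opn N \<longrightarrow> N \<subseteq> cl {x} \<longrightarrow> N \<subseteq> {}" by blast
  moreover have UI: "(\<Union>x\<in>I. {x}) = I" by blast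
  ultimately have cells: "\<And>y. y \<in> cl I \<Longrightarrow> \<exists>x\<in>I. y \<in> cl {x}"
    "\<And>y. y \<in> cl Y \<Longrightarrow> \<exists>x\<in>I. \<forall>z\<in>{x}. d y z < 3 * r" "\<And>y. y \<in> cl Y \<Longrightarrow> y \<in> cl (Y - cl I)"
    using separated_cells(2-4)[OF Y r I, of "\<lambda>x. {x}" "\<lambda>x. {}", unfolded UI] by simp_all
  have clI: "cl I = I"
  proof
    show "cl I \<subseteq> I"
    proof
      fix y assume "y \<in> cl I"
      then obtain x where "x \<in> I" "y \<in> cl {x}" using cells(1) by blast
      then show "y \<in> I" using cl1[of x] by simp
    qed
  qed (use IY YM in \<open>simp add: closure_of_subset\<close>)
  then have "closedin mtopology I"
    by (metis closedin_closure_of)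
  moreover have "dmor {} (\<lambda>_. l)"
    by (simp add: dmor_def)
  moreover have "\<exists>z. d y z < e \<and> z \<in> I" if "y \<in> cl Y" for y
    using cells(2)[OF that] by (auto simp: r_def)
  ultimately have "stage c l e Y {} I (\<lambda>_. l)"
    using IY l cells(3) clI unfolding stage_def by simp
  then show ?thesis by blast
qed

text \<open>For a strict successor \<open>l\<close>, the set \<open>up l\<close> lacks
  \<open>c\<close>, so \<open>l\<close> cannot occur where all of \<open>up c\<close> accumulates.
  It has to come with an open piece of its own.\<close>

lemma stage_open:
  assumes c: "R c l" "\<not> R l c" and loc: "localizes l" and Y: "opn Y" and e: "e > 0"
  shows "\<exists>G B f. stage c l e Y G B f"
proof -
  define r where "r = e / 3"
  have r: "r > 0" using e by (simp add: r_def)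
  have YM: "Y \<subseteq> M" by (rule opn_subset[OF Y])
  obtain I where I: "net r Y I" using net_exists[OF YM r] by blast
  then have IY: "I \<subseteq> Y" by (simp add: net_def)
  have "\<exists>V f. opn V \<and> cl V \<subseteq> Y \<inter> mball x (r/4) \<and> mtopology interior_of cl V = V \<and> dmor V f \<and> f ` V \<subseteq> up c \<and> l \<in> f ` V"
    if x: "x \<in> I" for x
  proof -
    have "opn (Y \<inter> mball x (r/4))" "x \<in> Y \<inter> mball x (r/4)"
      using Y x IY YM r by auto
    from loc[unfolded localizes_def, rule_format, OF this] obtain V f where "opn V" "cl V \<subseteq> Y \<inter> mball x (r/4)"
      "mtopology interior_of cl V = V" "dmor V f" "f ` V \<subseteq> insert l (up l)" "l \<in> f ` V"
      by metis
    moreover have "insert l (up l) \<subseteq> up c"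
      using c R_trans by blast
    ultimately show ?thesis by (metis subset_trans)
  qed
  then obtain V h where "\<forall>x\<in>I. opn (V x) \<and> cl (V x) \<subseteq> Y \<inter> mball x (r/4) \<and> mtopology interior_of cl (V x) = V x \<and>
      dmor (V x) (h x) \<and> h x ` V x \<subseteq> up c \<and> l \<in> h x ` V x"
    by metis
  then have V: "\<And>x. x \<in> I \<Longrightarrow> opn (V x)" "\<And>x. x \<in> I \<Longrightarrow> cl (V x) \<subseteq> Y \<inter> mball x (r/4)"
    "\<And>x. x \<in> I \<Longrightarrow> mtopology interior_of cl (V x) = V x" "\<And>x. x \<in> I \<Longrightarrow> dmor (V x) (h x)"
    "\<And>x. x \<in> I \<Longrightarrow> h x ` V x \<subseteq> up c" "\<And>x. x \<in> I \<Longrightarrow> l \<in> h x ` V x"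
    by auto
  define G where "G = (\<Union>x\<in>I. V x)"
  have "\<forall>x\<in>I. V x \<subseteq> cl (V x) \<and> cl (V x) \<subseteq> Y \<inter> mball x (r/4)"
    using cl_superset[OF V(1)] V(2) by simp
  moreover have "\<forall>x\<in>I. \<forall>N. opn N \<longrightarrow> N \<subseteq> cl (V x) \<longrightarrow> N \<subseteq> V x"
    using interior_of_maximal[of _ _ mtopology] V(3) by metis
  ultimately have cells: "\<And>x x' y. x \<in> I \<Longrightarrow> x' \<in> I \<Longrightarrow> y \<in> V x \<Longrightarrow> y \<in> V x' \<Longrightarrow> x = x'"
    "\<And>y. y \<in> cl G \<Longrightarrow> \<exists>x\<in>I. y \<in> cl (V x)" "\<And>y. y \<in> cl Y \<Longrightarrow> \<exists>x\<in>I. \<forall>z\<in>V x. d y z < 3 * r"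
    "\<And>y. y \<in> cl Y \<Longrightarrow> y \<notin> G \<Longrightarrow> y \<in> cl (Y - cl G)"
    using separated_cells[OF Y r I, of V V] unfolding G_def by simp_all
  obtain f where f: "\<And>x y. x \<in> I \<Longrightarrow> y \<in> V x \<Longrightarrow> f y = h x y"
    using glue[of I V h thesis] cells(1) by blast
  have opG: "opn G"
    using V(1) unfolding G_def by blast
  have "dmor G f"
  proof (rule dmor_local)
    fix z assume "z \<in> G"
    then obtain x where x: "x \<in> I" "z \<in> V x" unfolding G_def by blast
    have "\<forall>y\<in>V x. y \<in> G" using x unfolding G_def by blast
    then show "\<exists>N V' f'. opn N \<and> z \<in> N \<and> dmor V' f' \<and> (\<forall>y\<in>N. (y \<in> G \<longleftrightarrow> y \<in> V') \<and> (y \<in> G \<longrightarrow> f y = f' y))"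
      using V(1,4) x f by (intro exI[of _ "V x"] exI[of _ "h x"]) auto
  qed
  moreover have "f y \<in> up c" if "y \<in> G" for y
  proof -
    obtain x where "x \<in> I" "y \<in> V x" using \<open>y \<in> G\<close> unfolding G_def by blast
    then show ?thesis using V(5)[of x] f by auto
  qed
  moreover have "cl G \<subseteq> Y"
    using cells(2) V(2) by blast
  moreover have "\<exists>z. d y z < e \<and> z \<in> G \<and> f z = l" if y: "y \<in> cl Y" for y
  proof -
    obtain x where x: "x \<in> I" "\<forall>z\<in>V x. d y z < 3 * r"
      using cells(3)[OF y] by blast
    obtain z where z: "z \<in> V x" "h x z = l"
      using V(6)[OF x(1)] by auto
    then show ?thesis
      using x f[of x z] unfolding G_def r_def by auto
  qed
  moreover have "\<forall>y\<in>cl Y - G. y \<in> cl (Y - cl G)"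
    using cells(4) by blast
  ultimately have "stage c l e Y G {} f"
    using opG c unfolding stage_def by auto
  then show ?thesis by blast
qed

lemma fills_reflexive:
  assumes c: "R c c" and loc: "\<And>l. R c l \<Longrightarrow> \<not> R l c \<Longrightarrow> localizes l"
  shows "fills c"
  unfolding fills_def
proof (intro allI impI)
  fix U assume U: "opn U"
  have "c \<in> up c" using c by blast
  then obtain l :: "nat \<Rightarrow> 'w" where l: "l 0 = c" "\<And>n. l n \<in> up c" "\<And>b m. b \<in> up c \<Longrightarrow> \<exists>n\<ge>m. l n = b"
    by (rule enumerate_cofinally[OF finite_up]) (rule that)
  \<comment> \<open>The choice is made for every index and every open set at once, so that the sets
    left over form an ordinary recursion.\<close>
  define T where "T n Y = (SOME t. stage c (l n) (inverse (Suc n)) Y (fst t) (fst (snd t)) (snd (snd t)))" for n Y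
  define G0 B0 f0 where "G0 n Y = fst (T n Y)" and "B0 n Y = fst (snd (T n Y))" and "f0 n Y = snd (snd (T n Y))" for n Y
  have st0: "stage c (l n) (inverse (Suc n)) Y (G0 n Y) (B0 n Y) (f0 n Y)" if Y: "opn Y" for n Y
  proof -
    have e: "inverse (real (Suc n)) > 0" by simp
    have cl: "R c (l n)" using l(2) by blast
    have "\<exists>G B f. stage c (l n) (inverse (Suc n)) Y G B f"
    proof (cases "R (l n) c")
      case True
      then show ?thesis using stage_point[OF True Y e] by blast
    next
      case False
      then show ?thesis using stage_open[OF cl False loc[OF cl False] Y e] by blast
    qed
    then obtain G B f where "stage c (l n) (inverse (Suc n)) Y G B f" by blast
    then have "stage c (l n) (inverse (Suc n)) Y (fst (G, B, f)) (fst (snd (G, B, f))) (snd (snd (G, B, f)))"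
      by simp
    then show ?thesis
      unfolding G0_def B0_def f0_def T_def by (rule someI)
  qed
  define Y where "Y = rec_nat U (\<lambda>n Y. Y - (cl (G0 n Y) \<union> B0 n Y))"
  define G where "G n = G0 n (Y n)" for n
  define B where "B n = B0 n (Y n)" for n
  define h where "h n = f0 n (Y n)" for n
  have Y0: "Y 0 = U" and YS: "Y (Suc n) = Y n - (cl (G n) \<union> B n)" for n
    by (simp_all add: Y_def G_def B_def)
  have opY: "opn (Y n)" for n
  proof (induction n)
    case (Suc n)
    then have "closedin mtopology (cl (G n) \<union> B n)"
      using st0[of "Y n" n] unfolding G_def B_def stage_def by blast
    then show ?case
      using Suc by (simp add: YS openin_diff)
  qed (simp add: Y0 U)
  have st: "stage c (l n) (inverse (Suc n)) (Y n) (G n) (B n) (h n)" for n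
    using st0[OF opY] by (simp add: G_def B_def h_def)
  have opG: "opn (G n)" and sub: "cl (G n) \<union> B n \<subseteq> Y n" and GB: "G n \<inter> B n = {}" and mor: "dmor (G n) (h n)"
    and up: "h n ` G n \<subseteq> up c" and Bc: "B n \<noteq> {} \<Longrightarrow> R (l n) c" and Gc: "R (l n) c \<Longrightarrow> G n = {}"
    and near: "\<And>y. y \<in> cl (Y n) \<Longrightarrow> \<exists>z. d y z < inverse (Suc n) \<and> (z \<in> G n \<and> h n z = l n \<or> z \<in> B n)"
    and rest: "\<And>y. y \<in> cl (Y n) - G n \<Longrightarrow> y \<in> cl (Y (Suc n))" for n
    using st[of n] unfolding stage_def YS by blast+
  have Gcl: "G n \<subseteq> cl (G n)" for n
    by (rule cl_superset[OF opG])
  have Y_anti: "Y n \<subseteq> Y m" if "m \<le> n" for m n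
    using that by (rule lift_Suc_antimono_le[of Y, rotated]) (auto simp: YS)
  define P where "P n = G n \<union> B n" for n
  have PY: "P n \<subseteq> Y n" for n
    using sub[of n] Gcl[of n] unfolding P_def by blast
  have P_less: "P m \<inter> P n = {}" if "m < n" for m n
  proof -
    have "P n \<subseteq> Y (Suc m)"
      using PY[of n] Y_anti[of "Suc m" n] that by auto
    then show ?thesis
      using Gcl[of m] unfolding YS P_def by blast
  qed
  have P_inj: "m = n" if "y \<in> P m" "y \<in> P n" for m n y
    using P_less[of m n] P_less[of n m] that by (metis disjoint_iff linorder_neqE_nat)
  have PU: "P n \<subseteq> U" for n
    using PY Y_anti[of 0 n] Y0 by auto
  define GG where "GG = (\<Union>n. G n)"
  \<comment> \<open>The default \<open>c\<close> at points that are never treated belongs to the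
    same cluster as the values on the sets \<open>B n\<close>. So off \<open>GG\<close> every value
    has \<open>up c\<close> as its set of successors.\<close>
  define f where "f y = (if \<exists>n. y \<in> P n then (let n = SOME n. y \<in> P n in if y \<in> G n then h n y else l n) else c)" for y
  have f_P: "f y = (if y \<in> G n then h n y else l n)" if "y \<in> P n" for n y
  proof -
    have "(SOME n. y \<in> P n) = n"
      using that P_inj by (intro some_equality) auto
    then show ?thesis using that by (auto simp: f_def)
  qed
  have fG: "f y = h n y" if "y \<in> G n" for n y
    using f_P[of y n] that by (simp add: P_def)
  have fB: "f y = l n" if "y \<in> B n" for n y
    using f_P[of y n] that GB[of n] by (auto simp: P_def)
  have fup: "f y \<in> up c" for y
  proof (cases "\<exists>n. y \<in> P n")
    case True
    then obtain n where "y \<in> G n \<or> y \<in> B n" unfolding P_def by blast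
    then show ?thesis using up[of n] l(2)[of n] fG fB by auto
  next
    case False
    then show ?thesis using c by (simp add: f_def)
  qed
  have fcl: "R (f y) c" if yG: "y \<notin> GG" for y
  proof (cases "\<exists>n. y \<in> P n")
    case True
    then obtain n where "y \<in> B n" using yG unfolding P_def GG_def by blast
    then show ?thesis using Bc fB by auto
  next
    case False
    then show ?thesis using c by (simp add: f_def)
  qed
  \<comment> \<open>A point outside the open parts remains a limit of what is left over, so every
    later stage places its value near it.\<close>
  have in_cl: "y \<in> cl (Y n)" if "y \<in> cl U" "y \<notin> GG" for y n
  proof (induction n)
    case (Suc n)
    then show ?case using rest that unfolding GG_def by blast
  qed (use that Y0 in simp)
  have lim: "clusters U f y (up c)" if y: "y \<in> cl U" "y \<notin> GG" for y
  proof (rule clustersI)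
    have yM: "y \<in> M" using y unfolding cl_iff by blast
    show "opn M" "y \<in> M" using yM by simp_all
    show "f z \<in> up c" for z by (rule fup)
    fix b N assume b: "b \<in> up c" "opn N" "y \<in> N"
    obtain r where r: "r > 0" "mball y r \<subseteq> N"
      using b unfolding openin_mtopology by blast
    obtain m where m: "inverse (Suc m) < r"
      using reals_Archimedean[OF r(1)] by blast
    \<comment> \<open>At stages from \<open>k\<close> on, the point with the wanted value is
      different from \<open>y\<close>, as a limit value requires.\<close>
    have "\<exists>k. \<forall>n\<ge>k. y \<notin> P n"
    proof (cases "\<exists>n. y \<in> P n")
      case True
      then obtain n where n: "y \<in> P n" by blast
      have "\<forall>n'\<ge>Suc n. y \<notin> P n'"
        using P_inj[OF n] by (metis Suc_n_not_le_n)
      then show ?thesis by blast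
    qed blast
    then obtain k where k: "\<And>n. n \<ge> k \<Longrightarrow> y \<notin> P n"
      by blast
    obtain n where n: "n \<ge> max m k" "l n = b"
      using l(3)[OF b(1)] by blast
    obtain z where z: "d y z < inverse (Suc n)" "z \<in> G n \<and> h n z = l n \<or> z \<in> B n"
      using near[OF in_cl[OF y]] by blast
    have zP: "z \<in> P n" using z unfolding P_def by blast
    have "inverse (real (Suc n)) \<le> inverse (real (Suc m))"
      using n by (intro le_imp_inverse_le) auto
    then have "d y z < r" using z m by linarith
    moreover have "z \<in> U" using zP PU by blast
    moreover from this have "z \<in> M" using opn_subset[OF U] by blast
    ultimately have "z \<in> mball y r" "z \<in> U"
      using yM by auto
    then have "z \<in> N \<inter> U"
      using r(2) by blast
    moreover have "z \<noteq> y" using k[of n] n zP by auto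
    moreover have "f z = b" using z(2) fG fB n by auto
    ultimately show "\<exists>z\<in>N \<inter> U - {y}. f z = b" by blast
  qed
  have "f x \<in> W \<and> clusters U f x (up (f x))" if x: "x \<in> U" for x
  proof (cases "x \<in> GG")
    case True
    then obtain n where n: "x \<in> G n" unfolding GG_def by blast
    then have hx: "h n x \<in> W" "clusters (G n) (h n) x (up (h n x))"
      using mor[of n] unfolding dmor_def by blast+
    have "clusters U f x (up (h n x))"
      by (rule clusters_cong[OF hx(2) opG n]) (use fG PU[of n] in \<open>auto simp: P_def\<close>)
    then show ?thesis using hx fG[OF n] by simp
  next
    case False
    have "up (f x) = up c"
      using fcl[OF False] fup[of x] R_trans by blast
    moreover have "x \<in> cl U" using x cl_superset[OF U] by blast
    ultimately show ?thesis
      using lim[OF _ False] fup[of x] R_W by auto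
  qed
  then have "dmor U f"
    unfolding dmor_def by blast
  moreover have "f ` U \<subseteq> up c"
    using fup by blast
  moreover have "\<forall>y\<in>bd U. clusters U f y (up c)"
    using lim PU unfolding GG_def P_def by blast
  moreover have "c \<in> f ` U" if ne: "U \<noteq> {}"
  proof -
    obtain y where y: "y \<in> U" using ne by blast
    then have "y \<in> cl (Y 0)" using cl_superset[OF U] Y0 by auto
    then obtain z where "z \<in> G 0 \<or> z \<in> B 0" using near by blast
    \<comment> \<open>The value \<open>l 0\<close> is \<open>c\<close>, which is reflexive, so the
      first stage places points only; one of them provides the value \<open>c\<close>.\<close>
    moreover have "G 0 = {}" using Gc l(1) c by metis
    ultimately have "z \<in> B 0" by blast
    then have "f z = c" "z \<in> U"
      using fB l(1) PU[of 0] by (auto simp: P_def)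
    then show ?thesis by blast
  qed
  ultimately show "\<exists>f. dmor U f \<and> f ` U \<subseteq> up c \<and> (\<forall>y\<in>bd U. clusters U f y (up c)) \<and> (U \<noteq> {} \<longrightarrow> c \<in> f ` U)"
    by blast
qed

end

section \<open>The map of the whole space onto a good frame\<close>

locale metric_good_frame = dense_metric M d + good_frame W R
  for M :: "'x set" and d and W :: "'w set" and R
begin

sublocale metric_frame ..

text \<open>The measure counts \<open>v\<close> as well, because an irreflexive \<open>v\<close> may
  have a reflexive successor with the same \<open>up\<close>. For a reflexive \<open>v\<close> only
  strict successors are used, so the other points of its cluster do not have to be smaller.\<close>

lemma localizes_and_fills:
  assumes "v \<in> W"
  shows "localizes v \<and> (R v v \<longrightarrow> fills v)"
  using assms
proof (induction "card (insert v (up v))" arbitrary: v rule: less_induct)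
  case less
  have smaller: "localizes u \<and> (R u u \<longrightarrow> fills u)" if u: "R v u" "\<not> R u v" for u
  proof -
    have "insert u (up u) \<subseteq> insert v (up v)" "v \<notin> insert u (up u)"
      using u R_trans by blast+
    then have "insert u (up u) \<subset> insert v (up v)"
      by blast
    then have "card (insert u (up u)) < card (insert v (up v))"
      by (intro psubset_card_mono) (simp add: finite_up)
    then show ?thesis
      using less.hyps u R_W by blast
  qed
  show ?case
  proof (cases "R v v")
    case True
    then have "fills v"
      using fills_reflexive smaller by blast
    then show ?thesis
      using True localizes_reflexive by blast
  next
    case False
    then have "localizes u \<and> (R u u \<longrightarrow> fills u)" if "R v u" for u
      using smaller[OF that] that R_trans by blast
    then show ?thesis
      using localizes_irreflexive[OF less.prems False conn_up[OF less.prems False]] False by blast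
  qed
qed

text \<open>Surjectivity is secured before extending: every point \<open>w\<close> of the frame is
  realized near its own point \<open>p w\<close> of the space, and these pieces stay apart.
  \<open>extend\<close> is then applied with \<open>F\<close> the whole frame.\<close>

theorem dmor_onto_frame:
  assumes "M \<noteq> {}"
  shows "\<exists>f. dmor M f \<and> f ` M = W"
proof -
  have "infinite M"
  proof
    assume fin: "finite M"
    obtain x where x: "x \<in> M" using assms by blast
    then have "finite ((\<lambda>y. d x y) ` (M - {x}))" (is "finite ?D")
      using fin by simp
    moreover have "?D \<noteq> {}"
      using dense[of M x] x by auto
    ultimately have m: "Min ?D \<in> ?D" "\<And>r. r \<in> ?D \<Longrightarrow> Min ?D \<le> r"
      by auto
    then have "Min ?D > 0"
      using x by auto
    then obtain y where "y \<in> M" "0 < d x y" "d x y < Min ?D"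
      using dense_mball[OF x] by blast
    then show False
      using m(2)[of "d x y"] mdist_zero[OF x] by force
  qed
  then obtain A where A: "A \<subseteq> M" "finite A" "card A = card W"
    using infinite_arbitrarily_large by blast
  then obtain p where p: "bij_betw p W A"
    using finite_same_card_bij finite_W by metis
  have pM: "p w \<in> M" if "w \<in> W" for w
    using p A that by (auto simp: bij_betw_def)
  \<comment> \<open>The element 1 keeps the set non-empty when the frame has a single point.\<close>
  define E where "E = insert 1 ((\<lambda>(v, w). d (p v) (p w)) ` {(v, w) \<in> W \<times> W. v \<noteq> w})"
  have "finite E"
  proof -
    have "finite {(v, w) \<in> W \<times> W. v \<noteq> w}"
      by (rule finite_subset[of _ "W \<times> W"]) (use finite_W in auto)
    then show ?thesis by (simp add: E_def)
  qed
  have "0 < d (p v) (p w)" if "v \<in> W" "w \<in> W" "v \<noteq> w" for v w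
    using that p pM by (metis bij_betw_imp_inj_on inj_onD mdist_pos_less)
  then have "Min E > 0"
    using \<open>finite E\<close> by (subst Min_gr_iff) (auto simp: E_def)
  moreover have "Min E \<le> d (p v) (p w)" if "v \<in> W" "w \<in> W" "v \<noteq> w" for v w
    using that \<open>finite E\<close> by (intro Min_le) (auto simp: E_def)
  ultimately obtain r where r: "r > 0" "\<And>v w. v \<in> W \<Longrightarrow> w \<in> W \<Longrightarrow> v \<noteq> w \<Longrightarrow> r \<le> d (p v) (p w)"
    by blast
  have "\<exists>V f c. opn V \<and> V \<subseteq> mball (p w) (r/4) \<and> dmor V f \<and> f ` V \<subseteq> W \<and> w \<in> f ` V \<and> c \<in> W \<and> R c c \<and>
      (\<forall>y\<in>bd V. clusters V f y (up c))" if w: "w \<in> W" for w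
  proof -
    have "p w \<in> mball (p w) (r/4)" using pM[OF w] r by simp
    from localizes_and_fills[OF w, THEN conjunct1, unfolded localizes_def, rule_format, OF openin_mball this]
    obtain V f c where V: "opn V" "cl V \<subseteq> mball (p w) (r/4)" "dmor V f" "w \<in> f ` V" "R c c" "\<forall>y\<in>bd V. clusters V f y (up c)"
      by metis
    moreover have "V \<subseteq> mball (p w) (r/4)" using V(2) cl_superset[OF V(1)] by blast
    moreover have "f ` V \<subseteq> W" using V(3) unfolding dmor_def by blast
    ultimately show ?thesis using R_W[OF V(5)] by metis
  qed
  then obtain V h k where "\<forall>w\<in>W. opn (V w) \<and> V w \<subseteq> mball (p w) (r/4) \<and> dmor (V w) (h w) \<and> h w ` V w \<subseteq> W \<and>
      w \<in> h w ` V w \<and> k w \<in> W \<and> R (k w) (k w) \<and> (\<forall>y\<in>bd (V w). clusters (V w) (h w) y (up (k w)))"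
    by metis
  then have V: "\<And>w. w \<in> W \<Longrightarrow> opn (V w)" "\<And>w. w \<in> W \<Longrightarrow> V w \<subseteq> mball (p w) (r/4)" "\<And>w. w \<in> W \<Longrightarrow> dmor (V w) (h w)"
    "\<And>w. w \<in> W \<Longrightarrow> h w ` V w \<subseteq> W" "\<And>w. w \<in> W \<Longrightarrow> w \<in> h w ` V w" "\<And>w. w \<in> W \<Longrightarrow> k w \<in> W \<and> R (k w) (k w)"
    "\<And>w y. w \<in> W \<Longrightarrow> y \<in> bd (V w) \<Longrightarrow> clusters (V w) (h w) y (up (k w))"
    by auto
  have one: "v = w" if "v \<in> W" "w \<in> W" "z \<in> V v" "z' \<in> V w" "z \<in> mball y (r/4)" "z' \<in> mball y (r/4)" for v w y z z'
  proof (rule ccontr)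
    assume "v \<noteq> w"
    moreover have "d (p v) (p w) < r"
      by (rule quarter_balls[OF _ _ that(5,6)]) (use V(2) that(1-4) in blast)+
    ultimately show False
      using r(2)[OF that(1,2)] by simp
  qed
  have "v = w" if "v \<in> W" "w \<in> W" "y \<in> V v" "y \<in> V w" for v w y
    by (rule one[OF that, of y]) (use that V(2)[of v] r in auto)
  then obtain f0 where f0: "\<And>w y. w \<in> W \<Longrightarrow> y \<in> V w \<Longrightarrow> f0 y = h w y"
    using glue[of W V h thesis] by blast
  have "\<exists>f. dmor M f \<and> f ` M \<subseteq> W \<and> (\<forall>w\<in>W. \<forall>y\<in>V w. f y = f0 y)"
  proof (rule extend[where \<kappa> = k])
    show "opn (V w) \<and> V w \<subseteq> M \<and> dmor (V w) f0 \<and> f0 ` V w \<subseteq> W" if w: "w \<in> W" for w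
    proof (intro conjI)
      show "dmor (V w) f0"
        using dmor_cong[OF V(3)[OF w] V(1)[OF w], of f0] f0[OF w] by auto
      show "f0 ` V w \<subseteq> W"
        using V(4)[OF w] f0[OF w] by auto
    qed (use V(1)[OF w] opn_subset in auto)
    show "clusters (V w) f0 y (up (k w))" if "w \<in> W" "y \<in> M" "y \<in> bd (V w)" for w y
      by (rule clusters_cong[OF V(7)[OF that(1,3)], of M]) (use f0 that in auto)
    show "\<exists>N. opn N \<and> y \<in> N \<and> (\<forall>i\<in>W. \<forall>j\<in>W. N \<inter> V i \<noteq> {} \<longrightarrow> N \<inter> V j \<noteq> {} \<longrightarrow> i = j)" if y: "y \<in> M" for y
    proof (intro exI[of _ "mball y (r/4)"] conjI ballI impI)
      fix i j assume ij: "i \<in> W" "j \<in> W" "mball y (r/4) \<inter> V i \<noteq> {}" "mball y (r/4) \<inter> V j \<noteq> {}"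
      then obtain z z' where "z \<in> mball y (r/4)" "z \<in> V i" "z' \<in> mball y (r/4)" "z' \<in> V j" by blast
      then show "i = j" using one[OF ij(1,2)] by blast
    qed (use y r in auto)
    show "\<And>e. e \<in> W \<Longrightarrow> R e e \<Longrightarrow> fills e"
      using localizes_and_fills by blast
    show "\<And>a b. a \<in> W \<Longrightarrow> R a b \<Longrightarrow> b \<in> W"
      using R_W by blast
  qed (use W_ne conn_W V(6) in auto)
  then obtain f where f: "dmor M f" "f ` M \<subseteq> W" "\<And>w y. w \<in> W \<Longrightarrow> y \<in> V w \<Longrightarrow> f y = f0 y"
    by metis
  have "w \<in> f ` M" if w: "w \<in> W" for w
  proof -
    obtain y where y: "y \<in> V w" "h w y = w" using V(5)[OF w] by (metis imageE)
    then have "f y = w" using f(3)[OF w y(1)] f0[OF w y(1)] by simp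
    moreover have "y \<in> M" using y V(1)[OF w] opn_subset by blast
    ultimately show ?thesis by blast
  qed
  then show ?thesis using f by blast
qed

end

section \<open>Finite models\<close>

text \<open>
  In a state, \<open>\<tau>\<close> is the set of types that occur at successors. An irreflexive
  state \<open>Irr s \<tau> E\<close> also records the states of the successors, so that \<open>G\<^sub>1\<close> makes them
  connected; \<open>Loop s \<tau>\<close> is a one-point cluster, and the states \<open>Clus s K \<tau>\<close> with \<open>s \<in> K\<close>
  form a cluster.
\<close>

datatype 's st = Irr 's "'s set" "'s st fset" | Loop 's "'s set" | Clus 's "'s set" "'s set"

fun lab :: "'s st \<Rightarrow> 's" where
  "lab (Irr s \<tau> E) = s" | "lab (Loop s \<tau>) = s" | "lab (Clus s K \<tau>) = s"

fun vw :: "'s st \<Rightarrow> 's set" where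
  "vw (Irr s \<tau> E) = \<tau>" | "vw (Loop s \<tau>) = \<tau>" | "vw (Clus s K \<tau>) = \<tau>"

text \<open>\<open>Def\<close> collects the predicates that a formula can express.
  \<open>const_successors\<close>, \<open>const_global\<close>, \<open>t_Fix\<close> and
  \<open>t_Ind\<close> are \<open>G1\<close>, (C), (Fix) and (Ind) for such predicates, so the frame
  can be built without reference to maximal consistent sets.\<close>

locale tangle_points =
  fixes Pt :: "'p set" and R :: "'p \<Rightarrow> 'p \<Rightarrow> bool" and Def :: "('p \<Rightarrow> bool) \<Rightarrow> bool"
    and t :: "'p \<Rightarrow> 'v fm set" and \<Phi> :: "'v fm set"
  assumes Pt_ne: "Pt \<noteq> {}"
    and R_Pt: "R x y \<Longrightarrow> x \<in> Pt \<and> y \<in> Pt"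
    and R_trans: "R x y \<Longrightarrow> R y z \<Longrightarrow> R x z"
    and R_serial: "x \<in> Pt \<Longrightarrow> \<exists>y. R x y"
    and finite_types: "finite (t ` Pt)"
    and Def_t: "Def (\<lambda>x. t x = s)"
    and Def_not: "Def P \<Longrightarrow> Def (\<lambda>x. \<not> P x)"
    and Def_conj: "Def P \<Longrightarrow> Def Q \<Longrightarrow> Def (\<lambda>x. P x \<and> Q x)"
    and Def_dia: "Def P \<Longrightarrow> Def (\<lambda>x. \<exists>y. R x y \<and> P y)"
    and Def_cong: "Def P \<Longrightarrow> (\<And>x. x \<in> Pt \<Longrightarrow> P x \<longleftrightarrow> Q x) \<Longrightarrow> Def Q"
    and const_successors: "Def P \<Longrightarrow> x \<in> Pt \<Longrightarrow> (\<And>y z. R x y \<Longrightarrow> R y z \<Longrightarrow> P y \<longleftrightarrow> P z) \<Longrightarrow> R x y \<Longrightarrow> R x y' \<Longrightarrow> P y \<longleftrightarrow> P y'"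
    and const_global: "Def P \<Longrightarrow> (\<And>y z. R y z \<Longrightarrow> P y \<longleftrightarrow> P z) \<Longrightarrow> y \<in> Pt \<Longrightarrow> y' \<in> Pt \<Longrightarrow> P y \<longleftrightarrow> P y'"
    and t_Box: "\<^bold>[d\<^bold>] \<psi> \<in> \<Phi> \<Longrightarrow> x \<in> Pt \<Longrightarrow> \<^bold>[d\<^bold>] \<psi> \<in> t x \<longleftrightarrow> (\<forall>y. R x y \<longrightarrow> \<psi> \<in> t y)"
    and t_Fix: "\<^bold>\<langle>dt\<^bold>\<rangle> \<Gamma> \<in> t x \<Longrightarrow> x \<in> Pt \<Longrightarrow> \<gamma> |\<in>| \<Gamma> \<Longrightarrow> \<exists>y. R x y \<and> \<gamma> \<in> t y \<and> \<^bold>\<langle>dt\<^bold>\<rangle> \<Gamma> \<in> t y"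
    and t_Ind: "\<^bold>\<langle>dt\<^bold>\<rangle> \<Gamma> \<in> \<Phi> \<Longrightarrow> Def P \<Longrightarrow> x \<in> Pt \<Longrightarrow> P x \<Longrightarrow>
      (\<And>y \<gamma>. y = x \<or> R x y \<Longrightarrow> P y \<Longrightarrow> \<gamma> |\<in>| \<Gamma> \<Longrightarrow> \<exists>z. R y z \<and> \<gamma> \<in> t z \<and> P z) \<Longrightarrow> \<^bold>\<langle>dt\<^bold>\<rangle> \<Gamma> \<in> t x"
    and Tangle_ne: "\<^bold>\<langle>dt\<^bold>\<rangle> \<Gamma> \<in> \<Phi> \<Longrightarrow> \<Gamma> \<noteq> {||}"
begin

lemma Def_True: "Def (\<lambda>x. True)"
  using Def_not[OF Def_conj[OF Def_t[of "{}"] Def_not[OF Def_t[of "{}"]]]] by simp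

lemma Def_const: "Def (\<lambda>x. b)"
  using Def_True Def_not[OF Def_True] by (cases b) simp_all

lemma Def_disj: "Def P \<Longrightarrow> Def Q \<Longrightarrow> Def (\<lambda>x. P x \<or> Q x)"
  using Def_not[OF Def_conj[OF Def_not Def_not]] by simp

lemma Def_ex: "finite A \<Longrightarrow> (\<And>a. a \<in> A \<Longrightarrow> Def (P a)) \<Longrightarrow> Def (\<lambda>x. \<exists>a\<in>A. P a x)"
  by (induction A rule: finite_induct) (simp_all add: Def_const Def_disj)

lemma Def_all: "finite A \<Longrightarrow> (\<And>a. a \<in> A \<Longrightarrow> Def (P a)) \<Longrightarrow> Def (\<lambda>x. \<forall>a\<in>A. P a x)"
  by (induction A rule: finite_induct) (simp_all add: Def_const Def_conj)

definition T :: "'p \<Rightarrow> 'v fm set set" where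
  "T x = {t y | y. R x y}"

lemma T_iff: "s \<in> T x \<longleftrightarrow> (\<exists>y. R x y \<and> t y = s)"
  by (auto simp: T_def)

lemma t_in_T: "R x y \<Longrightarrow> t y \<in> T x"
  by (auto simp: T_def)

lemma T_mono: "R x y \<Longrightarrow> T y \<subseteq> T x"
  using R_trans by (auto simp: T_def)

lemma T_types: "T x \<subseteq> t ` Pt"
  using R_Pt by (auto simp: T_def)

lemma finite_T [simp]: "finite (T x)"
  using finite_subset[OF T_types finite_types] .

lemma T_ne: "x \<in> Pt \<Longrightarrow> T x \<noteq> {}"
  using R_serial by (fastforce simp: T_def)

text \<open>Only finitely many pairs of a type and a view occur, and each of them is
  definable.\<close>

lemma Def_tT: "Def (\<lambda>x. Q (t x) (T x))"
proof -
  have "Def (\<lambda>x. T x = \<tau>)" if "\<tau> \<subseteq> t ` Pt" for \<tau>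
  proof -
    have "Def (\<lambda>x. (\<exists>y. R x y \<and> t y = s) \<longleftrightarrow> b)" for s b
      using Def_dia[OF Def_t[of s]] Def_not[OF Def_dia[OF Def_t[of s]]] by (cases b) simp_all
    then have "Def (\<lambda>x. \<forall>s\<in>t ` Pt. (\<exists>y. R x y \<and> t y = s) \<longleftrightarrow> s \<in> \<tau>)"
      by (rule Def_all[OF finite_types])
    then show ?thesis
    proof (rule Def_cong)
      fix x assume "x \<in> Pt"
      show "(\<forall>s\<in>t ` Pt. (\<exists>y. R x y \<and> t y = s) \<longleftrightarrow> s \<in> \<tau>) \<longleftrightarrow> T x = \<tau>"
        unfolding T_iff[symmetric] using that T_types[of x] by blast
    qed
  qed
  moreover define A where "A = {p \<in> t ` Pt \<times> Pow (t ` Pt). Q (fst p) (snd p)}"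
  moreover have "finite A"
    unfolding A_def by (rule finite_subset[of _ "t ` Pt \<times> Pow (t ` Pt)"]) (use finite_types in auto)
  ultimately have "Def (\<lambda>x. \<exists>p\<in>A. t x = fst p \<and> T x = snd p)"
    by (intro Def_ex Def_conj Def_t) auto
  then show ?thesis
  proof (rule Def_cong)
    fix x assume "x \<in> Pt"
    then have "(t x, T x) \<in> t ` Pt \<times> Pow (t ` Pt)" using T_types[of x] by auto
    then show "(\<exists>p\<in>A. t x = fst p \<and> T x = snd p) \<longleftrightarrow> Q (t x) (T x)"
      unfolding A_def by force
  qed
qed

section \<open>States of points\<close>

definition irr :: "'p \<Rightarrow> bool" where
  "irr x \<longleftrightarrow> t x \<notin> T x"

text \<open>At a reflexive point that is a cluster by itself, a tangle formula is true as soon as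
  all its members are, with the point alone as witness. The type has to agree with this.\<close>

definition loopable :: "'v fm set \<Rightarrow> bool" where
  "loopable s \<longleftrightarrow> (\<forall>\<Gamma>. \<^bold>\<langle>dt\<^bold>\<rangle> \<Gamma> \<in> \<Phi> \<longrightarrow> fset \<Gamma> \<subseteq> s \<longrightarrow> \<^bold>\<langle>dt\<^bold>\<rangle> \<Gamma> \<in> s)"

definition good :: "'p \<Rightarrow> bool" where
  "good x \<longleftrightarrow> irr x \<or> loopable (t x)"

text \<open>Every occurrence of such a type above \<open>x\<close> still sees all that
  \<open>x\<close> sees, hence all other types of this kind. This is what makes them a
  cluster.\<close>

definition C :: "'p \<Rightarrow> 'v fm set set" where
  "C x = {s \<in> T x. \<forall>z. R x z \<longrightarrow> t z = s \<longrightarrow> T z = T x}"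

lemma Def_good: "Def good"
  using Def_tT[of "\<lambda>s \<tau>. s \<notin> \<tau> \<or> loopable s"] by (simp add: good_def[abs_def] irr_def)

lemma irr_less:
  assumes "R x y" "t y \<notin> T y"
  shows "T y \<subset> T x"
  using T_mono[OF assms(1)] t_in_T[OF assms(1)] assms(2) by blast

text \<open>Only irreflexive points recurse. An irreflexive successor loses its own type from view,
  so the view shrinks strictly between two of them; all other points get measure 0.\<close>

function (sequential) state :: "'p \<Rightarrow> 'v fm set st" where
  "state x = (if irr x then Irr (t x) (T x) (Abs_fset (state ` {y. R x y \<and> good y})) else Loop (t x) (T x))"
  by pat_completeness auto

termination
proof (relation "Wellfounded.measure (\<lambda>x. if irr x then Suc (card (T x)) else 0)")
  fix x y assume "irr x" "y \<in> {y. R x y \<and> good y}"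
  then show "(y, x) \<in> Wellfounded.measure (\<lambda>x. if irr x then Suc (card (T x)) else 0)"
    using irr_less[of x y] psubset_card_mono[of "T x" "T y"] by (auto simp: irr_def)
qed simp

declare state.simps [simp del]

lemma lab_state [simp]: "lab (state x) = t x"
  by (subst state.simps) simp

lemma vw_state [simp]: "vw (state x) = T x"
  by (subst state.simps) simp

lemma finite_states: "finite (state ` Pt)"
proof -
  define \<mu> where "\<mu> x = (if irr x then Suc (card (T x)) else 0)" for x
  let ?L = "(\<lambda>p. Loop (fst p) (snd p)) ` (t ` Pt \<times> Pow (t ` Pt))"
  have L: "finite ?L" using finite_types by simp
  have "finite (state ` {x \<in> Pt. \<mu> x \<le> n})" for n
  proof (induction n)
    case 0
    have "state ` {x \<in> Pt. \<mu> x \<le> 0} \<subseteq> ?L"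
    proof
      fix a assume "a \<in> state ` {x \<in> Pt. \<mu> x \<le> 0}"
      then obtain x where "x \<in> Pt" "\<not> irr x" "a = state x" by (auto simp: \<mu>_def split: if_splits)
      then have "a = Loop (t x) (T x)" "(t x, T x) \<in> t ` Pt \<times> Pow (t ` Pt)"
        using T_types[of x] state.simps[of x] by auto
      then show "a \<in> ?L" by (intro image_eqI[of _ _ "(t x, T x)"]) simp_all
    qed
    then show ?case using L finite_subset by blast
  next
    case (Suc n)
    let ?S = "state ` {x \<in> Pt. \<mu> x \<le> n}"
    let ?I = "(\<lambda>p. Irr (fst p) (fst (snd p)) (Abs_fset (snd (snd p)))) ` (t ` Pt \<times> Pow (t ` Pt) \<times> Pow ?S)"
    have "state ` {x \<in> Pt. \<mu> x \<le> Suc n} \<subseteq> ?L \<union> ?I"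
    proof
      fix a assume "a \<in> state ` {x \<in> Pt. \<mu> x \<le> Suc n}"
      then obtain x where x: "x \<in> Pt" "\<mu> x \<le> Suc n" "a = state x" by blast
      show "a \<in> ?L \<union> ?I"
      proof (cases "irr x")
        case True
        have "\<mu> y \<le> n" if "R x y" for y
          using irr_less[OF that] psubset_card_mono[of "T x" "T y"] x(2) True by (auto simp: \<mu>_def irr_def)
        then have "state ` {y. R x y \<and> good y} \<subseteq> ?S"
          using R_Pt by blast
        moreover have "a = Irr (t x) (T x) (Abs_fset (state ` {y. R x y \<and> good y}))"
          using x True state.simps[of x] by simp
        ultimately have "a \<in> ?I"
          using x(1) T_types[of x] by (intro image_eqI[of _ _ "(t x, T x, state ` {y. R x y \<and> good y})"]) auto
        then show ?thesis by blast
      next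
        case False
        then have "a = Loop (t x) (T x)" "(t x, T x) \<in> t ` Pt \<times> Pow (t ` Pt)"
          using T_types[of x] state.simps[of x] x by auto
        then have "a \<in> ?L" by (intro image_eqI[of _ _ "(t x, T x)"]) simp_all
        then show ?thesis by blast
      qed
    qed
    moreover have "finite ?I"
      by (rule finite_imageI) (use Suc finite_types in simp)
    then have "finite (?L \<union> ?I)" by (rule finite_UnI[OF L])
    ultimately show ?case by (rule finite_subset)
  qed
  then have "finite (state ` {x \<in> Pt. \<mu> x \<le> Suc (card (t ` Pt))})" .
  moreover have "{x \<in> Pt. \<mu> x \<le> Suc (card (t ` Pt))} = Pt"
    using card_mono[OF finite_types T_types] by (auto simp: \<mu>_def)
  ultimately show ?thesis by simp
qed

lemma finite_succ_states: "finite (state ` {y. R x y \<and> good y})"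
  by (rule finite_subset[OF _ finite_states]) (use R_Pt in blast)

lemma state_Irr:
  "irr x \<Longrightarrow> \<exists>E. state x = Irr (t x) (T x) E \<and> fset E = state ` {y. R x y \<and> good y}"
  using finite_succ_states[of x] by (subst state.simps) (simp add: Abs_fset_inverse)

lemma state_Loop: "\<not> irr x \<Longrightarrow> state x = Loop (t x) (T x)"
  by (subst state.simps) simp

text \<open>By induction on the nesting of the state: each recorded state belongs to some good
  successor, and no good successor has another one.\<close>

lemma Def_state: "Def (\<lambda>x. state x = a)"
proof (induction a)
  case (Irr s \<tau> E)
  show ?case
  proof (rule Def_cong)
    show "Def (\<lambda>x. (t x = s \<and> T x = \<tau> \<and> t x \<notin> T x) \<and> (\<forall>e\<in>fset E. \<exists>y. R x y \<and> (good y \<and> state y = e)) \<and>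
        \<not> (\<exists>y. R x y \<and> (good y \<and> \<not> (\<exists>e\<in>fset E. state y = e))))"
      by (intro Def_conj Def_all Def_dia Def_not Def_ex Def_good Irr Def_tT[of "\<lambda>u v. u = s \<and> v = \<tau> \<and> u \<notin> v"]) simp_all
    fix x
    show "(t x = s \<and> T x = \<tau> \<and> t x \<notin> T x) \<and> (\<forall>e\<in>fset E. \<exists>y. R x y \<and> (good y \<and> state y = e)) \<and>
        \<not> (\<exists>y. R x y \<and> (good y \<and> \<not> (\<exists>e\<in>fset E. state y = e))) \<longleftrightarrow> state x = Irr s \<tau> E"
    proof (cases "irr x")
      case True
      then obtain E' where E': "state x = Irr (t x) (T x) E'" "fset E' = state ` {y. R x y \<and> good y}"
        using state_Irr by blast
      have "(\<forall>e\<in>fset E. \<exists>y. R x y \<and> (good y \<and> state y = e)) \<and>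
          \<not> (\<exists>y. R x y \<and> (good y \<and> \<not> (\<exists>e\<in>fset E. state y = e))) \<longleftrightarrow> fset E' = fset E"
      proof -
        have img: "(\<exists>y. R x y \<and> (good y \<and> Q (state y))) \<longleftrightarrow> (\<exists>e\<in>fset E'. Q e)" for Q
          unfolding E'(2) by blast
        have "(\<forall>e\<in>fset E. \<exists>y. R x y \<and> (good y \<and> state y = e)) \<longleftrightarrow> fset E \<subseteq> fset E'"
          unfolding img[of "\<lambda>a. a = _"] by blast
        moreover have "\<not> (\<exists>y. R x y \<and> (good y \<and> \<not> (\<exists>e\<in>fset E. state y = e))) \<longleftrightarrow> fset E' \<subseteq> fset E"
          unfolding img[of "\<lambda>a. \<not> (\<exists>e\<in>fset E. a = e)"] by blast
        ultimately show ?thesis by blast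
      qed
      then show ?thesis
        using E'(1) True unfolding irr_def by (auto simp: fset_inject)
    next
      case False
      then show ?thesis by (auto simp: state_Loop irr_def)
    qed
  qed
next
  case (Loop s \<tau>)
  show ?case
  proof (rule Def_cong)
    show "Def (\<lambda>x. t x = s \<and> T x = \<tau> \<and> t x \<in> T x)"
      by (rule Def_tT)
    fix x
    show "t x = s \<and> T x = \<tau> \<and> t x \<in> T x \<longleftrightarrow> state x = Loop s \<tau>"
      using state_Irr[of x] state_Loop[of x] by (cases "irr x") (auto simp: irr_def)
  qed
next
  case (Clus s K \<tau>)
  have "state x \<noteq> Clus s K \<tau>" for x
    using state_Irr[of x] state_Loop[of x] by (cases "irr x") auto
  then show ?case using Def_const[of False] by simp
qed

section \<open>The frame of states and its truth lemma\<close>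

definition W :: "'v fm set st set" where
  "W = state ` {x \<in> Pt. good x} \<union> {Clus s (C x) (T x) | s x. x \<in> Pt \<and> s \<in> C x}"

text \<open>A loop sees the cluster states with its view, but neither do these see it nor does
  another loop with this view. So a reflexive cluster of the transitive closure is one loop or
  consists of the \<open>Clus\<close> states with a given \<open>K\<close> and
  \<open>\<tau>\<close>.\<close>

definition R0 :: "'v fm set st \<Rightarrow> 'v fm set st \<Rightarrow> bool" where
  "R0 a b \<longleftrightarrow> a \<in> W \<and> b \<in> W \<and> (case a of
     Irr s \<tau> E \<Rightarrow> b |\<in>| E
   | Loop s \<tau> \<Rightarrow> lab b \<in> \<tau> \<and> (vw b \<subset> \<tau> \<or> vw b = \<tau> \<and> ((\<exists>s K. b = Clus s K \<tau>) \<or> b = a))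
   | Clus s K \<tau> \<Rightarrow> lab b \<in> \<tau> \<and> (vw b \<subset> \<tau> \<or> (\<exists>s'. b = Clus s' K \<tau>)))"

abbreviation R' :: "'v fm set st \<Rightarrow> 'v fm set st \<Rightarrow> bool" where
  "R' \<equiv> R0\<^sup>+\<^sup>+"

lemma C_T: "C x \<subseteq> T x"
  by (auto simp: C_def)

lemma state_W: "x \<in> Pt \<Longrightarrow> good x \<Longrightarrow> state x \<in> W"
  by (auto simp: W_def)

lemma Clus_W: "x \<in> Pt \<Longrightarrow> s \<in> C x \<Longrightarrow> Clus s (C x) (T x) \<in> W"
  by (auto simp: W_def)

lemma finite_W: "finite W"
proof -
  have "{Clus s (C x) (T x) | s x. x \<in> Pt \<and> s \<in> C x} \<subseteq>
      (\<lambda>p. Clus (fst p) (fst (snd p)) (snd (snd p))) ` (t ` Pt \<times> Pow (t ` Pt) \<times> Pow (t ` Pt))"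
  proof
    fix a assume "a \<in> {Clus s (C x) (T x) | s x. x \<in> Pt \<and> s \<in> C x}"
    then obtain s x where "a = Clus s (C x) (T x)" "x \<in> Pt" "s \<in> C x" by blast
    then show "a \<in> (\<lambda>p. Clus (fst p) (fst (snd p)) (snd (snd p))) ` (t ` Pt \<times> Pow (t ` Pt) \<times> Pow (t ` Pt))"
      using C_T[of x] T_types[of x] by (intro image_eqI[of _ _ "(s, C x, T x)"]) auto
  qed
  then have "finite {Clus s (C x) (T x) | s x. x \<in> Pt \<and> s \<in> C x}"
    by (rule finite_subset) (simp add: finite_types)
  moreover have "finite (state ` {x \<in> Pt. good x})"
    by (rule finite_subset[OF _ finite_states]) blast
  ultimately show ?thesis by (simp add: W_def)
qed

lemma W_cases:
  assumes "a \<in> W"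
  obtains (Irr) x E where "x \<in> Pt" "good x" "irr x" "state x = a" "a = Irr (t x) (T x) E" "fset E = state ` {y. R x y \<and> good y}"
  | (Loop) x where "x \<in> Pt" "good x" "\<not> irr x" "state x = a" "a = Loop (t x) (T x)"
  | (Clus) x s where "x \<in> Pt" "s \<in> C x" "a = Clus s (C x) (T x)"
proof -
  consider x where "x \<in> Pt" "good x" "state x = a" | x s where "x \<in> Pt" "s \<in> C x" "a = Clus s (C x) (T x)"
    using assms unfolding W_def by blast
  then show thesis
  proof cases
    case 1
    then show thesis
      using that(1,2) state_Irr[of x] state_Loop[of x] by (cases "irr x") auto
  qed (use that(3) in blast)
qed

lemma realizer:
  assumes "a \<in> W"
  shows "\<exists>x\<in>Pt. t x = lab a \<and> T x = vw a"
  using assms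
proof (cases rule: W_cases)
  case (Clus x s)
  then obtain z where "R x z" "t z = s" "T z = T x"
    unfolding C_def T_iff by blast
  then show ?thesis using Clus R_Pt by auto
qed auto

lemma R0_W: "R0 a b \<Longrightarrow> a \<in> W \<and> b \<in> W"
  by (simp add: R0_def)

lemma R'_W: "R' a b \<Longrightarrow> a \<in> W \<and> b \<in> W"
  by (induction rule: tranclp_induct) (use R0_W in blast)+

lemma R0_mono:
  assumes "R0 a b"
  shows "lab b \<in> vw a \<and> vw b \<subseteq> vw a"
proof -
  have "a \<in> W" "b \<in> W" using assms R0_W by auto
  from \<open>a \<in> W\<close> show ?thesis
  proof (cases rule: W_cases)
    case (Irr x E)
    then have "b \<in> state ` {y. R x y \<and> good y}"
      using assms Irr(6) unfolding R0_def Irr(5) by simp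
    then obtain y where "R x y" "b = state y" by blast
    then show ?thesis
      using t_in_T[of x y] T_mono[of x y] Irr(5) by simp
  qed (use assms in \<open>auto simp: R0_def\<close>)
qed

lemma R'_mono: "R' a b \<Longrightarrow> lab b \<in> vw a \<and> vw b \<subseteq> vw a"
  by (induction rule: tranclp_induct) (use R0_mono in blast)+

text \<open>(Ind) is applied to the predicate that the type lies in \<open>C x\<close>. A successor
  \<open>u\<close> of \<open>x\<close> with this property has \<open>T u = T x\<close>, so it sees
  every type of \<open>C x\<close>.\<close>

lemma Clus_tangle:
  assumes \<Gamma>: "\<^bold>\<langle>dt\<^bold>\<rangle> \<Gamma> \<in> \<Phi>" "\<And>\<gamma>. \<gamma> |\<in>| \<Gamma> \<Longrightarrow> \<exists>s'\<in>C x. \<gamma> \<in> s'" and s: "s \<in> C x"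
  shows "\<^bold>\<langle>dt\<^bold>\<rangle> \<Gamma> \<in> s"
proof -
  obtain y where y: "R x y" "t y = s"
    using s unfolding C_def T_iff by blast
  have "\<^bold>\<langle>dt\<^bold>\<rangle> \<Gamma> \<in> t y"
  proof (rule t_Ind[OF \<Gamma>(1)])
    show "Def (\<lambda>u. t u \<in> C x)"
      by (rule Def_tT)
    show "y \<in> Pt" "t y \<in> C x" using y s R_Pt by auto
    fix u \<gamma> assume u: "u = y \<or> R y u" "t u \<in> C x" and \<gamma>: "\<gamma> |\<in>| \<Gamma>"
    have "R x u" using u y R_trans by blast
    then have "T u = T x" using u(2) unfolding C_def by blast
    then have "C x \<subseteq> T u" using C_T by blast
    moreover obtain s' where "s' \<in> C x" "\<gamma> \<in> s'" using \<Gamma>(2)[OF \<gamma>] by blast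
    ultimately show "\<exists>z. R u z \<and> \<gamma> \<in> t z \<and> t z \<in> C x"
      unfolding T_iff by (metis T_iff subsetD)
  qed
  then show ?thesis using y by simp
qed

lemma Clus_loopable:
  assumes "s \<in> C x"
  shows "loopable s"
  unfolding loopable_def
proof (intro allI impI)
  fix \<Gamma> assume \<Gamma>: "\<^bold>\<langle>dt\<^bold>\<rangle> \<Gamma> \<in> \<Phi>" "fset \<Gamma> \<subseteq> s"
  have "\<exists>s'\<in>C x. \<gamma> \<in> s'" if "\<gamma> |\<in>| \<Gamma>" for \<gamma>
    using \<Gamma>(2) that assms by blast
  then show "\<^bold>\<langle>dt\<^bold>\<rangle> \<Gamma> \<in> s"
    using Clus_tangle[OF \<Gamma>(1) _ assms] by blast
qed

text \<open>Follow the type of \<open>y\<close> to an occurrence \<open>z\<close> with smallest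
  view. Either the type no longer recurs above \<open>z\<close>, or every recurrence has the same
  view, which means that it belongs to \<open>C z\<close>.\<close>

lemma minimal_successor:
  assumes "R x y"
  obtains z where "R x z" "t z = t y" "T z \<subseteq> T y" "good z" "irr z \<or> t z \<in> C z"
proof -
  define A where "A = {z. z = y \<or> R y z \<and> t z = t y}"
  have "y \<in> A" by (simp add: A_def)
  then obtain z where z: "z \<in> A" and min: "\<And>u. u \<in> A \<Longrightarrow> card (T z) \<le> card (T u)"
    using ex_has_least_nat[of "\<lambda>z. z \<in> A" y "\<lambda>z. card (T z)"] by blast
  have tz: "t z = t y" "R x z" "T z \<subseteq> T y"
    using z assms R_trans T_mono unfolding A_def by blast+
  have C: "t z \<in> C z" if "\<not> irr z"
  proof -
    have "T u = T z" if "R z u" "t u = t z" for u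
    proof -
      have "u \<in> A" using that z tz R_trans unfolding A_def by auto
      then show ?thesis
        using min T_mono[OF that(1)] card_seteq[OF finite_T] by blast
    qed
    then show ?thesis using that unfolding C_def irr_def by blast
  qed
  then have "good z"
    using Clus_loopable unfolding good_def by blast
  then show thesis using that[of z] tz C by blast
qed

lemma good_successor: "x \<in> Pt \<Longrightarrow> \<exists>y. R x y \<and> good y"
  using R_serial minimal_successor by metis

text \<open>With \<open>R0_mono\<close> this shows that the labels of the successors of a state are
  exactly its view. The clause on loops provides a successor that other loops with the same view see
  too; \<open>linked_states\<close> relies on it.\<close>

lemma visible:
  assumes a: "a \<in> W" and s: "s \<in> vw a"
  shows "\<exists>b\<in>W. R0 a b \<and> lab b = s \<and> ((\<exists>s \<tau>. a = Loop s \<tau>) \<longrightarrow> vw b \<subset> vw a \<or> (\<exists>s K. b = Clus s K (vw a)))"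
  using a
proof (cases rule: W_cases)
  case (Irr x E)
  then have "s \<in> T x" using s by simp
  then obtain y where "R x y" "t y = s"
    unfolding T_iff by blast
  then obtain z where z: "R x z" "t z = s" "good z"
    using minimal_successor by metis
  then have "state z \<in> W" "state z |\<in>| E"
    using state_W R_Pt Irr(6) by auto
  then have "R0 a (state z)"
    using a Irr(5) by (simp add: R0_def)
  then show ?thesis using z \<open>state z \<in> W\<close> Irr(5) by (intro bexI[of _ "state z"]) auto
next
  case (Loop x)
  then have "s \<in> T x" using s by simp
  then obtain y where y: "R x y" "t y = s"
    unfolding T_iff by blast
  then obtain z where z: "R x z" "t z = s" "good z" "irr z \<or> t z \<in> C z"
    using minimal_successor by metis
  have zP: "z \<in> Pt" using z R_Pt by blast
  show ?thesis
  proof (cases "irr z")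
    case True
    then have "T z \<subset> T x"
      using irr_less z(1) unfolding irr_def by blast
    moreover have "state z \<in> W" by (rule state_W[OF zP z(3)])
    ultimately show ?thesis
      using Loop z a s by (intro bexI[of _ "state z"]) (auto simp: R0_def)
  next
    case False
    then have sC: "s \<in> C z" using z by auto
    have "Clus s (C z) (T z) \<in> W" by (rule Clus_W[OF zP sC])
    moreover have "T z \<subset> T x \<or> T z = T x" using T_mono[OF z(1)] by blast
    ultimately show ?thesis
      using Loop a s by (intro bexI[of _ "Clus s (C z) (T z)"]) (auto simp: R0_def)
  qed
next
  case (Clus x s0)
  show ?thesis
  proof (cases "s \<in> C x")
    case True
    then show ?thesis
      using Clus Clus_W a s by (intro bexI[of _ "Clus s (C x) (T x)"]) (auto simp: R0_def)
  next
    case False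
    moreover have "s \<in> T x" using s Clus by simp
    ultimately obtain y where y: "R x y" "t y = s" "T y \<noteq> T x"
      unfolding C_def by blast
    then obtain z where z: "R x z" "t z = s" "good z" "T z \<subseteq> T y"
      using minimal_successor by metis
    have "T z \<subset> T x" using z(4) y T_mono[OF y(1)] by blast
    moreover have "state z \<in> W" using state_W R_Pt z by blast
    ultimately show ?thesis
      using Clus z a s by (intro bexI[of _ "state z"]) (auto simp: R0_def)
  qed
qed

lemma vw_ne: "a \<in> W \<Longrightarrow> vw a \<noteq> {}"
  using realizer T_ne by metis

sublocale frame: fin_frame W R'
proof
  show "finite W" by (rule finite_W)
  show "R' a b \<Longrightarrow> a \<in> W \<and> b \<in> W" for a b by (rule R'_W)
  show "R' a b \<Longrightarrow> R' b c \<Longrightarrow> R' a c" for a b c by (rule tranclp_trans)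
  show "a \<in> W \<Longrightarrow> \<exists>b. R' a b" for a
    using visible[of a] vw_ne[of a] by (meson all_not_in_conv tranclp.r_into_trancl)
qed

lemma reflexive_or_Irr:
  assumes "a \<in> W"
  shows "R0 a a \<or> (\<exists>x E. x \<in> Pt \<and> good x \<and> irr x \<and> state x = a \<and> a = Irr (t x) (T x) E \<and> fset E = state ` {y. R x y \<and> good y})"
  using assms
proof (cases rule: W_cases)
  case (Loop x)
  then show ?thesis using assms by (auto simp: R0_def irr_def)
next
  case (Clus x s)
  then show ?thesis using assms C_T[of x] by (auto simp: R0_def)
qed blast

lemma lab_Box:
  assumes "\<^bold>[d\<^bold>] \<psi> \<in> \<Phi>" "a \<in> W"
  shows "\<^bold>[d\<^bold>] \<psi> \<in> lab a \<longleftrightarrow> (\<forall>b. R' a b \<longrightarrow> \<psi> \<in> lab b)"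
proof -
  obtain x where x: "x \<in> Pt" "t x = lab a" "T x = vw a"
    using realizer[OF assms(2)] by blast
  have "\<^bold>[d\<^bold>] \<psi> \<in> lab a \<longleftrightarrow> (\<forall>s\<in>vw a. \<psi> \<in> s)"
    using t_Box[OF assms(1) x(1)] x(2) unfolding x(3)[symmetric] T_def by auto
  also have "\<dots> \<longleftrightarrow> (\<forall>b. R' a b \<longrightarrow> \<psi> \<in> lab b)"
    using R'_mono visible[OF assms(2)] by (metis tranclp.r_into_trancl)
  finally show ?thesis .
qed

lemma Clus_persistent:
  assumes "R' (Clus s K \<tau>) b" "vw b = \<tau>"
  shows "\<exists>s'. b = Clus s' K \<tau>"
  using assms
proof (induction rule: tranclp_induct)
  case (base y)
  then show ?case by (auto simp: R0_def)
next
  case (step b c)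
  have "vw b = \<tau>"
    using R'_mono[OF step(1)] R0_mono[OF step(2)] step.prems by auto
  then obtain s' where b: "b = Clus s' K \<tau>" using step.IH by blast
  show ?case using step(2) step.prems unfolding b R0_def by auto
qed

lemma Loop_persistent:
  assumes "R' (Loop s \<tau>) b" "vw b = \<tau>"
  shows "b = Loop s \<tau> \<or> (\<exists>s' K. b = Clus s' K \<tau>)"
  using assms
proof (induction rule: tranclp_induct)
  case (base y)
  then show ?case by (auto simp: R0_def)
next
  case (step b c)
  have "vw b = \<tau>"
    using R'_mono[OF step(1)] R0_mono[OF step(2)] step.prems by auto
  then have "b = Loop s \<tau> \<or> (\<exists>s' K. b = Clus s' K \<tau>)" using step.IH by blast
  then show ?case using step(2) step.prems unfolding R0_def by auto
qed

text \<open>(Ind) is applied to the predicate that some successor has the tangle formula. (Fix) is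
  used twice: once to reach \<open>\<gamma>\<close>, and once more to have the predicate again
  there.\<close>

lemma Tangle_down:
  assumes \<Gamma>: "\<^bold>\<langle>dt\<^bold>\<rangle> \<Gamma> \<in> \<Phi>" and y: "R x y" "\<^bold>\<langle>dt\<^bold>\<rangle> \<Gamma> \<in> t y"
  shows "\<^bold>\<langle>dt\<^bold>\<rangle> \<Gamma> \<in> t x"
proof (rule t_Ind[OF \<Gamma>])
  show "Def (\<lambda>u. \<exists>v. R u v \<and> \<^bold>\<langle>dt\<^bold>\<rangle> \<Gamma> \<in> t v)"
    by (intro Def_dia Def_tT)
  show "x \<in> Pt" "\<exists>v. R x v \<and> \<^bold>\<langle>dt\<^bold>\<rangle> \<Gamma> \<in> t v" using y R_Pt by blast+
  fix u \<gamma> assume "\<exists>v. R u v \<and> \<^bold>\<langle>dt\<^bold>\<rangle> \<Gamma> \<in> t v" and \<gamma>: "\<gamma> |\<in>| \<Gamma>"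
  then obtain v where v: "R u v" "\<^bold>\<langle>dt\<^bold>\<rangle> \<Gamma> \<in> t v" by blast
  obtain w where w: "R v w" "\<gamma> \<in> t w" "\<^bold>\<langle>dt\<^bold>\<rangle> \<Gamma> \<in> t w"
    using t_Fix[OF v(2) _ \<gamma>] R_Pt[OF v(1)] by blast
  obtain w' where "R w w'" "\<^bold>\<langle>dt\<^bold>\<rangle> \<Gamma> \<in> t w'"
    using t_Fix[OF w(3) _ \<gamma>] R_Pt[OF w(1)] by blast
  then show "\<exists>z. R u z \<and> \<gamma> \<in> t z \<and> (\<exists>v. R z v \<and> \<^bold>\<langle>dt\<^bold>\<rangle> \<Gamma> \<in> t v)"
    using v w R_trans by blast
qed

text \<open>From right to left: views cannot grow along \<open>R'\<close>, so from a point of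
  \<open>S\<close> with smallest view onwards, \<open>S\<close> stays at that view. By the
  persistence lemmas it then stays in one \<open>Clus\<close> cluster, where
  \<open>Clus_tangle\<close> applies, or at one loop, whose type is loopable.
  \<open>Tangle_down\<close> brings the formula back to \<open>w\<close>.\<close>

lemma lab_Tangle:
  assumes \<Gamma>: "\<^bold>\<langle>dt\<^bold>\<rangle> \<Gamma> \<in> \<Phi>" and w: "w \<in> W"
  shows "\<^bold>\<langle>dt\<^bold>\<rangle> \<Gamma> \<in> lab w \<longleftrightarrow> (\<exists>S\<subseteq>W. w \<in> S \<and> (\<forall>b\<in>S. \<forall>\<gamma>. \<gamma> |\<in>| \<Gamma> \<longrightarrow> (\<exists>c\<in>S. R' b c \<and> \<gamma> \<in> lab c)))" (is "?l \<longleftrightarrow> ?r")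
proof
  assume l: ?l
  define S where "S = {a \<in> W. \<^bold>\<langle>dt\<^bold>\<rangle> \<Gamma> \<in> lab a}"
  have "\<exists>c\<in>S. R' b c \<and> \<gamma> \<in> lab c" if b: "b \<in> S" and \<gamma>: "\<gamma> |\<in>| \<Gamma>" for b \<gamma>
  proof -
    have bW: "b \<in> W" using b by (simp add: S_def)
    obtain x where x: "x \<in> Pt" "t x = lab b" "T x = vw b"
      using realizer[OF bW] by blast
    obtain y where y: "R x y" "\<gamma> \<in> t y" "\<^bold>\<langle>dt\<^bold>\<rangle> \<Gamma> \<in> t y"
      using t_Fix[of \<Gamma> x \<gamma>] x b \<gamma> unfolding S_def by auto
    have "t y \<in> vw b" using t_in_T[OF y(1)] x(3) by simp
    then obtain c where "c \<in> W" "R0 b c" "lab c = t y"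
      using visible[OF bW] by blast
    then show ?thesis using y by (intro bexI[of _ c]) (auto simp: S_def)
  qed
  then show ?r
    using l w by (intro exI[of _ S]) (auto simp: S_def)
next
  assume ?r
  then obtain S where S: "S \<subseteq> W" "w \<in> S" and step: "\<And>b \<gamma>. b \<in> S \<Longrightarrow> \<gamma> |\<in>| \<Gamma> \<Longrightarrow> \<exists>c\<in>S. R' b c \<and> \<gamma> \<in> lab c"
    by blast
  obtain \<gamma>0 where \<gamma>0: "\<gamma>0 |\<in>| \<Gamma>"
    using Tangle_ne[OF \<Gamma>] by blast
  define A where "A = {b \<in> S. b = w \<or> R' w b}"
  have "w \<in> A" using S by (simp add: A_def)
  then obtain b where b: "b \<in> A" and min: "\<And>c. c \<in> A \<Longrightarrow> card (vw b) \<le> card (vw c)"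
    using ex_has_least_nat[of "\<lambda>z. z \<in> A" w "\<lambda>z. card (vw z)"] by blast
  have fin: "finite (vw a)" if "a \<in> W" for a
    using realizer[OF that] finite_T by metis
  define B where "B = {c \<in> A. vw c = vw b}"
  have next_B: "d \<in> B" if "c \<in> B" "d \<in> S" "R' c d" for c d
  proof -
    have "d \<in> A" using that frame.R_trans unfolding A_def B_def by blast
    moreover have "vw d = vw c"
    proof (rule card_seteq)
      show "finite (vw c)" using fin that R'_W by blast
      show "vw d \<subseteq> vw c" using R'_mono that by blast
      show "card (vw c) \<le> card (vw d)" using min[OF \<open>d \<in> A\<close>] that(1) by (simp add: B_def)
    qed
    ultimately show ?thesis using that by (simp add: B_def)
  qed
  have "b \<in> B" using b by (simp add: B_def)
  then obtain c0 where c0: "c0 \<in> B" "R' b c0"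
    using step[OF _ \<gamma>0, of b] next_B unfolding B_def A_def by blast
  have refl: "lab c \<in> vw c" if "R' c' c" "c' \<in> B" "c \<in> B" for c c'
    using R'_mono[OF that(1)] that(2,3) by (simp add: B_def)
  have BW: "B \<subseteq> W" using S unfolding B_def A_def by blast
  have "\<exists>c\<in>B. \<^bold>\<langle>dt\<^bold>\<rangle> \<Gamma> \<in> lab c"
  proof (cases "\<exists>c\<in>B. \<exists>s K \<tau>. c = Clus s K \<tau>")
    case True
    then obtain c s K \<tau> where c: "c \<in> B" "c = Clus s K \<tau>" by blast
    have "c \<in> W" using c BW by blast
    then obtain x where x: "x \<in> Pt" "s \<in> C x" "K = C x"
      using c(2) by (cases rule: W_cases) auto
    have "\<exists>s'\<in>C x. \<gamma> \<in> s'" if \<gamma>: "\<gamma> |\<in>| \<Gamma>" for \<gamma>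
    proof -
      obtain d where d: "d \<in> S" "R' c d" "\<gamma> \<in> lab d"
        using step[OF _ \<gamma>, of c] c unfolding B_def A_def by blast
      have "d \<in> B" using next_B c d by blast
      then have "vw d = \<tau>" using c by (auto simp: B_def)
      then obtain s' where s': "d = Clus s' K \<tau>" using Clus_persistent[of s K \<tau> d] d(2) c(2) by blast
      have "d \<in> W" using \<open>d \<in> B\<close> BW by blast
      then have "s' \<in> K" using s' by (cases rule: W_cases) auto
      then show ?thesis using d s' x by auto
    qed
    then have "\<^bold>\<langle>dt\<^bold>\<rangle> \<Gamma> \<in> s" using Clus_tangle[OF \<Gamma> _ x(2)] by blast
    then show ?thesis using c by force
  next
    case False
    \<comment> \<open>As \<open>c0\<close> succeeds a point with the same view, its label is visible
      to itself, which rules out an irreflexive state.\<close>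
    have "lab c0 \<in> vw c0" using refl[OF c0(2) \<open>b \<in> B\<close> c0(1)] .
    have "c0 \<in> W" using c0 BW by blast
    then obtain x where x: "x \<in> Pt" "good x" "\<not> irr x" "c0 = Loop (t x) (T x)"
    proof (cases rule: W_cases)
      case (Irr x E)
      then have False using \<open>lab c0 \<in> vw c0\<close> by (simp add: irr_def)
      then show ?thesis ..
    next
      case (Clus x s)
      then have False using False c0 by blast
      then show ?thesis ..
    qed (use that in blast)
    have "\<gamma> \<in> t x" if \<gamma>: "\<gamma> |\<in>| \<Gamma>" for \<gamma>
    proof -
      obtain d where d: "d \<in> S" "R' c0 d" "\<gamma> \<in> lab d"
        using step[OF _ \<gamma>, of c0] c0 unfolding B_def A_def by blast
      have "d \<in> B" using next_B c0 d by blast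
      then have "vw d = T x" using c0 x by (auto simp: B_def)
      then have "d = c0" using Loop_persistent[of "t x" "T x" d] d(2) x(4) False \<open>d \<in> B\<close> by auto
      then show ?thesis using d x by simp
    qed
    then have "\<^bold>\<langle>dt\<^bold>\<rangle> \<Gamma> \<in> t x"
      using x(2,3) \<Gamma> unfolding good_def loopable_def by blast
    then show ?thesis using c0 x by force
  qed
  then obtain c where c: "c \<in> B" "\<^bold>\<langle>dt\<^bold>\<rangle> \<Gamma> \<in> lab c" by blast
  then consider "c = w" | "R' w c" unfolding B_def A_def by blast
  then show ?l
  proof cases
    case 2
    obtain x where x: "x \<in> Pt" "t x = lab w" "T x = vw w"
      using realizer[OF w] by blast
    then obtain y where "R x y" "t y = lab c"
      using R'_mono[OF 2] T_iff by metis
    then show ?thesis using Tangle_down[OF \<Gamma>, of x y] c x by simp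
  qed (use c in simp)
qed

lemma type_represented:
  assumes "x \<in> Pt"
  shows "\<exists>a\<in>W. lab a = t x"
proof (cases "good x")
  case True
  then show ?thesis using assms state_W by (intro bexI[of _ "state x"]) auto
next
  case False
  then obtain y where "R x y" "t y = t x"
    unfolding good_def irr_def T_iff by blast
  then obtain z where "R x z" "t z = t x" "good z"
    using minimal_successor by metis
  then show ?thesis using state_W R_Pt by (intro bexI[of _ "state z"]) auto
qed

section \<open>Connectedness of the frame of states\<close>

text \<open>In all but one case \<open>R0\<close> relates the two states. Two loops need not be
  related, but by the clause on loops in \<open>visible\<close> some successor of the second is also
  one of the first.\<close>

lemma linked_states:
  assumes z: "z \<in> Pt" "good z" and u: "good u" "R z u"
  shows "\<exists>g. R' (state z) g \<and> R' (state u) g"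
proof -
  have uP: "u \<in> Pt" using u R_Pt by blast
  have W: "state z \<in> W" "state u \<in> W" using state_W z u uP by auto
  have via: ?thesis if "R0 (state z) (state u)"
    using that frame.R_serial[OF W(2)] by (meson tranclp.r_into_trancl tranclp_into_tranclp2)
  show ?thesis
  proof (cases "irr z")
    case True
    then obtain E where "state z = Irr (t z) (T z) E" "fset E = state ` {y. R z y \<and> good y}"
      using state_Irr by blast
    then have "R0 (state z) (state u)"
      using W u unfolding R0_def by auto
    then show ?thesis by (rule via)
  next
    case zL: False
    show ?thesis
    proof (cases "irr u")
      case True
      then have "T u \<subset> T z" using irr_less[OF u(2)] by (simp add: irr_def)
      then have "R0 (state z) (state u)"
        using W t_in_T[OF u(2)] unfolding R0_def state_Loop[OF zL] by auto
      then show ?thesis by (rule via)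
    next
      case uL: False
      have "t u \<in> vw (state u)" using uL by (simp add: irr_def)
      then obtain b where b: "b \<in> W" "R0 (state u) b" "lab b = t u" "vw b \<subset> T u \<or> (\<exists>s K. b = Clus s K (T u))"
        using visible[OF W(2)] state_Loop[OF uL] by fastforce
      have "vw b \<subset> T z \<or> vw b = T z \<and> (\<exists>s K. b = Clus s K (T z))"
        using b(4) T_mono[OF u(2)] by auto
      then have "R0 (state z) b"
        using W b t_in_T[OF u(2)] unfolding R0_def state_Loop[OF zL] by auto
      then show ?thesis using b(2) by blast
    qed
  qed
qed

definition link_closed :: "'v fm set st set \<Rightarrow> 'p set \<Rightarrow> bool" where
  "link_closed A N \<longleftrightarrow> (\<forall>y\<in>N. \<forall>z\<in>N. good y \<longrightarrow> good z \<longrightarrow>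
     (\<exists>g. R' (state y) g \<and> R' (state z) g) \<longrightarrow> (state y \<in> A \<longleftrightarrow> state z \<in> A))"

definition sees :: "'v fm set st set \<Rightarrow> 'p \<Rightarrow> bool" where
  "sees A x \<longleftrightarrow> (\<exists>y. R x y \<and> good y \<and> state y \<in> A)"

text \<open>Bad points are dropped from the frame, but \<open>G1\<close> and (C) speak of all
  points. A bad point is therefore placed according to the states that it sees.\<close>

definition side :: "'v fm set st set \<Rightarrow> 'p \<Rightarrow> bool" where
  "side A x \<longleftrightarrow> good x \<and> state x \<in> A \<or> \<not> good x \<and> sees A x"

lemma Def_in: "Def (\<lambda>x. good x \<and> state x \<in> A)"
proof (rule Def_cong)
  have "finite (A \<inter> state ` Pt)" using finite_states by blast
  then show "Def (\<lambda>x. good x \<and> (\<exists>a\<in>A \<inter> state ` Pt. state x = a))"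
    by (intro Def_conj Def_good Def_ex Def_state)
qed auto

lemma Def_sees: "Def (sees A)"
  unfolding sees_def[abs_def] by (intro Def_dia Def_in)

lemma Def_side: "Def (side A)"
  unfolding side_def[abs_def] by (intro Def_disj Def_in Def_conj Def_not Def_good Def_sees)

text \<open>All good points involved are linked to each other or seen from \<open>y\<close>, so only
  a bad point that sees both sides could break the equivalence; \<open>bad\<close> excludes
  this.\<close>

lemma side_transfer:
  assumes lc: "link_closed A N" and yN: "y \<in> N" "y \<in> Pt" and up: "\<And>z. R y z \<Longrightarrow> z \<in> N" and yz: "R y z"
    and bad: "\<not> good y \<Longrightarrow> \<not> (sees A y \<and> sees (- A) y)"
  shows "side A y \<longleftrightarrow> side A z"
proof -
  have zP: "z \<in> Pt" and zN: "z \<in> N" using R_Pt yz up by auto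
  obtain w where w: "R z w" "good w" using good_successor[OF zP] by blast
  have yw: "R y w" using R_trans yz w by blast
  have link: "state y \<in> A \<longleftrightarrow> state u \<in> A" if "good y" "R y u" "good u" for u
    using lc yN(1) up[OF that(2)] linked_states[OF yN(2) that(1,3,2)] that unfolding link_closed_def by blast
  show ?thesis
  proof (cases "good y")
    case gy: True
    show ?thesis
    proof (cases "good z")
      case True
      then show ?thesis using gy link[OF gy yz] by (simp add: side_def)
    next
      case False
      have "sees A z \<longleftrightarrow> state y \<in> A"
        using link[OF gy] w yw R_trans[OF yz] unfolding sees_def by blast
      then show ?thesis using gy False by (simp add: side_def)
    qed
  next
    case gy: False
    have split: "\<not> (sees A y \<and> sees (- A) y)" using bad gy by blast
    show ?thesis
    proof (cases "good z")
      case True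
      then have "state z \<in> A \<longleftrightarrow> sees A y"
        using split yz unfolding sees_def by blast
      then show ?thesis using gy True by (simp add: side_def)
    next
      case False
      have "sees A z \<longleftrightarrow> sees A y"
        using split yw w R_trans[OF yz] unfolding sees_def by blast
      then show ?thesis using gy False by (simp add: side_def)
    qed
  qed
qed

text \<open>
  If a point sees both sides of \<open>A\<close>, then by \<open>G\<^sub>1\<close> so does a bad successor of it. Among
  the bad points that see both sides, take one for which the set of types of its successors of
  this kind is minimal. The induction axiom then yields a tangle formula that the type of such a
  successor lacks because it is not loopable.
\<close>

lemma successors_one_sided:
  assumes x: "x \<in> Pt" and lc: "link_closed A {y. R x y}"
  shows "\<not> (sees A x \<and> sees (- A) x)"
proof
  assume sx: "sees A x \<and> sees (- A) x"
  define \<eta> where "\<eta> u \<longleftrightarrow> sees A u \<and> sees (- A) u" for u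
  define B where "B u \<longleftrightarrow> \<not> good u \<and> \<eta> u" for u
  have step: "\<exists>v. R u v \<and> B v" if u: "u = x \<or> R x u" "\<eta> u" for u
  proof (rule ccontr)
    assume n: "\<nexists>v. R u v \<and> B v"
    have uP: "u \<in> Pt" using u x R_Pt by blast
    have up: "R x v" if "R u v" for v using u that R_trans by blast
    have tr: "side A v \<longleftrightarrow> side A w" if "R u v" "R v w" for v w
    proof (rule side_transfer[OF lc])
      show "v \<in> {y. R x y}" "v \<in> Pt" "R v w" using up R_Pt that by auto
      show "z \<in> {y. R x y}" if "R v z" for z using R_trans up \<open>R u v\<close> that by blast
      show "\<not> (sees A v \<and> sees (- A) v)" if "\<not> good v"
        using n \<open>R u v\<close> that unfolding B_def \<eta>_def by blast
    qed
    obtain y y' where y: "R u y" "good y" "state y \<in> A" "R u y'" "good y'" "state y' \<notin> A"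
      using u(2) unfolding \<eta>_def sees_def by blast
    have "side A y \<longleftrightarrow> side A y'"
      by (rule const_successors[OF Def_side uP tr y(1,4)])
    then show False using y by (simp add: side_def)
  qed
  have DefB: "Def B"
    unfolding B_def[abs_def] \<eta>_def by (intro Def_conj Def_not Def_good Def_sees)
  define S where "S v = {t w | w. R v w \<and> B w}" for v
  have finS: "finite (S v)" for v
    by (rule finite_subset[OF _ finite_T[of v]]) (auto simp: S_def T_def)
  obtain v0 where "R x v0" "B v0"
    using step[of x] sx unfolding \<eta>_def by blast
  then obtain v where v: "R x v" "B v" and min: "\<And>u. R x u \<Longrightarrow> B u \<Longrightarrow> card (S v) \<le> card (S u)"
    using ex_has_least_nat[of "\<lambda>u. R x u \<and> B u" v0 "\<lambda>u. card (S u)"] by blast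
  have S_eq: "S u = S v" if "R v u" "B u" for u
  proof (rule card_seteq[OF finS])
    show "S u \<subseteq> S v" using R_trans[OF that(1)] unfolding S_def by blast
    show "card (S v) \<le> card (S u)" using min R_trans v(1) that by blast
  qed
  obtain w where w: "R v w" "B w"
    using step[of v] v unfolding B_def by blast
  obtain \<Gamma> where \<Gamma>: "\<^bold>\<langle>dt\<^bold>\<rangle> \<Gamma> \<in> \<Phi>" "fset \<Gamma> \<subseteq> t w" "\<^bold>\<langle>dt\<^bold>\<rangle> \<Gamma> \<notin> t w"
    using w(2) unfolding B_def good_def loopable_def by blast
  have "\<^bold>\<langle>dt\<^bold>\<rangle> \<Gamma> \<in> t w"
  proof (rule t_Ind[OF \<Gamma>(1)])
    show "Def (\<lambda>u. B u \<and> t u = t w)" by (intro Def_conj DefB Def_t)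
    show "w \<in> Pt" "B w \<and> t w = t w" using w R_Pt by auto
    fix u \<gamma> assume u: "u = w \<or> R w u" "B u \<and> t u = t w" and \<gamma>: "\<gamma> |\<in>| \<Gamma>"
    have "t w \<in> S v" using w unfolding S_def by blast
    moreover have "R v u" using u(1) w R_trans by blast
    ultimately have "t w \<in> S u" using S_eq u(2) by blast
    then obtain z where "R u z" "B z" "t z = t w" unfolding S_def by auto
    then show "\<exists>z. R u z \<and> \<gamma> \<in> t z \<and> B z \<and> t z = t w" using \<Gamma>(2) \<gamma> by auto
  qed
  then show False using \<Gamma>(3) by blast
qed

lemma all_one_sided:
  assumes lc: "link_closed A Pt" and y: "y \<in> Pt" "good y" "y' \<in> Pt" "good y'"
  shows "state y \<in> A \<longleftrightarrow> state y' \<in> A"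
proof -
  have tr: "side A v \<longleftrightarrow> side A w" if "R v w" for v w
  proof (rule side_transfer[OF lc])
    show "v \<in> Pt" "v \<in> Pt" "R v w" using R_Pt that by auto
    show "z \<in> Pt" if "R v z" for z using R_Pt that by blast
    have "{z. R v z} \<subseteq> Pt" using R_Pt by blast
    then have "link_closed A {z. R v z}" using lc unfolding link_closed_def by blast
    then show "\<not> (sees A v \<and> sees (- A) v)"
      using successors_one_sided R_Pt that by blast
  qed
  have "side A y \<longleftrightarrow> side A y'"
    by (rule const_global[OF Def_side tr y(1,3)])
  then show ?thesis using y by (simp add: side_def)
qed

lemma R'_Irr:
  assumes "R' a b" "a = Irr s \<tau> E"
  shows "\<exists>e. e |\<in>| E \<and> (b = e \<or> R' e b)"
proof -
  obtain e where e: "R0 a e" "e = b \<or> R' e b"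
    using assms(1) by (metis tranclpD rtranclpD)
  then show ?thesis using assms(2) by (auto simp: R0_def)
qed

text \<open>\<open>link_inv\<close> is a condition on reflexive states, including the cluster
  states, while \<open>link_closed\<close> concerns the states of all good points.
  \<open>lift\<close> passes from the first to the second.\<close>

definition lift :: "'v fm set st set \<Rightarrow> 'v fm set st set" where
  "lift A = {a. \<exists>c. R' c c \<and> R' a c \<and> c \<in> A}"

definition link_inv :: "'v fm set st set \<Rightarrow> 'v fm set st set \<Rightarrow> bool" where
  "link_inv A F \<longleftrightarrow> (\<forall>a\<in>F. \<forall>b\<in>F. R' a a \<longrightarrow> R' b b \<longrightarrow> (\<exists>g. R' a g \<and> R' b g) \<longrightarrow> (a \<in> A \<longleftrightarrow> b \<in> A))"

lemma lift_iff:
  assumes homog: "\<And>c c'. R' a c \<Longrightarrow> R' c c \<Longrightarrow> R' a c' \<Longrightarrow> R' c' c' \<Longrightarrow> c \<in> A \<longleftrightarrow> c' \<in> A"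
    and "R' a c" "R' c c"
  shows "a \<in> lift A \<longleftrightarrow> c \<in> A"
  using assms unfolding lift_def by blast

text \<open>Induction on the nesting of the state. A reflexive state is linked to itself through
  everything it sees. At an irreflexive one, the induction hypothesis shows that each recorded state
  sees one side of \<open>A\<close> only, and \<open>successors_one_sided\<close> for
  \<open>lift A\<close> shows that all recorded states see the same side.\<close>

lemma homogeneous:
  assumes "a \<in> W" "link_inv A F" "F \<subseteq> W" "\<And>b. R' a b \<Longrightarrow> b \<in> F" "R' a a \<Longrightarrow> a \<in> F"
    and "R' a c" "R' c c" "R' a c'" "R' c' c'"
  shows "c \<in> A \<longleftrightarrow> c' \<in> A"
  using assms
proof (induction a arbitrary: c c')
  case (Irr s \<tau> E)
  let ?a = "Irr s \<tau> E"
  show ?case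
  proof (cases "R' ?a ?a")
    case True
    then show ?thesis using Irr.prems unfolding link_inv_def by blast
  next
    case False
    then obtain x where x: "x \<in> Pt" "state x = ?a" "fset E = state ` {y. R x y \<and> good y}"
      using reflexive_or_Irr[OF Irr.prems(1)] by auto
    have E_R': "R' ?a e" if "e |\<in>| E" for e
    proof -
      have "e \<in> W" using that x(3) state_W R_Pt by auto
      then have "R0 ?a e" using that Irr.prems(1) by (simp add: R0_def)
      then show ?thesis by blast
    qed
    have hom: "c \<in> A \<longleftrightarrow> c' \<in> A" if e: "e |\<in>| E" "R' e c" "R' c c" "R' e c'" "R' c' c'" for e c c'
    proof (rule Irr.IH[of e c c'])
      note eR = E_R'[OF e(1)]
      show "e \<in> W" using R'_W[OF eR] by simp
      show "b \<in> F" if "R' e b" for b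
        using Irr.prems(4) frame.R_trans[OF eR that] by simp
      show "e \<in> F"
        using Irr.prems(4) eR by simp
    qed (use e Irr.prems(2,3) in simp_all)
    have li: "e \<in> lift A \<longleftrightarrow> c \<in> A" if "e |\<in>| E" "R' e c" "R' c c" for e c
      by (rule lift_iff[OF hom[OF that(1)] that(2,3)])
    have "link_closed (lift A) {y. R x y}"
      unfolding link_closed_def
    proof (intro ballI impI, elim exE conjE)
      fix y z g assume y: "y \<in> {y. R x y}" "z \<in> {y. R x y}" "good y" "good z" "R' (state y) g" "R' (state z) g"
      have E: "state y |\<in>| E" "state z |\<in>| E" using y x(3) by auto
      obtain c where c: "R' g c" "R' c c"
        using frame.reflexive_above R'_W y(5) by blast
      then have "R' (state y) c" "R' (state z) c" using y frame.R_trans by blast+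
      then show "state y \<in> lift A \<longleftrightarrow> state z \<in> lift A" using li E c by blast
    qed
    then have one: "\<not> (sees (lift A) x \<and> sees (- lift A) x)"
      by (rule successors_one_sided[OF x(1)])
    have E_one: "e \<in> lift A \<longleftrightarrow> e' \<in> lift A" if ee: "e |\<in>| E" "e' |\<in>| E" for e e'
    proof -
      obtain y y' where "R x y" "good y" "e = state y" "R x y'" "good y'" "e' = state y'"
        using ee x(3) by auto
      then show ?thesis using one unfolding sees_def by blast
    qed
    obtain e where e: "e |\<in>| E" "c = e \<or> R' e c"
      using R'_Irr[OF \<open>R' ?a c\<close> refl] by blast
    obtain e' where e': "e' |\<in>| E" "c' = e' \<or> R' e' c'"
      using R'_Irr[OF \<open>R' ?a c'\<close> refl] by blast
    have "e \<in> lift A \<longleftrightarrow> c \<in> A" "e' \<in> lift A \<longleftrightarrow> c' \<in> A"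
      using li e e' Irr.prems by blast+
    then show ?thesis using E_one e e' by blast
  qed
next
  case (Loop s \<tau>)
  then have "R' (Loop s \<tau>) (Loop s \<tau>)"
    using reflexive_or_Irr[OF Loop.prems(1)] by auto
  then show ?case using Loop.prems unfolding link_inv_def by blast
next
  case (Clus s K \<tau>)
  then have "R' (Clus s K \<tau>) (Clus s K \<tau>)"
    using reflexive_or_Irr[OF Clus.prems(1)] by auto
  then show ?case using Clus.prems unfolding link_inv_def by blast
qed

text \<open>A \<open>Clus\<close> state is never the state of a point, but a point that realizes it
  is good and has a loop as its state, and this loop sees the cluster.\<close>

lemma state_sees_reflexive:
  assumes "c \<in> W" "R' c c"
  shows "\<exists>z\<in>Pt. good z \<and> R' (state z) c"
  using assms(1)
proof (cases rule: W_cases)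
  case (Clus x s)
  obtain z where z: "R x z" "t z = s" "T z = T x"
    using Clus(2) unfolding C_def T_iff by blast
  have sT: "s \<in> T x" using Clus(2) C_T by blast
  have zP: "z \<in> Pt" using z R_Pt by blast
  have g: "good z" using Clus_loopable[OF Clus(2)] z by (simp add: good_def)
  have "\<not> irr z" using z sT by (simp add: irr_def)
  then have st: "state z = Loop s (T x)" using state_Loop z by simp
  have "R0 (state z) c"
    using state_W[OF zP g] assms(1) sT unfolding st R0_def Clus(3) by auto
  then show ?thesis using zP g by blast
qed (use assms in auto)

sublocale model: good_frame W R'
proof
  show "W \<noteq> {}"
    using Pt_ne type_represented by blast
  show "frame.link_connected W"
    unfolding frame.link_connected_def
  proof (intro allI impI ballI)
    fix A c c' assume inv: "\<forall>a\<in>W. \<forall>b\<in>W. R' a a \<longrightarrow> R' b b \<longrightarrow> (\<exists>g. R' a g \<and> R' b g) \<longrightarrow> (a \<in> A \<longleftrightarrow> b \<in> A)"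
      and c: "c \<in> W" "c' \<in> W" "R' c c" "R' c' c'"
    have li: "a \<in> lift A \<longleftrightarrow> c \<in> A" if "R' a c" "R' c c" for a c
    proof (rule lift_iff[OF homogeneous[of a A W] that])
      show "link_inv A W" using inv by (simp add: link_inv_def)
    qed (use R'_W that in blast)+
    have "link_closed (lift A) Pt"
      unfolding link_closed_def
    proof (intro ballI impI, elim exE conjE)
      fix y z g assume y: "R' (state y) g" "R' (state z) g"
      obtain c where c: "R' g c" "R' c c"
        using frame.reflexive_above R'_W y(1) by blast
      then have "R' (state y) c" "R' (state z) c" using y frame.R_trans by blast+
      then show "state y \<in> lift A \<longleftrightarrow> state z \<in> lift A" using li c by blast
    qed
    moreover obtain z z' where "z \<in> Pt" "good z" "R' (state z) c" "z' \<in> Pt" "good z'" "R' (state z') c'"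
      using state_sees_reflexive c by metis
    ultimately show "c \<in> A \<longleftrightarrow> c' \<in> A"
      using all_one_sided[of "lift A" z z'] li c by metis
  qed
  show "frame.link_connected (frame.up v)" if v: "v \<in> W" "\<not> R' v v" for v
    unfolding frame.link_connected_def
  proof (intro allI impI ballI)
    fix A c c' assume inv: "\<forall>a\<in>frame.up v. \<forall>b\<in>frame.up v. R' a a \<longrightarrow> R' b b \<longrightarrow> (\<exists>g. R' a g \<and> R' b g) \<longrightarrow> (a \<in> A \<longleftrightarrow> b \<in> A)"
      and c: "c \<in> frame.up v" "c' \<in> frame.up v" "R' c c" "R' c' c'"
    show "c \<in> A \<longleftrightarrow> c' \<in> A"
    proof (rule homogeneous[OF v(1), of A "frame.up v"])
      show "link_inv A (frame.up v)" using inv by (simp add: link_inv_def)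
      show "frame.up v \<subseteq> W" using R'_W by blast
    qed (use v c in simp_all)
  qed
qed

end

section \<open>Soundness\<close>

lemma truth_psubst: "truth X h x (psubst s P) \<longleftrightarrow> peval (\<lambda>n. truth X h x (s n)) P"
  by (induction P) simp_all

lemma truth_Conjs: "truth X h x (\<^bold>\<And> \<phi>s) \<longleftrightarrow> (\<forall>\<phi>\<in>set \<phi>s. truth X h x \<phi>)"
  by (induction \<phi>s rule: Conjs.induct) auto

lemma truth_Dia:
  "truth X h x (\<^bold>\<langle>d\<^bold>\<rangle> \<phi>) \<longleftrightarrow> (\<forall>U. openin X U \<longrightarrow> x \<in> U \<longrightarrow> (\<exists>y\<in>U - {x}. truth X h y \<phi>))"
  by auto

text \<open>The antecedent makes both the truth set of \<open>\<phi>\<close> and its complement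
  open.\<close>

lemma valid_C:
  fixes X :: "'x topology" and \<phi> :: "'v fm"
  assumes "connected_space X"
  shows "valid X (\<^bold>\<forall> (\<^bold>\<box>\<^sup>* \<phi> \<^bold>\<or> \<^bold>\<box>\<^sup>* \<^bold>\<not> \<phi>) \<^bold>\<rightarrow> (\<^bold>\<forall> \<phi> \<^bold>\<or> \<^bold>\<forall> \<^bold>\<not> \<phi>))"
  unfolding valid_def
proof (intro allI impI ballI)
  fix h :: "'v \<Rightarrow> 'x set" and x assume "x \<in> topspace X"
  let ?A = "{y \<in> topspace X. truth X h y \<phi>}" and ?B = "{y \<in> topspace X. \<not> truth X h y \<phi>}"
  have "?A = {} \<or> ?B = {}" if c: "\<forall>y\<in>topspace X. truth X h y (\<^bold>\<box>\<^sup>* \<phi> \<^bold>\<or> \<^bold>\<box>\<^sup>* \<^bold>\<not> \<phi>)"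
  proof -
    have "\<exists>U. openin X U \<and> y \<in> U \<and> U \<subseteq> ?A" if "y \<in> ?A" for y
    proof -
      have "truth X h y (\<^bold>[d\<^bold>] \<phi>)" "truth X h y \<phi>" using c that by auto
      then obtain U where "openin X U" "y \<in> U" "\<forall>z\<in>U - {y}. truth X h z \<phi>" by auto
      then show ?thesis
        using that openin_subset[of X U] by (intro exI[of _ U]) auto
    qed
    then have "openin X ?A" by (subst openin_subopen) blast
    moreover have "\<exists>U. openin X U \<and> y \<in> U \<and> U \<subseteq> ?B" if "y \<in> ?B" for y
    proof -
      have "truth X h y (\<^bold>[d\<^bold>] \<^bold>\<not> \<phi>)" "\<not> truth X h y \<phi>" using c that by auto
      then obtain U where "openin X U" "y \<in> U" "\<forall>z\<in>U - {y}. \<not> truth X h z \<phi>" by auto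
      then show ?thesis
        using that openin_subset[of X U] by (intro exI[of _ U]) auto
    qed
    then have "openin X ?B" by (subst openin_subopen) blast
    moreover have "topspace X \<subseteq> ?A \<union> ?B" "?A \<inter> ?B = {}" by blast+
    ultimately show ?thesis
      using assms unfolding connected_space_def by blast
  qed
  then show "truth X h x (\<^bold>\<forall> (\<^bold>\<box>\<^sup>* \<phi> \<^bold>\<or> \<^bold>\<box>\<^sup>* \<^bold>\<not> \<phi>) \<^bold>\<rightarrow> (\<^bold>\<forall> \<phi> \<^bold>\<or> \<^bold>\<forall> \<^bold>\<not> \<phi>))"
    by (auto simp del: truth.simps(5))
qed

lemma valid_KD4:
  assumes "t1_space X" "dense_in_itself X" "\<phi> \<in> KD4_axioms"
  shows "valid X \<phi>"
proof -
  consider \<psi> \<theta> where "\<phi> = \<^bold>[d\<^bold>] (\<psi> \<^bold>\<rightarrow> \<theta>) \<^bold>\<rightarrow> (\<^bold>[d\<^bold>] \<psi> \<^bold>\<rightarrow> \<^bold>[d\<^bold>] \<theta>)" | "\<phi> = \<^bold>\<langle>d\<^bold>\<rangle> Top"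
    | \<psi> where "\<phi> = \<^bold>[d\<^bold>] \<psi> \<^bold>\<rightarrow> \<^bold>[d\<^bold>] \<^bold>[d\<^bold>] \<psi>"
    using assms(3) unfolding KD4_axioms_def by blast
  then show ?thesis
  proof cases
    case 1
    have "truth X h x (\<^bold>[d\<^bold>] \<theta>)" if "truth X h x (\<^bold>[d\<^bold>] (\<psi> \<^bold>\<rightarrow> \<theta>))" "truth X h x (\<^bold>[d\<^bold>] \<psi>)" for h x
    proof -
      obtain U V where "openin X U" "x \<in> U" "\<forall>y\<in>U - {x}. truth X h y \<psi> \<longrightarrow> truth X h y \<theta>"
        "openin X V" "x \<in> V" "\<forall>y\<in>V - {x}. truth X h y \<psi>"
        using \<open>truth X h x (\<^bold>[d\<^bold>] (\<psi> \<^bold>\<rightarrow> \<theta>))\<close> \<open>truth X h x (\<^bold>[d\<^bold>] \<psi>)\<close> by auto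
      then have "openin X (U \<inter> V)" "x \<in> U \<inter> V" "\<forall>y\<in>U \<inter> V - {x}. truth X h y \<theta>" by auto
      then show ?thesis by (simp only: truth.simps(5)) blast
    qed
    then show ?thesis
      unfolding 1 valid_def by (simp del: truth.simps(5))
  next
    case 2
    have "\<exists>y\<in>U - {x}. True" if "openin X U" "x \<in> U" for U x
    proof (rule ccontr)
      assume "\<not> ?thesis"
      then have "U = {x}" using that by blast
      then show False
        using that assms(2) openin_subset[of X U] unfolding dense_in_itself_def by auto
    qed
    then show ?thesis
      unfolding 2 valid_def truth_Dia by simp
  next
    case 3
    have "truth X h x (\<^bold>[d\<^bold>] \<^bold>[d\<^bold>] \<psi>)" if b: "truth X h x (\<^bold>[d\<^bold>] \<psi>)" for h x
    proof -
      obtain U where U: "openin X U" "x \<in> U" "\<forall>y\<in>U - {x}. truth X h y \<psi>"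
        using b by auto
      have "closedin X {x}"
        using assms(1) U openin_subset[of X U] unfolding t1_space_closedin_singleton by auto
      \<comment> \<open>Because the punctured set is open, it is a neighbourhood of each of its
        points on which \<open>\<psi>\<close> holds throughout.\<close>
      then have "openin X (U - {x})" using U(1) by (rule openin_diff[rotated])
      then have "\<forall>y\<in>U - {x}. truth X h y (\<^bold>[d\<^bold>] \<psi>)"
        using U(3) by (simp only: truth.simps(5)) blast
      then show ?thesis using U by (subst truth.simps(5)) blast
    qed
    then show ?thesis
      unfolding 3 valid_def by (simp del: truth.simps(5))
  qed
qed

lemma valid_S5_U:
  assumes "\<phi> \<in> S5_axioms \<union> U_axioms"
  shows "valid X \<phi>"
proof -
  have "\<exists>U. openin X U \<and> x \<in> U" if "x \<in> topspace X" for x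
    using that openin_topspace by blast
  moreover have "y \<in> topspace X" if "openin X U" "y \<in> U" for U y
    using that openin_subset by blast
  ultimately show ?thesis
    using assms unfolding S5_axioms_def U_axioms_def valid_def
    by auto (metis DiffD1 openin_topspace)+
qed

lemma valid_Fix:
  fixes X :: "'x topology" and \<Gamma> :: "'v fm fset"
  assumes \<gamma>: "\<gamma> |\<in>| \<Gamma>"
  shows "valid X (\<^bold>\<langle>dt\<^bold>\<rangle> \<Gamma> \<^bold>\<rightarrow> \<^bold>\<langle>d\<^bold>\<rangle> (\<gamma> \<^bold>\<and> \<^bold>\<langle>dt\<^bold>\<rangle> \<Gamma>))"
  unfolding valid_def
proof (intro allI impI ballI)
  fix h :: "'v \<Rightarrow> 'x set" and x
  have "truth X h x (\<^bold>\<langle>d\<^bold>\<rangle> (\<gamma> \<^bold>\<and> \<^bold>\<langle>dt\<^bold>\<rangle> \<Gamma>))" if "truth X h x (\<^bold>\<langle>dt\<^bold>\<rangle> \<Gamma>)"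
  proof -
    obtain S where S: "S \<subseteq> topspace X" "x \<in> S"
      "\<forall>\<delta>|\<in>|\<Gamma>. S \<subseteq> X derived_set_of ({y \<in> topspace X. truth X h y \<delta>} \<inter> S)"
      using \<open>truth X h x (\<^bold>\<langle>dt\<^bold>\<rangle> \<Gamma>)\<close> by auto
    have dt: "truth X h y (\<^bold>\<langle>dt\<^bold>\<rangle> \<Gamma>)" if "y \<in> S" for y
      using S that by auto
    have "x \<in> X derived_set_of ({y \<in> topspace X. truth X h y \<gamma>} \<inter> S)"
      using S \<gamma> by blast
    then have d: "\<exists>z. z \<noteq> x \<and> z \<in> {y \<in> topspace X. truth X h y \<gamma>} \<inter> S \<and> z \<in> U" if "x \<in> U" "openin X U" for U
      using that unfolding in_derived_set_of by blast
    show ?thesis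
      unfolding truth_Dia
    proof (intro allI impI)
      fix U assume "openin X U" "x \<in> U"
      then obtain z where z: "z \<noteq> x" "truth X h z \<gamma>" "z \<in> S" "z \<in> U"
        using d by blast
      then have "truth X h z (\<gamma> \<^bold>\<and> \<^bold>\<langle>dt\<^bold>\<rangle> \<Gamma>)"
        using dt by (simp only: truth.simps(4))
      then show "\<exists>z\<in>U - {x}. truth X h z (\<gamma> \<^bold>\<and> \<^bold>\<langle>dt\<^bold>\<rangle> \<Gamma>)"
        using z by blast
    qed
  qed
  then show "truth X h x (\<^bold>\<langle>dt\<^bold>\<rangle> \<Gamma> \<^bold>\<rightarrow> \<^bold>\<langle>d\<^bold>\<rangle> (\<gamma> \<^bold>\<and> \<^bold>\<langle>dt\<^bold>\<rangle> \<Gamma>))"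
    by (simp del: truth.simps(5,7))
qed

lemma valid_Ind:
  assumes "\<phi> \<in> Ind_axioms"
  shows "valid X \<phi>"
proof -
  obtain \<psi> \<Gamma> \<gamma>s where \<phi>: "\<phi> = \<^bold>\<box>\<^sup>* (\<psi> \<^bold>\<rightarrow> \<^bold>\<And> (map (\<lambda>\<gamma>. \<^bold>\<langle>d\<^bold>\<rangle> (\<gamma> \<^bold>\<and> \<psi>)) \<gamma>s)) \<^bold>\<rightarrow> (\<psi> \<^bold>\<rightarrow> \<^bold>\<langle>dt\<^bold>\<rangle> \<Gamma>)"
    and \<gamma>s: "fset_of_list \<gamma>s = \<Gamma>"
    using assms unfolding Ind_axioms_def by blast
  have "truth X h x (\<^bold>\<langle>dt\<^bold>\<rangle> \<Gamma>)"
    if "truth X h x (\<^bold>\<box>\<^sup>* (\<psi> \<^bold>\<rightarrow> \<^bold>\<And> (map (\<lambda>\<gamma>. \<^bold>\<langle>d\<^bold>\<rangle> (\<gamma> \<^bold>\<and> \<psi>)) \<gamma>s)))" "truth X h x \<psi>" for h x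
  proof -
    let ?i = "\<psi> \<^bold>\<rightarrow> \<^bold>\<And> (map (\<lambda>\<gamma>. \<^bold>\<langle>d\<^bold>\<rangle> (\<gamma> \<^bold>\<and> \<psi>)) \<gamma>s)"
    obtain U where U: "openin X U" "x \<in> U" "\<forall>y\<in>U - {x}. truth X h y ?i" "truth X h x ?i"
      using \<open>truth X h x (\<^bold>\<box>\<^sup>* ?i)\<close> by (auto simp only: truth.simps(4,5))
    have i: "truth X h y ?i" if "y \<in> U" for y
      using U that by (cases "y = x") simp_all
    define S where "S = {y \<in> U. truth X h y \<psi>}"
    have "S \<subseteq> X derived_set_of ({y \<in> topspace X. truth X h y \<delta>} \<inter> S)" if "\<delta> |\<in>| \<Gamma>" for \<delta>
    proof
      fix y assume y: "y \<in> S"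
      have "\<delta> \<in> set \<gamma>s" using that \<gamma>s fset_of_list.rep_eq[of \<gamma>s] by auto
      then have "truth X h y (\<^bold>\<langle>d\<^bold>\<rangle> (\<delta> \<^bold>\<and> \<psi>))"
        using i[of y] y unfolding S_def by (auto simp: truth_Conjs simp del: truth.simps(5))
      then have d: "\<exists>z\<in>V - {y}. truth X h z (\<delta> \<^bold>\<and> \<psi>)" if "openin X V" "y \<in> V" for V
        using that unfolding truth_Dia by blast
      show "y \<in> X derived_set_of ({y \<in> topspace X. truth X h y \<delta>} \<inter> S)"
        unfolding in_derived_set_of
      proof (intro conjI allI impI)
        show "y \<in> topspace X" using y U openin_subset[of X U] unfolding S_def by blast
        fix V assume V: "y \<in> V \<and> openin X V"
        then obtain z where "z \<in> V \<inter> U - {y}" "truth X h z (\<delta> \<^bold>\<and> \<psi>)"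
          using d[of "V \<inter> U"] y U unfolding S_def by auto
        then show "\<exists>z. z \<noteq> y \<and> z \<in> {y \<in> topspace X. truth X h y \<delta>} \<inter> S \<and> z \<in> V"
          using openin_subset[OF U(1)] unfolding S_def by auto
      qed
    qed
    moreover have "S \<subseteq> topspace X" "x \<in> S"
      using openin_subset[OF U(1)] U(2) \<open>truth X h x \<psi>\<close> unfolding S_def by auto
    ultimately show ?thesis by auto
  qed
  then show ?thesis
    unfolding \<phi> valid_def by (simp del: truth.simps(5,7))
qed

lemma sound:
  assumes X: "t1_space X" "dense_in_itself X" "connected_space X" "validates X (G1 \<inter> L)"
    and "\<phi> \<in> thms L full_axioms"
  shows "valid X \<phi>"
  using assms(5)
proof induction
  case (ax \<phi>)
  consider "\<phi> \<in> Taut" | "\<phi> \<in> KD4_axioms" | "\<phi> \<in> G1" | "\<phi> \<in> S5_axioms \<union> U_axioms" | "\<phi> \<in> C_axioms"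
    | "\<phi> \<in> Fix_axioms" | "\<phi> \<in> Ind_axioms"
    using ax unfolding full_axioms_def by blast
  then show ?case
  proof cases
    case 1
    then show ?thesis unfolding Taut_def valid_def by (auto simp: truth_psubst)
  next
    case 2
    then show ?thesis using valid_KD4 X by blast
  next
    case 3
    then show ?thesis using X(4) ax unfolding validates_def by blast
  next
    case 4
    then show ?thesis by (rule valid_S5_U)
  next
    case 5
    then show ?thesis using valid_C[OF X(3)] unfolding C_axioms_def by blast
  next
    case 6
    then show ?thesis using valid_Fix unfolding Fix_axioms_def by blast
  next
    case 7
    then show ?thesis by (rule valid_Ind)
  qed
next
  case (mp \<phi> \<psi>)
  then show ?case by (auto simp: valid_def)
next
  case (nec_d \<phi>)
  then show ?case by (auto simp: valid_def intro!: exI[of _ "topspace X"])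
next
  case (nec_univ \<phi>)
  then show ?case by (auto simp: valid_def)
qed

section \<open>Completeness\<close>

primrec sub :: "'v fm \<Rightarrow> 'v fm set" where
  "sub (Atom p) = {Atom p}"
| "sub Top = {Top}"
| "sub (\<^bold>\<not> \<phi>) = insert (\<^bold>\<not> \<phi>) (sub \<phi>)"
| "sub (\<phi> \<^bold>\<and> \<psi>) = insert (\<phi> \<^bold>\<and> \<psi>) (sub \<phi> \<union> sub \<psi>)"
| "sub (\<^bold>[d\<^bold>] \<phi>) = insert (\<^bold>[d\<^bold>] \<phi>) (sub \<phi>)"
| "sub (\<^bold>\<forall> \<phi>) = insert (\<^bold>\<forall> \<phi>) (sub \<phi>)"
| "sub (\<^bold>\<langle>dt\<^bold>\<rangle> \<Gamma>) = insert (\<^bold>\<langle>dt\<^bold>\<rangle> \<Gamma>) (\<Union> (fset (sub |`| \<Gamma>)))"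

lemma finite_sub: "finite (sub \<phi>)"
  by (induction \<phi>) auto

lemma sub_refl: "\<phi> \<in> sub \<phi>"
  by (cases \<phi>) auto

lemma sub_trans: "\<psi> \<in> sub \<phi> \<Longrightarrow> sub \<psi> \<subseteq> sub \<phi>"
proof (induction \<phi>)
  case (Tangle \<Gamma>)
  show ?case
  proof (cases "\<psi> = \<^bold>\<langle>dt\<^bold>\<rangle> \<Gamma>")
    case False
    then obtain \<gamma> where "\<gamma> |\<in>| \<Gamma>" "\<psi> \<in> sub \<gamma>" using Tangle.prems by auto
    then have "sub \<psi> \<subseteq> sub \<gamma>" "\<gamma> |\<in>| \<Gamma>" using Tangle.IH by auto
    then show ?thesis by fastforce
  qed simp
qed auto

context metric_frame
begin

text \<open>For tangle formulas, the image under \<open>f\<close> of a witness in the space is a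
  witness in the frame, and the preimage of a witness in the frame is one in the space. Surjectivity
  enters through the universal modality.\<close>

lemma truth_dmor:
  fixes lb :: "'w \<Rightarrow> 'v fm set"
  assumes f: "dmor M f" "f ` M = W" and h: "\<And>p. h p = {x \<in> M. Atom p \<in> lb (f x)}"
    and Top: "\<And>a. Top \<in> \<Phi> \<Longrightarrow> a \<in> W \<Longrightarrow> Top \<in> lb a"
    and Neg: "\<And>a \<psi>. \<^bold>\<not> \<psi> \<in> \<Phi> \<Longrightarrow> a \<in> W \<Longrightarrow> \<^bold>\<not> \<psi> \<in> lb a \<longleftrightarrow> \<psi> \<notin> lb a"
    and Conj: "\<And>a \<psi> \<theta>. \<psi> \<^bold>\<and> \<theta> \<in> \<Phi> \<Longrightarrow> a \<in> W \<Longrightarrow> \<psi> \<^bold>\<and> \<theta> \<in> lb a \<longleftrightarrow> \<psi> \<in> lb a \<and> \<theta> \<in> lb a"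
    and Box: "\<And>a \<psi>. \<^bold>[d\<^bold>] \<psi> \<in> \<Phi> \<Longrightarrow> a \<in> W \<Longrightarrow> \<^bold>[d\<^bold>] \<psi> \<in> lb a \<longleftrightarrow> (\<forall>b. R a b \<longrightarrow> \<psi> \<in> lb b)"
    and Univ: "\<And>a \<psi>. \<^bold>\<forall> \<psi> \<in> \<Phi> \<Longrightarrow> a \<in> W \<Longrightarrow> \<^bold>\<forall> \<psi> \<in> lb a \<longleftrightarrow> (\<forall>b\<in>W. \<psi> \<in> lb b)"
    and Tangle: "\<And>a \<Gamma>. \<^bold>\<langle>dt\<^bold>\<rangle> \<Gamma> \<in> \<Phi> \<Longrightarrow> a \<in> W \<Longrightarrow> \<^bold>\<langle>dt\<^bold>\<rangle> \<Gamma> \<in> lb a \<longleftrightarrow>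
        (\<exists>S\<subseteq>W. a \<in> S \<and> (\<forall>b\<in>S. \<forall>\<gamma>. \<gamma> |\<in>| \<Gamma> \<longrightarrow> (\<exists>c\<in>S. R b c \<and> \<gamma> \<in> lb c)))"
    and "sub \<psi> \<subseteq> \<Phi>" "x \<in> M"
  shows "truth mtopology h x \<psi> \<longleftrightarrow> \<psi> \<in> lb (f x)"
proof -
  have fW: "f x \<in> W" and cf: "clusters M f x (up (f x))" if "x \<in> M" for x
    using f(1) that unfolding dmor_def by blast+
  have opM: "y \<in> M" if "opn U" "y \<in> U" for U y
    using opn_subset that by blast
  show ?thesis
    using assms(10,11)
  proof (induction \<psi> arbitrary: x)
    case (Box \<psi>)
    have B: "\<^bold>[d\<^bold>] \<psi> \<in> \<Phi>" using Box.prems(1) by simp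
    have IH: "truth mtopology h y \<psi> \<longleftrightarrow> \<psi> \<in> lb (f y)" if "y \<in> M" for y
      using Box that by simp
    show ?case
    proof
      assume "truth mtopology h x (\<^bold>[d\<^bold>] \<psi>)"
      then obtain U where U: "opn U" "x \<in> U" "\<forall>y\<in>U - {x}. truth mtopology h y \<psi>" by auto
      have "\<psi> \<in> lb b" if b: "R (f x) b" for b
      proof -
        obtain y where "y \<in> U \<inter> M - {x}" "f y = b"
          using clusters_hit[OF cf[OF Box.prems(2)] _ U(1,2), of b] b by blast
        then show ?thesis using U(3) IH by auto
      qed
      then show "\<^bold>[d\<^bold>] \<psi> \<in> lb (f x)"
        using assms(7)[OF B fW[OF Box.prems(2)]] by blast
    next
      assume "\<^bold>[d\<^bold>] \<psi> \<in> lb (f x)"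
      then have r: "\<psi> \<in> lb b" if "R (f x) b" for b
        using assms(7)[OF B fW[OF Box.prems(2)]] that by blast
      obtain N where N: "opn N" "x \<in> N" "\<forall>y\<in>N \<inter> M - {x}. f y \<in> up (f x)"
        using clusters_nearby[OF cf[OF Box.prems(2)]] by blast
      have "\<forall>y\<in>N - {x}. truth mtopology h y \<psi>"
      proof
        fix y assume y: "y \<in> N - {x}"
        then have "y \<in> M" using opM N(1) by blast
        then have "R (f x) (f y)" using N(3) y by blast
        then show "truth mtopology h y \<psi>" using r IH[OF \<open>y \<in> M\<close>] by blast
      qed
      then show "truth mtopology h x (\<^bold>[d\<^bold>] \<psi>)" using N(1,2) by auto
    qed
  next
    case (Univ \<psi>)
    have B: "\<^bold>\<forall> \<psi> \<in> \<Phi>" using Univ.prems(1) by simp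
    have IH: "truth mtopology h y \<psi> \<longleftrightarrow> \<psi> \<in> lb (f y)" if "y \<in> M" for y
      using Univ that by simp
    have "(\<forall>y\<in>M. \<psi> \<in> lb (f y)) \<longleftrightarrow> (\<forall>b\<in>W. \<psi> \<in> lb b)"
      unfolding f(2)[symmetric] by blast
    then show ?case
      using IH assms(8)[OF B fW[OF Univ.prems(2)]] by simp
  next
    case (Tangle \<Gamma>)
    have B: "\<^bold>\<langle>dt\<^bold>\<rangle> \<Gamma> \<in> \<Phi>" using Tangle.prems(1) by simp
    have IH: "truth mtopology h y \<gamma> \<longleftrightarrow> \<gamma> \<in> lb (f y)" if "\<gamma> |\<in>| \<Gamma>" "y \<in> M" for y \<gamma>
    proof -
      have "sub \<gamma> \<subseteq> \<Phi>" using Tangle.prems(1) that(1) by auto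
      then show ?thesis using Tangle.IH that by blast
    qed
    show ?case
    proof
      assume "truth mtopology h x (\<^bold>\<langle>dt\<^bold>\<rangle> \<Gamma>)"
      then obtain S where S: "S \<subseteq> M" "x \<in> S"
        "\<forall>\<delta>|\<in>|\<Gamma>. S \<subseteq> mtopology derived_set_of ({y \<in> M. truth mtopology h y \<delta>} \<inter> S)"
        by auto
      have "\<exists>c\<in>f ` S. R b c \<and> \<gamma> \<in> lb c" if b: "b \<in> f ` S" and \<gamma>: "\<gamma> |\<in>| \<Gamma>" for b \<gamma>
      proof -
        obtain y where y: "y \<in> S" "b = f y" using b by blast
        have yM: "y \<in> M" using y S(1) by blast
        obtain N where N: "opn N" "y \<in> N" "\<forall>z\<in>N \<inter> M - {y}. f z \<in> up (f y)"
          using clusters_nearby[OF cf[OF yM]] by blast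
        have "y \<in> mtopology derived_set_of ({y \<in> M. truth mtopology h y \<gamma>} \<inter> S)"
          using S(3) \<gamma> y(1) by blast
        then obtain z where z: "z \<noteq> y" "z \<in> M" "truth mtopology h z \<gamma>" "z \<in> S" "z \<in> N"
          using N(1,2) unfolding in_derived_set_of by blast
        then have "R b (f z)" "\<gamma> \<in> lb (f z)" using N(3) y(2) IH[OF \<gamma>] by auto
        then show ?thesis using z(4) by blast
      qed
      moreover have "f ` S \<subseteq> W" "f x \<in> f ` S" using S f(2) by auto
      ultimately show "\<^bold>\<langle>dt\<^bold>\<rangle> \<Gamma> \<in> lb (f x)"
        using assms(9)[OF B fW[OF Tangle.prems(2)]] by metis
    next
      assume "\<^bold>\<langle>dt\<^bold>\<rangle> \<Gamma> \<in> lb (f x)"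
      then obtain S where S: "S \<subseteq> W" "f x \<in> S" "\<And>b \<gamma>. b \<in> S \<Longrightarrow> \<gamma> |\<in>| \<Gamma> \<Longrightarrow> \<exists>c\<in>S. R b c \<and> \<gamma> \<in> lb c"
        using assms(9)[OF B fW[OF Tangle.prems(2)]] by metis
      define S' where "S' = {y \<in> M. f y \<in> S}"
      have "y \<in> mtopology derived_set_of ({y \<in> M. truth mtopology h y \<gamma>} \<inter> S')"
        if y: "y \<in> S'" and \<gamma>: "\<gamma> |\<in>| \<Gamma>" for y \<gamma>
        unfolding in_derived_set_of
      proof (intro conjI allI impI)
        show "y \<in> topspace mtopology" using y by (simp add: S'_def)
        fix U assume U: "y \<in> U \<and> opn U"
        obtain c where c: "c \<in> S" "R (f y) c" "\<gamma> \<in> lb c"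
          using S(3) y \<gamma> unfolding S'_def by blast
        have yM: "y \<in> M" using y by (simp add: S'_def)
        obtain z where "z \<in> U \<inter> M - {y}" "f z = c"
          using clusters_hit[OF cf[OF yM], of c U] c U by blast
        then show "\<exists>z. z \<noteq> y \<and> z \<in> {y \<in> M. truth mtopology h y \<gamma>} \<inter> S' \<and> z \<in> U"
          using c IH[OF \<gamma>] unfolding S'_def by auto
      qed
      moreover have "S' \<subseteq> M" "x \<in> S'" using S(2) Tangle.prems(2) unfolding S'_def by auto
      ultimately show "truth mtopology h x (\<^bold>\<langle>dt\<^bold>\<rangle> \<Gamma>)"
        by (simp del: in_derived_set_of) blast
    qed
  next
    case (Neg \<psi>)
    then show ?case using assms(5)[of \<psi> "f x"] fW by simp
  next
    case (Conj \<psi> \<theta>)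
    then show ?case using assms(6)[of \<psi> \<theta> "f x"] fW by simp
  next
    case Top
    then show ?case using assms(4)[of "f x"] fW by simp
  next
    case (Atom p)
    then show ?case using h by simp
  qed
qed

end

context tangle_logic
begin

lemma sub_L: "\<phi> \<in> L \<Longrightarrow> sub \<phi> \<subseteq> L"
proof (induction \<phi>)
  case (Tangle \<Gamma>)
  then show ?case using Tangle_L by fastforce
qed auto

definition definable :: "'v fm set set \<Rightarrow> ('v fm set \<Rightarrow> bool) \<Rightarrow> bool" where
  "definable N P \<longleftrightarrow> (\<exists>\<alpha>\<in>L. \<forall>x\<in>N. P x \<longleftrightarrow> \<alpha> \<in> x)"

lemma definableI: "\<alpha> \<in> L \<Longrightarrow> (\<And>x. x \<in> N \<Longrightarrow> P x \<longleftrightarrow> \<alpha> \<in> x) \<Longrightarrow> definable N P"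
  unfolding definable_def by blast

lemma definableE:
  assumes "definable N P"
  obtains \<alpha> where "\<alpha> \<in> L" "\<And>x. x \<in> N \<Longrightarrow> P x \<longleftrightarrow> \<alpha> \<in> x"
  using assms unfolding definable_def by auto

lemma definable_mem: "\<alpha> \<in> L \<Longrightarrow> definable N (\<lambda>x. \<alpha> \<in> x)"
  by (rule definableI) simp_all

lemma definable_not:
  assumes "N \<subseteq> {x. mcs x}" "definable N P"
  shows "definable N (\<lambda>x. \<not> P x)"
proof -
  obtain \<alpha> where \<alpha>: "\<alpha> \<in> L" "\<And>x. x \<in> N \<Longrightarrow> P x \<longleftrightarrow> \<alpha> \<in> x"
    using assms(2) by (rule definableE) (rule that)
  show ?thesis
    by (rule definableI[of "\<^bold>\<not> \<alpha>"]) (use assms(1) \<alpha> mcs_Neg[of _ \<alpha>] in auto)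
qed

lemma definable_conj:
  assumes "N \<subseteq> {x. mcs x}" "definable N P" "definable N Q"
  shows "definable N (\<lambda>x. P x \<and> Q x)"
proof -
  obtain \<alpha> where \<alpha>: "\<alpha> \<in> L" "\<And>x. x \<in> N \<Longrightarrow> P x \<longleftrightarrow> \<alpha> \<in> x"
    using assms(2) by (rule definableE) (rule that)
  obtain \<beta> where \<beta>: "\<beta> \<in> L" "\<And>x. x \<in> N \<Longrightarrow> Q x \<longleftrightarrow> \<beta> \<in> x"
    using assms(3) by (rule definableE) (rule that)
  show ?thesis
    by (rule definableI[of "\<alpha> \<^bold>\<and> \<beta>"]) (use assms(1) \<alpha> \<beta> mcs_Conj[of _ \<alpha> \<beta>] in auto)
qed

lemma definable_const:
  assumes "N \<subseteq> {x. mcs x}"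
  shows "definable N (\<lambda>x. b)"
proof -
  have "definable N (\<lambda>x. True)"
    by (rule definableI[of Top]) (use assms mcs_Top in auto)
  then show ?thesis
    using definable_not[OF assms, of "\<lambda>x. True"] by (cases b) simp_all
qed

lemma definable_type:
  assumes N: "N \<subseteq> {x. mcs x}" and "finite \<Phi>" "\<Phi> \<subseteq> L"
  shows "definable N (\<lambda>x. x \<inter> \<Phi> = s)"
proof -
  have "definable N (\<lambda>x. \<forall>\<psi>\<in>\<Phi>. \<psi> \<in> x \<longleftrightarrow> \<psi> \<in> s)"
    using assms(2,3)
  proof (induction \<Phi> rule: finite_induct)
    case empty
    then show ?case using definable_const[OF N, of True] by simp
  next
    case (insert \<psi> F)
    have "definable N (\<lambda>x. \<psi> \<in> x \<longleftrightarrow> \<psi> \<in> s)"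
      using insert.prems definable_mem[of \<psi>] definable_not[OF N definable_mem[of \<psi>]] by (cases "\<psi> \<in> s") auto
    then show ?case
      using insert definable_conj[OF N, of "\<lambda>x. \<psi> \<in> x \<longleftrightarrow> \<psi> \<in> s"] by simp
  qed
  then have "definable N (\<lambda>x. (\<forall>\<psi>\<in>\<Phi>. \<psi> \<in> x \<longleftrightarrow> \<psi> \<in> s) \<and> s \<subseteq> \<Phi>)"
    by (rule definable_conj[OF N _ definable_const[OF N]])
  moreover have "(\<forall>\<psi>\<in>\<Phi>. \<psi> \<in> x \<longleftrightarrow> \<psi> \<in> s) \<and> s \<subseteq> \<Phi> \<longleftrightarrow> x \<inter> \<Phi> = s" for x
    by blast
  ultimately show ?thesis by simp
qed

text \<open>Points are restricted to those with the same universal formulas as \<open>x0\<close>.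
  The conjunct \<open>R_univ x0 x\<close> restricts \<open>R\<close> to them; its targets are again
  such points by (U).\<close>

lemma canonical_tangle_points:
  assumes x0: "mcs x0" and \<phi>: "\<phi> \<in> L"
  shows "tangle_points {x. R_univ x0 x} (\<lambda>x y. R_univ x0 x \<and> R x y) (definable {x. R_univ x0 x}) (\<lambda>x. x \<inter> sub \<phi>) (sub \<phi>)"
proof
  let ?N = "{x. R_univ x0 x}"
  have N: "?N \<subseteq> {x. mcs x}" by (auto simp: R_univ_def)
  have R_N: "R_univ x0 y" if "R_univ x0 x" "R x y" for x y
    using R_univ_trans R_imp_R_univ that by blast
  have fin: "finite (sub \<phi>)" and L: "sub \<phi> \<subseteq> L"
    using finite_sub sub_L \<phi> by auto
  have mem: "\<theta> \<in> sub \<phi>" if "\<psi> \<in> sub \<phi>" "\<theta> \<in> sub \<psi>" for \<psi> \<theta>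
    using sub_trans that by blast
  show "?N \<noteq> {}" using R_univ_refl[OF x0] by blast
  show "R_univ x0 x \<and> R x y \<Longrightarrow> x \<in> ?N \<and> y \<in> ?N" for x y using R_N by blast
  show "R_univ x0 x \<and> R x y \<Longrightarrow> R_univ x0 y \<and> R y z \<Longrightarrow> R_univ x0 x \<and> R x z" for x y z
    using R_trans by blast
  show "x \<in> ?N \<Longrightarrow> \<exists>y. R_univ x0 x \<and> R x y" for x using R_serial N by blast
  show "finite ((\<lambda>x. x \<inter> sub \<phi>) ` ?N)"
    by (rule finite_subset[of _ "Pow (sub \<phi>)"]) (use fin in auto)
  show "definable ?N (\<lambda>x. x \<inter> sub \<phi> = s)" for s
    by (rule definable_type[OF N fin L])
  show "definable ?N P \<Longrightarrow> definable ?N (\<lambda>x. \<not> P x)" for P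
    by (rule definable_not[OF N])
  show "definable ?N P \<Longrightarrow> definable ?N Q \<Longrightarrow> definable ?N (\<lambda>x. P x \<and> Q x)" for P Q
    by (rule definable_conj[OF N])
  show "definable ?N (\<lambda>x. \<exists>y. (R_univ x0 x \<and> R x y) \<and> P y)" if P: "definable ?N P" for P
  proof -
    obtain \<alpha> where \<alpha>: "\<alpha> \<in> L" "\<And>x. x \<in> ?N \<Longrightarrow> P x \<longleftrightarrow> \<alpha> \<in> x"
      using P by (rule definableE) (rule that)
    have "(\<exists>y. (R_univ x0 x \<and> R x y) \<and> P y) \<longleftrightarrow> \<^bold>\<langle>d\<^bold>\<rangle> \<alpha> \<in> x" if x: "x \<in> ?N" for x
      using mcs_Dia[of x \<alpha>] N x \<alpha> R_N by blast
    moreover have "\<^bold>\<langle>d\<^bold>\<rangle> \<alpha> \<in> L" using \<alpha> by simp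
    ultimately show ?thesis by (intro definableI)
  qed
  show "definable ?N P \<Longrightarrow> (\<And>x. x \<in> ?N \<Longrightarrow> P x \<longleftrightarrow> Q x) \<Longrightarrow> definable ?N Q" for P Q
    unfolding definable_def by blast
  show "P y \<longleftrightarrow> P y'" if P: "definable ?N P" and x: "x \<in> ?N"
    and step: "\<And>y z. R_univ x0 x \<and> R x y \<Longrightarrow> R_univ x0 y \<and> R y z \<Longrightarrow> P y \<longleftrightarrow> P z"
    and y: "R_univ x0 x \<and> R x y" "R_univ x0 x \<and> R x y'" for P x y y'
  proof -
    obtain \<alpha> where \<alpha>: "\<alpha> \<in> L" "\<And>x. x \<in> ?N \<Longrightarrow> P x \<longleftrightarrow> \<alpha> \<in> x"
      using P by (rule definableE) (rule that)
    have "\<alpha> \<in> y \<longleftrightarrow> \<alpha> \<in> y'"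
    proof (rule mcs_G1[of x])
      show "mcs x" using x N by blast
      fix u v assume uv: "R x u" "R u v"
      then have "u \<in> ?N" "v \<in> ?N" using R_N x by blast+
      then show "\<alpha> \<in> u \<longleftrightarrow> \<alpha> \<in> v" using step[of u v] uv x \<alpha>(2)[of u] \<alpha>(2)[of v] by blast
    qed (use \<alpha>(1) y in auto)
    then show ?thesis using \<alpha>(2)[of y] \<alpha>(2)[of y'] y R_N by blast
  qed
  show "P y \<longleftrightarrow> P y'" if P: "definable ?N P"
    and step: "\<And>y z. R_univ x0 y \<and> R y z \<Longrightarrow> P y \<longleftrightarrow> P z" and y: "y \<in> ?N" "y' \<in> ?N" for P y y'
  proof -
    obtain \<alpha> where \<alpha>: "\<alpha> \<in> L" "\<And>x. x \<in> ?N \<Longrightarrow> P x \<longleftrightarrow> \<alpha> \<in> x"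
      using P by (rule definableE) (rule that)
    have "\<alpha> \<in> y \<longleftrightarrow> \<alpha> \<in> y'"
    proof (rule mcs_C[OF x0])
      fix u v assume uv: "R_univ x0 u" "R u v"
      then have "u \<in> ?N" "v \<in> ?N" using R_N by blast+
      then show "\<alpha> \<in> u \<longleftrightarrow> \<alpha> \<in> v" using step[of u v] uv \<alpha>(2)[of u] \<alpha>(2)[of v] by blast
    qed (use \<alpha>(1) y in auto)
    then show ?thesis using \<alpha>(2)[of y] \<alpha>(2)[of y'] y by blast
  qed
  show "\<^bold>[d\<^bold>] \<psi> \<in> x \<inter> sub \<phi> \<longleftrightarrow> (\<forall>y. R_univ x0 x \<and> R x y \<longrightarrow> \<psi> \<in> y \<inter> sub \<phi>)"
    if "\<^bold>[d\<^bold>] \<psi> \<in> sub \<phi>" "x \<in> ?N" for \<psi> x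
  proof -
    have "\<psi> \<in> sub \<phi>" using mem[OF that(1)] sub_refl[of \<psi>] by simp
    moreover from this have "\<^bold>[d\<^bold>] \<psi> \<in> x \<longleftrightarrow> (\<forall>y. R x y \<longrightarrow> \<psi> \<in> y)"
      using mcs_Box[of x \<psi>] that(2) N L by blast
    ultimately show ?thesis using that by simp
  qed
  show "\<exists>y. (R_univ x0 x \<and> R x y) \<and> \<gamma> \<in> y \<inter> sub \<phi> \<and> \<^bold>\<langle>dt\<^bold>\<rangle> \<Gamma> \<in> y \<inter> sub \<phi>"
    if h: "\<^bold>\<langle>dt\<^bold>\<rangle> \<Gamma> \<in> x \<inter> sub \<phi>" "x \<in> ?N" "\<gamma> |\<in>| \<Gamma>" for \<Gamma> x \<gamma>
  proof -
    have "\<gamma> \<in> sub (\<^bold>\<langle>dt\<^bold>\<rangle> \<Gamma>)" using that(3) sub_refl[of \<gamma>] by auto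
    then have "\<gamma> \<in> sub \<phi>" using mem that(1) by blast
    moreover obtain y where "R x y" "\<gamma> \<in> y" "\<^bold>\<langle>dt\<^bold>\<rangle> \<Gamma> \<in> y"
      using mcs_Fix[of x \<Gamma> \<gamma>] h N by blast
    ultimately show ?thesis using that by blast
  qed
  show "\<^bold>\<langle>dt\<^bold>\<rangle> \<Gamma> \<in> x \<inter> sub \<phi>"
    if \<Gamma>: "\<^bold>\<langle>dt\<^bold>\<rangle> \<Gamma> \<in> sub \<phi>" and P: "definable ?N P" and x: "x \<in> ?N" "P x"
      and step: "\<And>y \<gamma>. y = x \<or> R_univ x0 x \<and> R x y \<Longrightarrow> P y \<Longrightarrow> \<gamma> |\<in>| \<Gamma> \<Longrightarrow>
        \<exists>z. (R_univ x0 y \<and> R y z) \<and> \<gamma> \<in> z \<inter> sub \<phi> \<and> P z" for \<Gamma> P x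
  proof -
    obtain \<alpha> where \<alpha>: "\<alpha> \<in> L" "\<And>x. x \<in> ?N \<Longrightarrow> P x \<longleftrightarrow> \<alpha> \<in> x"
      using P by (rule definableE) (rule that)
    have "\<^bold>\<langle>dt\<^bold>\<rangle> \<Gamma> \<in> x"
    proof (rule mcs_Ind)
      show "mcs x" "\<^bold>\<langle>dt\<^bold>\<rangle> \<Gamma> \<in> L" "\<alpha> \<in> L" "\<alpha> \<in> x" using x N L \<Gamma> \<alpha> by auto
      fix y \<gamma> assume y: "y = x \<or> R x y" "\<alpha> \<in> y" "\<gamma> |\<in>| \<Gamma>"
      have yN: "y \<in> ?N" using y(1) x(1) R_N by blast
      then obtain z where "R y z" "\<gamma> \<in> z" "P z" using step[of y \<gamma>] y x(1) \<alpha>(2)[OF yN] by blast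
      then show "\<exists>z. R y z \<and> \<gamma> \<in> z \<and> \<alpha> \<in> z" using \<alpha>(2)[of z] R_N yN by blast
    qed
    then show ?thesis using \<Gamma> by blast
  qed
  show "\<^bold>\<langle>dt\<^bold>\<rangle> \<Gamma> \<in> sub \<phi> \<Longrightarrow> \<Gamma> \<noteq> {||}" for \<Gamma> using Tangle_L_nonempty L by blast
qed

theorem complete:
  fixes M :: "'x set" and d :: "'x \<Rightarrow> 'x \<Rightarrow> real"
  assumes "Metric_space M d" "M \<noteq> {}" "dense_in_itself (Metric_space.mtopology M d)"
    and \<phi>: "\<phi> \<in> L" "valid (Metric_space.mtopology M d) \<phi>"
  shows "\<phi> \<in> Th"
proof (rule ccontr)
  assume "\<phi> \<notin> Th"
  then obtain x0 where x0: "mcs x0" "\<phi> \<notin> x0"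
    by (rule Lindenbaum[OF closed_theory_Th \<phi>(1)])
  let ?N = "{x. R_univ x0 x}"
  interpret tp: tangle_points ?N "\<lambda>x y. R_univ x0 x \<and> R x y" "definable ?N" "\<lambda>x. x \<inter> sub \<phi>" "sub \<phi>"
    by (rule canonical_tangle_points[OF x0(1) \<phi>(1)])
  interpret Metric_space M d by fact
  interpret dm: dense_metric M d
  proof
    fix U x assume U: "openin mtopology U" "x \<in> U"
    have "U \<noteq> {x}"
    proof
      assume "U = {x}"
      then show False
        using U assms(3) openin_subset[OF U(1)] unfolding dense_in_itself_def by auto
    qed
    then show "\<exists>y\<in>U. y \<noteq> x" using U(2) by blast
  qed
  interpret mg: metric_good_frame M d tp.W tp.R' ..
  obtain f where f: "mg.dmor M f" "f ` M = tp.W"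
    using mg.dmor_onto_frame assms(2) by blast
  define h where "h p = {x \<in> M. Atom p \<in> lab (f x)}" for p
  have m: "mcs x" if "x \<in> ?N" for x using that by (auto simp: R_univ_def)
  have sL: "\<psi> \<in> L" if "\<psi> \<in> sub \<phi>" for \<psi> using sub_L[OF \<phi>(1)] that by blast
  have mem: "\<theta> \<in> sub \<phi>" if "\<psi> \<in> sub \<phi>" "\<theta> \<in> sub \<psi>" for \<psi> \<theta>
    using sub_trans that by blast
  have tl: "truth mtopology h x \<phi> \<longleftrightarrow> \<phi> \<in> lab (f x)" if x: "x \<in> M" for x
  proof (rule mg.truth_dmor[OF f])
    show "h p = {x \<in> M. Atom p \<in> lab (f x)}" for p by (rule h_def)
    fix a assume a: "a \<in> tp.W"
    obtain y where y: "y \<in> ?N" "y \<inter> sub \<phi> = lab a" using tp.realizer[OF a] by blast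
    note my = m[OF y(1)]
    show "Top \<in> sub \<phi> \<Longrightarrow> Top \<in> lab a" using y(2) mcs_Top[OF my] by blast
    show "\<^bold>\<not> \<psi> \<in> lab a \<longleftrightarrow> \<psi> \<notin> lab a" if "\<^bold>\<not> \<psi> \<in> sub \<phi>" for \<psi>
    proof -
      have "\<psi> \<in> sub \<phi>" using mem[OF that] sub_refl[of \<psi>] by simp
      then show ?thesis using y(2)[symmetric] mcs_Neg[OF my, of \<psi>] sL that by simp
    qed
    show "\<psi> \<^bold>\<and> \<theta> \<in> lab a \<longleftrightarrow> \<psi> \<in> lab a \<and> \<theta> \<in> lab a" if "\<psi> \<^bold>\<and> \<theta> \<in> sub \<phi>" for \<psi> \<theta>
    proof -
      have "\<psi> \<in> sub \<phi>" "\<theta> \<in> sub \<phi>" using mem[OF that] sub_refl[of \<psi>] sub_refl[of \<theta>] by simp_all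
      then show ?thesis using y(2)[symmetric] mcs_Conj[OF my, of \<psi> \<theta>] sL that by simp
    qed
    show "\<^bold>[d\<^bold>] \<psi> \<in> lab a \<longleftrightarrow> (\<forall>b. tp.R' a b \<longrightarrow> \<psi> \<in> lab b)" if "\<^bold>[d\<^bold>] \<psi> \<in> sub \<phi>" for \<psi>
      by (rule tp.lab_Box[OF that a])
    show "\<^bold>\<langle>dt\<^bold>\<rangle> \<Gamma> \<in> lab a \<longleftrightarrow> (\<exists>S\<subseteq>tp.W. a \<in> S \<and> (\<forall>b\<in>S. \<forall>\<gamma>. \<gamma> |\<in>| \<Gamma> \<longrightarrow> (\<exists>c\<in>S. tp.R' b c \<and> \<gamma> \<in> lab c)))"
      if "\<^bold>\<langle>dt\<^bold>\<rangle> \<Gamma> \<in> sub \<phi>" for \<Gamma>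
      by (rule tp.lab_Tangle[OF that a])
    show "\<^bold>\<forall> \<psi> \<in> lab a \<longleftrightarrow> (\<forall>b\<in>tp.W. \<psi> \<in> lab b)" if \<psi>: "\<^bold>\<forall> \<psi> \<in> sub \<phi>" for \<psi>
    proof -
      have s: "\<psi> \<in> sub \<phi>" using mem[OF \<psi>] sub_refl[of \<psi>] by simp
      have "\<^bold>\<forall> \<psi> \<in> lab a \<longleftrightarrow> (\<forall>z. R_univ y z \<longrightarrow> \<psi> \<in> z)"
        using y(2) \<psi> mcs_Univ[OF my sL[OF s]] by blast
      also have "\<dots> \<longleftrightarrow> (\<forall>z\<in>?N. \<psi> \<in> z)"
        using y(1) R_univ_trans R_univ_sym by blast
      also have "\<dots> \<longleftrightarrow> (\<forall>b\<in>tp.W. \<psi> \<in> lab b)"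
      proof
        assume l: "\<forall>z\<in>?N. \<psi> \<in> z"
        show "\<forall>b\<in>tp.W. \<psi> \<in> lab b"
        proof
          fix b assume "b \<in> tp.W"
          then obtain z where "z \<in> ?N" "z \<inter> sub \<phi> = lab b" using tp.realizer by blast
          then show "\<psi> \<in> lab b" using l s by blast
        qed
      next
        assume r: "\<forall>b\<in>tp.W. \<psi> \<in> lab b"
        show "\<forall>z\<in>?N. \<psi> \<in> z"
        proof
          fix z assume "z \<in> ?N"
          then obtain b where "b \<in> tp.W" "lab b = z \<inter> sub \<phi>" using tp.type_represented by blast
          then show "\<psi> \<in> z" using r by blast
        qed
      qed
      finally show ?thesis .
    qed
  qed (use x in auto)
  obtain a where "a \<in> tp.W" "lab a = x0 \<inter> sub \<phi>"
    using tp.type_represented[of x0] R_univ_refl[OF x0(1)] by blast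
  then obtain x where "x \<in> M" "lab (f x) = x0 \<inter> sub \<phi>"
    using f(2) by (metis imageE)
  then have "\<not> truth mtopology h x \<phi>"
    using tl x0(2) by blast
  moreover have "\<forall>p. h p \<subseteq> topspace mtopology"
    by (auto simp: h_def)
  ultimately show False
    using \<phi>(2) \<open>x \<in> M\<close> unfolding valid_def by auto
qed

end

lemma thms_mono:
  assumes "A \<inter> L \<subseteq> B" "\<phi> \<in> thms L A"
  shows "\<phi> \<in> thms L B"
  using assms(2) by induction (use assms(1) in \<open>auto intro: thms.intros\<close>)

lemma thms_cong: "A \<inter> L = B \<inter> L \<Longrightarrow> thms L A = thms L B"
  using thms_mono[of A L B] thms_mono[of B L A] by blast

lemma KD4G1t_UC_eq: "KD4G1t_UC = thms lang_dt full_axioms"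
  by (simp add: KD4G1t_UC_def full_axioms_def)

lemma lang_d_iff [simp]:
  "Top \<in> lang_d" "\<^bold>\<not> \<phi> \<in> lang_d \<longleftrightarrow> \<phi> \<in> lang_d" "\<phi> \<^bold>\<and> \<psi> \<in> lang_d \<longleftrightarrow> \<phi> \<in> lang_d \<and> \<psi> \<in> lang_d"
  "\<^bold>[d\<^bold>] \<phi> \<in> lang_d \<longleftrightarrow> \<phi> \<in> lang_d" "\<^bold>\<forall> \<phi> \<in> lang_d \<longleftrightarrow> \<phi> \<in> lang_d" "\<^bold>\<langle>dt\<^bold>\<rangle> \<Delta> \<notin> lang_d"
  by (auto intro: lang_d.intros elim: lang_d.cases)

lemma lang_dt_iff [simp]:
  "Top \<in> lang_dt" "\<^bold>\<not> \<phi> \<in> lang_dt \<longleftrightarrow> \<phi> \<in> lang_dt" "\<phi> \<^bold>\<and> \<psi> \<in> lang_dt \<longleftrightarrow> \<phi> \<in> lang_dt \<and> \<psi> \<in> lang_dt"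
  "\<^bold>[d\<^bold>] \<phi> \<in> lang_dt \<longleftrightarrow> \<phi> \<in> lang_dt" "\<^bold>\<forall> \<phi> \<in> lang_dt \<longleftrightarrow> \<phi> \<in> lang_dt"
  by (auto intro: lang_dt.intros elim: lang_dt.cases)

text \<open>Every instance of (Fix) and of (Ind) contains a tangle formula, so it lies outside
  \<open>lang_d\<close> and the common axiom set yields the same theorems there.\<close>

lemma KD4G1_UC_eq: "KD4G1_UC = thms lang_d full_axioms"
proof -
  have "Fix_axioms \<inter> lang_d = {}" "Ind_axioms \<inter> lang_d = {}"
    by (auto simp: Fix_axioms_def Ind_axioms_def)
  then show ?thesis
    unfolding KD4G1_UC_def by (intro thms_cong) (auto simp: full_axioms_def)
qed

interpretation d: tangle_logic lang_d
  by unfold_locales auto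

interpretation dt: tangle_logic lang_dt
  by unfold_locales (auto elim: lang_dt.cases)

theorem theorem9p5:
  fixes M :: "'x set" and d :: "'x \<Rightarrow> 'x \<Rightarrow> real" and X :: "'x topology"
  assumes "Metric_space M d"
    and "X = Metric_space.mtopology M d"
    and "M \<noteq> {}"
    and "dense_in_itself X"
  shows "(complete_over X lang_d (KD4G1_UC :: 'v fm set) \<and>
          (connected_space X \<and> validates X (G1 \<inter> lang_d :: 'v fm set) \<longrightarrow>
             sound_over X (KD4G1_UC :: 'v fm set))) \<and>
         (complete_over X lang_dt (KD4G1t_UC :: 'v fm set) \<and>
          (connected_space X \<and> validates X (G1 \<inter> lang_dt :: 'v fm set) \<longrightarrow>
             sound_over X (KD4G1t_UC :: 'v fm set)))"
proof -
  have "t1_space X"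
    using Metric_space.Hausdorff_space_mtopology[OF assms(1)] assms(2) Hausdorff_imp_t1_space by blast
  then have "sound_over X (thms L full_axioms)" if "connected_space X" "validates X (G1 \<inter> L)" for L :: "'v fm set"
    using sound assms(4) that unfolding sound_over_def by blast
  moreover have "complete_over X lang_d (KD4G1_UC :: 'v fm set)" "complete_over X lang_dt (KD4G1t_UC :: 'v fm set)"
    using d.complete dt.complete assms unfolding complete_over_def KD4G1_UC_eq KD4G1t_UC_eq by blast+
  ultimately show ?thesis
    unfolding KD4G1_UC_eq KD4G1t_UC_eq by blast
qed

end
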